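(* Let $(\mathcal{V},\mathcal{E})$ be a finite directed graph whose adjacency matrix $M$ is irreducible and is not a permutation matrix, let $(X,\sigma)$ be the associated one-sided shift of finite type and let $G$ be the étale groupoid of $(X,\sigma)$. Let $\Omega$ be the set of equivalence classes $[V]$ of non-empty compact open $G$-sets $V$ such that $s(V)$ is a cylinder set, where $V_1$ and $V_2$ are equivalent provided $V_2=V_1U_{\mu,\nu}$ with $s(V_1)=C_\mu$ and $s(V_2)=C_\nu$. Define an action $\varphi:[[G]]\curvearrowright\Omega$ by $\varphi_\alpha([V])=[WV]$, where $W$ is the compact open $G$-set such that $\alpha=\pi_W$. Then the action $\varphi:[[G]]\curvearrowright\Omega$ is a zipper action. In particular, $[[G]]$ has the Haagerup property.
   Context: Étale groupoids: an étale groupoid is a second countable locally compact Hausdorff topological groupoid $G$ whose range map is a local homeomorphism. $G^{(0)}$ is the unit space, $s,r$ are the source and range maps, and $gh$ is defined when $s(g)=r(h)$. A $G$-set is a subset $U\subset G$ such that $r|U$ and $s|U$ are injective; for $G$-sets $U,V$, $UV=\{gg'\mid g\in U,\ g'\in V,\ s(g)=r(g')\}$. For an open $G$-set $U$, $\pi_U=r\circ(s|U)^{-1}:s(U)\to r(U)$. When $G^{(0)}$ is compact, the topological full group $[[G]]$ is the group of all $\alpha\in\mathrm{Homeo}(G^{(0)})$ for which there is a compact open $G$-set $U$ with $\alpha=\pi_U$ (so $s(U)=r(U)=G^{(0)}$); for the groupoids considered here (which are essentially principal, i.e. the interior of $\{g\in G\mid r(g)=s(g)\}$ is $G^{(0)}$)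 this $U$ is unique. Shifts of finite type: $\mathbb{N}=\{1,2,\dots\}$. For $e\in\mathcal{E}$, $i(e)$ and $t(e)$ are the initial and terminal vertices. $M(\xi,\eta)=\#\{e\in\mathcal{E}\mid i(e)=\xi,\ t(e)=\eta\}$; $M$ is irreducible if for all $\xi,\eta\in\mathcal{V}$ there is $n\in\mathbb{N}$ with $M^n(\xi,\eta)>0$. $X=\{(x_k)_{k\in\mathbb{N}}\in\mathcal{E}^{\mathbb{N}}\mid t(x_k)=i(x_{k+1})\ \forall k\}$ with the product topology (a Cantor set), and $\sigma:X\to X$, $\sigma(x)_k=x_{k+1}$. The étale groupoid of $(X,\sigma)$ is $G=\{(x,n,y)\in X\times\mathbb{Z}\times X\mid\exists k,l\in\mathbb{N},\ n=k-l,\ \sigma^k(x)=\sigma^l(y)\}$, with product $(x,n,y)(y,n',y')=(x,n+n',y')$, inverse $(x,n,y)^{-1}=(y,-n,x)$, and topology generated by the sets $\{(x,k-l,y)\in G\mid x\in A,\ y\in B,\ \sigma^k(x)=\sigma^l(y)\}$ for $A,B\subset X$ open and $k,l\in\mathbb{N}$. $X$ is identified with $G^{(0)}$ via $x\mapsto(x,0,x)$. A word is a finite sequence $\mu=(e_1,\dots,e_k)$ of edges, with length $|\mu|=k\ge1$ and $t(\mu)=t(e_k)$; it is admissible if $t(e_j)=i(e_{j+1})$ for $1\le j<k$. The cylinder set of $\mu$ is $C_\mu=\{(x_n)_n\in X\mid x_j=e_j,\ 1\le j\le k\}$. For words $\mu,\nu$ with $t(\mu)=t(\nu)$, $U_{\mu,\nu}=\{(x,|\mu|-|\nu|,y)\in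 G\mid\sigma^{|\mu|}(x)=\sigma^{|\nu|}(y),\ x\in C_\mu,\ y\in C_\nu\}$, a compact open $G$-set. Zipper actions: an action $\varphi$ of a discrete group $\Gamma$ on a set $\Omega$ is a zipper action if there is a subset $Z\subset\Omega$ such that (1) for every $\alpha\in\Gamma$ the symmetric difference $\varphi_\alpha(Z)\bigtriangleup Z$ is finite; (2) for every $r>0$, the set $\{\alpha\in\Gamma\mid\#(\varphi_\alpha(Z)\bigtriangleup Z)\leq r\}$ is finite. The Haagerup property means a-T-menability in the sense of Gromov. *)

theory Defs
  imports
    "HOL-Analysis.Analysis"
    "HOL-Algebra.Group_Action"
    "Graph_Theory.Digraph"
begin

section \<open>Topological groupoids and topological full groups\<close>

text \<open>
  The arrows are the points of the topology \<open>gtop\<close>. The operation \<open>gmult G g h\<close> is meaningful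
  only if \<open>gsource G g = grange G h\<close>.
\<close>

record 'g top_groupoid =
  gtop :: "'g topology"
  gmult :: "'g \<Rightarrow> 'g \<Rightarrow> 'g"
  ginv :: "'g \<Rightarrow> 'g"

definition gsource :: "('g, 'm) top_groupoid_scheme \<Rightarrow> 'g \<Rightarrow> 'g" where
  "gsource G g = gmult G (ginv G g) g"

definition grange :: "('g, 'm) top_groupoid_scheme \<Rightarrow> 'g \<Rightarrow> 'g" where
  "grange G g = gmult G g (ginv G g)"

definition gunits :: "('g, 'm) top_groupoid_scheme \<Rightarrow> 'g set" where
  "gunits G = gsource G ` topspace (gtop G)"

definition G_set :: "('g, 'm) top_groupoid_scheme \<Rightarrow> 'g set \<Rightarrow> bool" where
  "G_set G U \<longleftrightarrow>
     U \<subseteq> topspace (gtop G) \<and> inj_on (grange G) U \<and> inj_on (gsource G) U"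

definition compact_open_G_set :: "('g, 'm) top_groupoid_scheme \<Rightarrow> 'g set \<Rightarrow> bool" where
  "compact_open_G_set G U \<longleftrightarrow> G_set G U \<and> compactin (gtop G) U \<and> openin (gtop G) U"

definition gset_mult :: "('g, 'm) top_groupoid_scheme \<Rightarrow> 'g set \<Rightarrow> 'g set \<Rightarrow> 'g set" where
  "gset_mult G U V = {gmult G g h | g h. g \<in> U \<and> h \<in> V \<and> gsource G g = grange G h}"

definition gset_map :: "('g, 'm) top_groupoid_scheme \<Rightarrow> 'g set \<Rightarrow> 'g \<Rightarrow> 'g" where
  "gset_map G U = (\<lambda>x \<in> gsource G ` U. grange G (inv_into U (gsource G) x))"

text \<open>
  The compact open \<open>G\<close>-set \<open>W\<close> has full source and range, and \<open>\<alpha> = \<pi>\<^sub>W\<close>.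
\<close>

definition represents :: "('g, 'm) top_groupoid_scheme \<Rightarrow> 'g set \<Rightarrow> ('g \<Rightarrow> 'g) \<Rightarrow> bool" where
  "represents G W \<alpha> \<longleftrightarrow>
     compact_open_G_set G W \<and>
     gsource G ` W = gunits G \<and> grange G ` W = gunits G \<and> \<alpha> = gset_map G W"

text \<open>
  Homeomorphisms of the unit space are taken extensional (undefined off the unit space), as in
  \<^const>\<open>BijGroup\<close>, so that equality of functions is equality on the unit space.
\<close>

definition full_group :: "('g, 'm) top_groupoid_scheme \<Rightarrow> ('g \<Rightarrow> 'g) monoid" where
  "full_group G = (BijGroup (gunits G))
     \<lparr>carrier := {\<alpha> \<in> extensional (gunits G).
        homeomorphic_map (subtopology (gtop G) (gunits G)) (subtopology (gtop G) (gunits G)) \<alpha> \<and>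
        (\<exists>W. represents G W \<alpha>)}\<rparr>"


section \<open>Adjacency matrices\<close>

definition adjacency :: "('v, 'e) pre_digraph \<Rightarrow> 'v \<Rightarrow> 'v \<Rightarrow> nat" where
  "adjacency D \<xi> \<eta> = card {e \<in> arcs D. tail D e = \<xi> \<and> head D e = \<eta>}"

text \<open>Matrices whose rows and columns are indexed by the finite set \<open>I\<close>.\<close>

primrec matrix_power :: "'i set \<Rightarrow> ('i \<Rightarrow> 'i \<Rightarrow> nat) \<Rightarrow> nat \<Rightarrow> 'i \<Rightarrow> 'i \<Rightarrow> nat" where
  "matrix_power I M 0 = (\<lambda>\<xi> \<eta>. if \<xi> = \<eta> then 1 else 0)"
| "matrix_power I M (Suc n) = (\<lambda>\<xi> \<eta>. \<Sum>\<zeta>\<in>I. matrix_power I M n \<xi> \<zeta> * M \<zeta> \<eta>)"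

definition irreducible_matrix :: "'i set \<Rightarrow> ('i \<Rightarrow> 'i \<Rightarrow> nat) \<Rightarrow> bool" where
  "irreducible_matrix I M \<longleftrightarrow> (\<forall>\<xi>\<in>I. \<forall>\<eta>\<in>I. \<exists>n\<ge>1. matrix_power I M n \<xi> \<eta> > 0)"

definition permutation_matrix :: "'i set \<Rightarrow> ('i \<Rightarrow> 'i \<Rightarrow> nat) \<Rightarrow> bool" where
  "permutation_matrix I M \<longleftrightarrow>
     (\<exists>p. bij_betw p I I \<and> (\<forall>\<xi>\<in>I. \<forall>\<eta>\<in>I. M \<xi> \<eta> = (if \<eta> = p \<xi> then 1 else 0)))"


section \<open>The groupoid of a one-sided shift of finite type\<close>

text \<open>
  Sequences are indexed from \<open>0\<close>: \<open>x k\<close> is the letter written $x_{k+1}$ when indexing starts at 1.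
  Initial and terminal vertices of an edge are \<^const>\<open>tail\<close> and \<^const>\<open>head\<close>.
\<close>

definition sft :: "('v, 'e) pre_digraph \<Rightarrow> (nat \<Rightarrow> 'e) set" where
  "sft D = {x. \<forall>k. x k \<in> arcs D \<and> head D (x k) = tail D (x (Suc k))}"

definition sft_topology :: "('v, 'e) pre_digraph \<Rightarrow> (nat \<Rightarrow> 'e) topology" where
  "sft_topology D = subtopology (product_topology (\<lambda>_. discrete_topology (arcs D)) UNIV) (sft D)"

definition shift :: "(nat \<Rightarrow> 'e) \<Rightarrow> nat \<Rightarrow> 'e" where
  "shift x = (\<lambda>k. x (Suc k))"

type_synonym 'e sft_arrow = "(nat \<Rightarrow> 'e) \<times> int \<times> (nat \<Rightarrow> 'e)"

definition sft_arrows :: "('v, 'e) pre_digraph \<Rightarrow> 'e sft_arrow set" where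
  "sft_arrows D = {(x, n, y) | x n y. x \<in> sft D \<and> y \<in> sft D \<and>
     (\<exists>k\<ge>1. \<exists>l\<ge>1. n = int k - int l \<and> (shift ^^ k) x = (shift ^^ l) y)}"

definition sft_basic_set ::
  "('v, 'e) pre_digraph \<Rightarrow> nat \<Rightarrow> nat \<Rightarrow> (nat \<Rightarrow> 'e) set \<Rightarrow> (nat \<Rightarrow> 'e) set \<Rightarrow> 'e sft_arrow set" where
  "sft_basic_set D k l A B = {(x, n, y) \<in> sft_arrows D.
     n = int k - int l \<and> x \<in> A \<and> y \<in> B \<and> (shift ^^ k) x = (shift ^^ l) y}"

definition sft_groupoid :: "('v, 'e) pre_digraph \<Rightarrow> 'e sft_arrow top_groupoid" where
  "sft_groupoid D =
     \<lparr>gtop = topology_generated_by {sft_basic_set D k l A B | k l A B.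
        1 \<le> k \<and> 1 \<le> l \<and> openin (sft_topology D) A \<and> openin (sft_topology D) B},
      gmult = (\<lambda>(x, n, y) (y', n', z). (x, n + n', z)),
      ginv = (\<lambda>(x, n, y). (y, - n, x))\<rparr>"

lemma topspace_sft_topology: "topspace (sft_topology D) = sft D"
  by (auto simp: sft_topology_def sft_def)

lemma topspace_sft_groupoid: "topspace (gtop (sft_groupoid D)) = sft_arrows D"
proof -
  have "g \<in> \<Union>{sft_basic_set D k l A B | k l A B.
        1 \<le> k \<and> 1 \<le> l \<and> openin (sft_topology D) A \<and> openin (sft_topology D) B}"
    if "g \<in> sft_arrows D" for g
  proof -
    from that obtain x y k l where g: "g = (x, int k - int l, y)" "x \<in> sft D" "y \<in> sft D"
      "1 \<le> k" "1 \<le> l" "(shift ^^ k) x = (shift ^^ l) y"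
      unfolding sft_arrows_def by blast
    have "openin (sft_topology D) (sft D)"
      by (metis openin_topspace topspace_sft_topology)
    moreover have "g \<in> sft_basic_set D k l (sft D) (sft D)"
      using g that by (auto simp: sft_basic_set_def)
    ultimately show ?thesis using g(4,5) by blast
  qed
  moreover have "sft_basic_set D k l A B \<subseteq> sft_arrows D" for k l A B
    by (auto simp: sft_basic_set_def)
  ultimately show ?thesis
    unfolding sft_groupoid_def top_groupoid.simps topology_generated_by_topspace by blast
qed

lemma gsource_sft_groupoid: "gsource (sft_groupoid D) (x, n, y) = (y, 0, y)"
  and grange_sft_groupoid: "grange (sft_groupoid D) (x, n, y) = (x, 0, x)"
  by (simp_all add: gsource_def grange_def sft_groupoid_def)

text \<open>The identification of the shift space with the unit space.\<close>

definition sft_unit :: "(nat \<Rightarrow> 'e) \<Rightarrow> 'e sft_arrow" where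
  "sft_unit x = (x, 0, x)"

definition is_word :: "('v, 'e) pre_digraph \<Rightarrow> 'e list \<Rightarrow> bool" where
  "is_word D \<mu> \<longleftrightarrow> \<mu> \<noteq> [] \<and> set \<mu> \<subseteq> arcs D"

definition word_end :: "('v, 'e) pre_digraph \<Rightarrow> 'e list \<Rightarrow> 'v" where
  "word_end D \<mu> = head D (last \<mu>)"

definition cylinder :: "('v, 'e) pre_digraph \<Rightarrow> 'e list \<Rightarrow> (nat \<Rightarrow> 'e) set" where
  "cylinder D \<mu> = {x \<in> sft D. \<forall>j < length \<mu>. x j = \<mu> ! j}"

definition U_word :: "('v, 'e) pre_digraph \<Rightarrow> 'e list \<Rightarrow> 'e list \<Rightarrow> 'e sft_arrow set" where
  "U_word D \<mu> \<nu> = {(x, n, y) \<in> sft_arrows D.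
     n = int (length \<mu>) - int (length \<nu>) \<and>
     (shift ^^ length \<mu>) x = (shift ^^ length \<nu>) y \<and> x \<in> cylinder D \<mu> \<and> y \<in> cylinder D \<nu>}"


section \<open>The set of classes and the action\<close>

definition cylinder_G_sets :: "('v, 'e) pre_digraph \<Rightarrow> 'e sft_arrow set set" where
  "cylinder_G_sets D = {V. V \<noteq> {} \<and> compact_open_G_set (sft_groupoid D) V \<and>
     (\<exists>\<mu>. is_word D \<mu> \<and> gsource (sft_groupoid D) ` V = sft_unit ` cylinder D \<mu>)}"

definition cylinder_rel :: "('v, 'e) pre_digraph \<Rightarrow> ('e sft_arrow set \<times> 'e sft_arrow set) set" where
  "cylinder_rel D = {(V\<^sub>1, V\<^sub>2). V\<^sub>1 \<in> cylinder_G_sets D \<and> V\<^sub>2 \<in> cylinder_G_sets D \<and>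
     (\<exists>\<mu> \<nu>. is_word D \<mu> \<and> is_word D \<nu> \<and> word_end D \<mu> = word_end D \<nu> \<and>
        gsource (sft_groupoid D) ` V\<^sub>1 = sft_unit ` cylinder D \<mu> \<and>
        gsource (sft_groupoid D) ` V\<^sub>2 = sft_unit ` cylinder D \<nu> \<and>
        V\<^sub>2 = gset_mult (sft_groupoid D) V\<^sub>1 (U_word D \<mu> \<nu>))}"

definition cylinder_class :: "('v, 'e) pre_digraph \<Rightarrow> 'e sft_arrow set \<Rightarrow> 'e sft_arrow set set" where
  "cylinder_class D V = cylinder_rel D `` {V}"

definition Omega :: "('v, 'e) pre_digraph \<Rightarrow> 'e sft_arrow set set set" where
  "Omega D = cylinder_G_sets D // cylinder_rel D"

text \<open>
  \<open>Omega_action D \<alpha>\<close> sends \<open>[V]\<close> to \<open>[W V]\<close>, where \<open>\<alpha> = \<pi>\<^sub>W\<close>. The description is meaningful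
  only once \<open>[W V]\<close> is known not to depend on the choice of \<open>V\<close> in its class, nor on \<open>W\<close>.
\<close>

definition Omega_action ::
  "('v, 'e) pre_digraph \<Rightarrow> ('e sft_arrow \<Rightarrow> 'e sft_arrow) \<Rightarrow>
     'e sft_arrow set set \<Rightarrow> 'e sft_arrow set set" where
  "Omega_action D \<alpha> = (\<lambda>c \<in> Omega D. THE d. \<exists>V W. V \<in> c \<and> represents (sft_groupoid D) W \<alpha> \<and>
     d = cylinder_class D (gset_mult (sft_groupoid D) W V))"


section \<open>Zipper actions\<close>

definition zipper_action :: "('a, 'm) monoid_scheme \<Rightarrow> 'b set \<Rightarrow> ('a \<Rightarrow> 'b \<Rightarrow> 'b) \<Rightarrow> bool" where
  "zipper_action \<Gamma> \<Omega> \<phi> \<longleftrightarrow> group_action \<Gamma> \<Omega> \<phi> \<and>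
     (\<exists>Z \<subseteq> \<Omega>.
        (\<forall>\<alpha> \<in> carrier \<Gamma>. finite (sym_diff (\<phi> \<alpha> ` Z) Z)) \<and>
        (\<forall>r::real. r > 0 \<longrightarrow>
           finite {\<alpha> \<in> carrier \<Gamma>. real (card (sym_diff (\<phi> \<alpha> ` Z) Z)) \<le> r}))"


section \<open>The Hilbert space of square-summable real sequences\<close>

typedef ell2 = "{x :: nat \<Rightarrow> real. summable (\<lambda>i. (x i)\<^sup>2)}"
  morphisms ell2_nth Abs_ell2
  by (rule exI[of _ "\<lambda>_. 0"]) simp

setup_lifting type_definition_ell2

lemma summable_ell2_mult:
  fixes x y :: "nat \<Rightarrow> real"
  assumes "summable (\<lambda>i. (x i)\<^sup>2)" "summable (\<lambda>i. (y i)\<^sup>2)"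
  shows "summable (\<lambda>i. x i * y i)"
proof (rule summable_comparison_test')
  show "summable (\<lambda>i. (x i)\<^sup>2 + (y i)\<^sup>2)"
    using assms by (rule summable_add)
  show "norm (x i * y i) \<le> (x i)\<^sup>2 + (y i)\<^sup>2" if "i \<ge> 0" for i
  proof -
    have "0 \<le> (\<bar>x i\<bar> - \<bar>y i\<bar>)\<^sup>2" by simp
    then have "2 * (\<bar>x i\<bar> * \<bar>y i\<bar>) \<le> (x i)\<^sup>2 + (y i)\<^sup>2"
      by (simp add: power2_diff)
    moreover have "0 \<le> \<bar>x i\<bar> * \<bar>y i\<bar>" by simp
    ultimately have "\<bar>x i\<bar> * \<bar>y i\<bar> \<le> (x i)\<^sup>2 + (y i)\<^sup>2" by linarith
    then show ?thesis by (simp add: abs_mult)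
  qed
qed

lemma summable_ell2_add:
  fixes x y :: "nat \<Rightarrow> real"
  assumes "summable (\<lambda>i. (x i)\<^sup>2)" "summable (\<lambda>i. (y i)\<^sup>2)"
  shows "summable (\<lambda>i. (x i + y i)\<^sup>2)"
proof -
  have "summable (\<lambda>i. (x i)\<^sup>2 + (y i)\<^sup>2 + 2 * (x i * y i))"
    by (intro summable_add assms summable_mult summable_ell2_mult)
  then show ?thesis
    by (simp add: power2_sum mult.assoc)
qed

instantiation ell2 :: real_vector
begin

lift_definition zero_ell2 :: ell2 is "\<lambda>_. 0"
  by simp

lift_definition plus_ell2 :: "ell2 \<Rightarrow> ell2 \<Rightarrow> ell2" is "\<lambda>x y i. x i + y i"
  by (rule summable_ell2_add)

lift_definition uminus_ell2 :: "ell2 \<Rightarrow> ell2" is "\<lambda>x i. - x i"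
  by simp

lift_definition scaleR_ell2 :: "real \<Rightarrow> ell2 \<Rightarrow> ell2" is "\<lambda>c x i. c * x i"
  by (simp add: power_mult_distrib summable_mult)

definition minus_ell2 :: "ell2 \<Rightarrow> ell2 \<Rightarrow> ell2" where
  "minus_ell2 x y = x + - y"

instance
  by standard (rule minus_ell2_def | (transfer, simp add: algebra_simps))+

end

lemma ell2_nth_diff: "ell2_nth (x - y) i = ell2_nth x i - ell2_nth y i"
  unfolding minus_ell2_def by transfer simp

instantiation ell2 :: real_inner
begin

lift_definition inner_ell2 :: "ell2 \<Rightarrow> ell2 \<Rightarrow> real" is "\<lambda>x y. \<Sum>i. x i * y i" .

definition norm_ell2 :: "ell2 \<Rightarrow> real" where
  "norm_ell2 x = sqrt (inner x x)"

definition dist_ell2 :: "ell2 \<Rightarrow> ell2 \<Rightarrow> real" where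
  "dist_ell2 x y = norm (x - y)"

definition sgn_ell2 :: "ell2 \<Rightarrow> ell2" where
  "sgn_ell2 x = inverse (norm x) *\<^sub>R x"

definition uniformity_ell2 :: "(ell2 \<times> ell2) filter" where
  "uniformity_ell2 = (INF e\<in>{0 <..}. principal {(x, y). dist x y < e})"

definition open_ell2 :: "ell2 set \<Rightarrow> bool" where
  "open_ell2 S = (\<forall>x\<in>S. \<forall>\<^sub>F (x', y) in uniformity. x' = x \<longrightarrow> y \<in> S)"

instance
proof
  fix x y z :: ell2 and c :: real and S :: "ell2 set"
  show "inner x y = inner y x"
    by transfer (simp add: mult.commute)
  show "inner (x + y) z = inner x z + inner y z"
    by transfer (simp add: distrib_right suminf_add summable_ell2_mult)
  show "inner (c *\<^sub>R x) y = c * inner x y"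
    by transfer (simp add: mult.assoc suminf_mult summable_ell2_mult)
  show "0 \<le> inner x x"
    by transfer (simp add: suminf_nonneg summable_ell2_mult)
  show "inner x x = 0 \<longleftrightarrow> x = 0"
    by transfer (auto simp: suminf_eq_zero_iff summable_ell2_mult)
qed (fact norm_ell2_def dist_ell2_def sgn_ell2_def uniformity_ell2_def open_ell2_def)+

end

lemma norm_ell2_squared: "(norm x)\<^sup>2 = (\<Sum>i. (ell2_nth x i)\<^sup>2)" for x :: ell2
  unfolding power2_norm_eq_inner by transfer (simp add: power2_eq_square)

lemma summable_ell2_nth: "summable (\<lambda>i. (ell2_nth x i)\<^sup>2)"
  using ell2_nth[of x] by simp

lemma sum_ell2_nth_le: "(\<Sum>i<n. (ell2_nth x i)\<^sup>2) \<le> (norm x)\<^sup>2"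
  unfolding norm_ell2_squared by (rule sum_le_suminf[OF summable_ell2_nth]) auto

lemma ell2_nth_le_norm: "\<bar>ell2_nth x i\<bar> \<le> norm x"
proof -
  have "(ell2_nth x i)\<^sup>2 \<le> (\<Sum>j<Suc i. (ell2_nth x j)\<^sup>2)"
    by (simp add: sum_nonneg)
  also have "\<dots> \<le> (norm x)\<^sup>2" by (rule sum_ell2_nth_le)
  finally show ?thesis by (simp add: abs_le_square_iff[symmetric])
qed

instance ell2 :: complete_space
proof
  fix X :: "nat \<Rightarrow> ell2"
  assume X: "Cauchy X"
  have "Cauchy (\<lambda>n. ell2_nth (X n) i)" for i
  proof (rule metric_CauchyI)
    fix e :: real assume "e > 0"
    then obtain N where N: "dist (X m) (X n) < e" if "m \<ge> N" "n \<ge> N" for m n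
      using X unfolding Cauchy_def by blast
    have "dist (ell2_nth (X m) i) (ell2_nth (X n) i) < e" if "m \<ge> N" "n \<ge> N" for m n
      using ell2_nth_le_norm[of "X m - X n" i] N[OF that]
      by (simp add: dist_norm ell2_nth_diff)
    then show "\<exists>N. \<forall>m\<ge>N. \<forall>n\<ge>N. dist (ell2_nth (X m) i) (ell2_nth (X n) i) < e"
      by blast
  qed
  then have "\<forall>i. \<exists>l. (\<lambda>n. ell2_nth (X n) i) \<longlonglongrightarrow> l"
    by (simp add: Cauchy_convergent_iff convergent_def)
  then obtain l where l: "(\<lambda>n. ell2_nth (X n) i) \<longlonglongrightarrow> l i" for i by metis
  have bound: "\<exists>N. \<forall>n\<ge>N. \<forall>k. (\<Sum>i<k. (ell2_nth (X n) i - l i)\<^sup>2) \<le> e\<^sup>2"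
    if "e > 0" for e :: real
  proof -
    obtain N where N: "dist (X m) (X n) < e" if "m \<ge> N" "n \<ge> N" for m n
      using X \<open>e > 0\<close> unfolding Cauchy_def by blast
    have "(\<Sum>i<k. (ell2_nth (X n) i - l i)\<^sup>2) \<le> e\<^sup>2" if "n \<ge> N" for n k
    proof (rule tendsto_upperbound)
      show "(\<lambda>m. \<Sum>i<k. (ell2_nth (X n) i - ell2_nth (X m) i)\<^sup>2)
          \<longlonglongrightarrow> (\<Sum>i<k. (ell2_nth (X n) i - l i)\<^sup>2)"
        by (intro tendsto_intros l)
      have "(\<Sum>i<k. (ell2_nth (X n) i - ell2_nth (X m) i)\<^sup>2) \<le> e\<^sup>2" if "m \<ge> N" for m
      proof -
        have "(\<Sum>i<k. (ell2_nth (X n) i - ell2_nth (X m) i)\<^sup>2) \<le> (norm (X n - X m))\<^sup>2"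
          using sum_ell2_nth_le[of "X n - X m" k] by (simp add: ell2_nth_diff)
        also have "\<dots> \<le> e\<^sup>2"
          using N[OF \<open>n \<ge> N\<close> that] by (intro power_mono) (auto simp: dist_norm)
        finally show ?thesis .
      qed
      then show "\<forall>\<^sub>F m in sequentially.
          (\<Sum>i<k. (ell2_nth (X n) i - ell2_nth (X m) i)\<^sup>2) \<le> e\<^sup>2"
        unfolding eventually_sequentially by blast
    qed simp
    then show ?thesis by blast
  qed
  have diff: "summable (\<lambda>i. (ell2_nth (X n) i - l i)\<^sup>2)"
    if "\<And>k. (\<Sum>i<k. (ell2_nth (X n) i - l i)\<^sup>2) \<le> e" for n e
    using that by (intro summableI_nonneg_bounded[where x = e]) auto
  obtain N where "\<forall>k. (\<Sum>i<k. (ell2_nth (X N) i - l i)\<^sup>2) \<le> 1\<^sup>2"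
    using bound[of 1] by auto
  then have "summable (\<lambda>i. (ell2_nth (X N) i - l i)\<^sup>2)"
    by (intro diff) auto
  then have "summable (\<lambda>i. (l i - ell2_nth (X N) i)\<^sup>2)"
    by (simp add: power2_commute)
  from summable_ell2_add[OF this summable_ell2_nth[of "X N"]]
  have "summable (\<lambda>i. (l i)\<^sup>2)" by simp
  then have L: "ell2_nth (Abs_ell2 l) = l" by (simp add: Abs_ell2_inverse)
  have "X \<longlonglongrightarrow> Abs_ell2 l"
  proof (rule metric_LIMSEQ_I)
    fix e :: real assume "e > 0"
    then obtain N where N: "\<forall>n\<ge>N. \<forall>k. (\<Sum>i<k. (ell2_nth (X n) i - l i)\<^sup>2) \<le> (e / 2)\<^sup>2"
      using bound[of "e / 2"] by auto
    have "dist (X n) (Abs_ell2 l) < e" if "n \<ge> N" for n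
    proof -
      have "(norm (X n - Abs_ell2 l))\<^sup>2 \<le> (e / 2)\<^sup>2"
        unfolding norm_ell2_squared ell2_nth_diff L
        using N that by (intro suminf_le_const diff[of n "(e / 2)\<^sup>2"]) auto
      then have "norm (X n - Abs_ell2 l) \<le> e / 2"
        using \<open>e > 0\<close> by (simp add: power2_le_iff_abs_le)
      then show ?thesis using \<open>e > 0\<close> by (simp add: dist_norm)
    qed
    then show "\<exists>N. \<forall>n\<ge>N. dist (X n) (Abs_ell2 l) < e" by blast
  qed
  then show "convergent X" by (rule convergentI)
qed


section \<open>The Haagerup property\<close>

text \<open>
  A metrically proper action of the discrete group \<open>\<Gamma>\<close> by affine isometries of a real
  Hilbert space.
\<close>

definition proper_affine_isometric_action ::
  "('a, 'm) monoid_scheme \<Rightarrow> ('a \<Rightarrow> 'h \<Rightarrow> 'h::{real_inner, complete_space}) \<Rightarrow> bool" where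
  "proper_affine_isometric_action \<Gamma> A \<longleftrightarrow>
     group_action \<Gamma> UNIV A \<and>
     (\<forall>\<alpha> \<in> carrier \<Gamma>.
        (\<exists>L b. linear L \<and> A \<alpha> = (\<lambda>v. L v + b)) \<and> (\<forall>v w. dist (A \<alpha> v) (A \<alpha> w) = dist v w)) \<and>
     (\<forall>v R. finite {\<alpha> \<in> carrier \<Gamma>. norm (A \<alpha> v) \<le> R})"

text \<open>
  A-T-menability of a discrete group. Quantification over all Hilbert spaces is not available
  inside a formula, so the space is $\ell^2(\mathbb{N})$, which loses nothing: a discrete group
  with a proper action as above on some Hilbert space is countable, so it preserves a separable
  closed affine subspace, and a separable Hilbert space embeds in $\ell^2(\mathbb{N})$ with the
  linear parts extended by the identity on the orthogonal complement.
\<close>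

definition haagerup_property :: "('a, 'm) monoid_scheme \<Rightarrow> bool" where
  "haagerup_property \<Gamma> \<longleftrightarrow>
     (\<exists>A :: 'a \<Rightarrow> ell2 \<Rightarrow> ell2. proper_affine_isometric_action \<Gamma> A)"

end

theory Submission
  imports Defs "HOL-Library.Omega_Words_Fun"
begin

text \<open>
  Every compact open set of arrows is a finite union of sets $U_{\mu,\nu}$. The zipper set consists
  of the classes of the cylinder sets, seen as sets of units; these are exactly the classes of the
  sets $U_{\mu,\nu}$. If $\alpha = \pi_W$, then $W C_\mu$ is some $U_{\rho,\mu}$ for all long $\mu$,
  because $W$ is a finite union of such sets; so $\alpha$ moves only finitely many classes out of the
  zipper set. Conversely, if $[W C_\mu]$ lies outside the zipper set, then so does $[W C_{\mu'}]$ for every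
  prefix $\mu'$ of $\mu$. As $M$ is irreducible and not a permutation matrix, a branching vertex is
  met within a bounded number of steps, so a long word has many prefixes with distinct cylinders.
  Hence a bound on the defect of $\alpha$ bounds the length of the words $\nu$ needed to cover $W$ by
  sets $U_{\mu,\nu}$; the same bound for $\alpha^{-1}$ controls $\mu$, which leaves finitely many $W$.
  The Haagerup property follows by conjugating the permutation representation on
  $\ell^2(\Omega)$ by the translation by the indicator function of the zipper set.
\<close>

section \<open>From zipper actions to the Haagerup property\<close>

text \<open>The obstacle throughout is that a cylinder does not determine its word: where the next
  edge is forced, a longer word has the same cylinder. This affects the transitivity of the
  relation, where the two words attached to the middle set may differ, and the final count, where
  the word found for a cylinder may be longer than the prefix that defined it. Both are settled by
  comparing words as prefixes of one point; the count also needs a uniform bound on forced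
  extensions. Branching is used once more to show that \<alpha> determines \<open>W\<close>, without
  which the action would not be defined. An arrow of \<open>U_word D u w\<close> replaces the prefix
  \<open>w\<close> by \<open>u\<close> and keeps the tail. Hence a product of two such sets is empty
  or again such a set, so membership in the zipper set passes from a cylinder to every smaller one.
  This is why one failure at a long word yields failures at all its prefixes. The integer component
  of an arrow is the difference of two word lengths; through it, bounds on the source words of an
  element and of its inverse bound the range words.\<close>

definition transport_action :: "('b \<Rightarrow> 'i) \<Rightarrow> 'b set \<Rightarrow> ('a \<Rightarrow> 'b \<Rightarrow> 'b) \<Rightarrow> 'a \<Rightarrow> 'i \<Rightarrow> 'i" where
  "transport_action e E \<phi> g n = (if n \<in> e ` E then e (\<phi> g (inv_into E e n)) else n)"

text \<open>The action on \<open>E\<close> is carried along \<open>e\<close> to the whole index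
  type. Outside the image of \<open>E\<close> every index is fixed, so that each group element gives
  a bijection of all indices, as needed for permuting the coordinates of a sequence.\<close>

lemma (in group_action) transport_action:
  fixes e :: "_ \<Rightarrow> 'i"
  assumes e: "inj_on e E"
  defines "p \<equiv> transport_action e E \<phi>"
  shows "\<And>g x. x \<in> E \<Longrightarrow> p g (e x) = e (\<phi> g x)"
    and "p \<one> = id"
    and "\<And>g h. g \<in> carrier G \<Longrightarrow> h \<in> carrier G \<Longrightarrow> p (g \<otimes> h) = p g \<circ> p h"
proof -
  show pe: "p g (e x) = e (\<phi> g x)" if "x \<in> E" for g x
    using that e by (simp add: p_def transport_action_def)
  have one: "\<phi> \<one> x = x" if "x \<in> E" for x
    using that id_eq_one by (metis restrict_apply)
  show "p \<one> = id"
  proof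
    show "p \<one> n = id n" for n
      by (cases "n \<in> e ` E") (auto simp: pe one, simp add: p_def transport_action_def)
  qed
  show "p (g \<otimes> h) = p g \<circ> p h" if g: "g \<in> carrier G" and h: "h \<in> carrier G" for g h
  proof
    fix n
    show "p (g \<otimes> h) n = (p g \<circ> p h) n"
    proof (cases "n \<in> e ` E")
      case True
      then obtain x where "n = e x" "x \<in> E" by blast
      moreover have "\<phi> h x \<in> E" using element_image[OF h \<open>x \<in> E\<close> refl] .
      ultimately show ?thesis
        by (simp add: pe composition_rule g h)
    next
      case False
      then show ?thesis by (simp add: p_def transport_action_def)
    qed
  qed
qed

text \<open>A difference of two indicators takes the values -1, 0 and 1 only, so its square is the
  indicator of the symmetric difference. This turns a number of elements into a squared
  norm.\<close>

lemma suminf_square_diff_indicator: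
  fixes A B :: "nat set"
  assumes "finite (sym_diff A B)"
  shows "summable (\<lambda>n. (indicator A n - indicator B n :: real)\<^sup>2)"
    and "(\<Sum>n. (indicator A n - indicator B n :: real)\<^sup>2) = card (sym_diff A B)"
proof -
  have eq: "(indicator A n - indicator B n :: real)\<^sup>2 = indicator (sym_diff A B) n" for n
    by (auto simp: indicator_def)
  show "summable (\<lambda>n. (indicator A n - indicator B n :: real)\<^sup>2)"
    unfolding eq by (rule summable_finite[OF assms]) auto
  show "(\<Sum>n. (indicator A n - indicator B n :: real)\<^sup>2) = card (sym_diff A B)"
    unfolding eq by (subst suminf_finite[OF assms]) auto
qed

text \<open>
  With \<open>\<zeta>\<close> the indicator function of \<open>Z\<close>, the affine action is the permutation action
  conjugated by the translation by \<open>\<zeta>\<close>, which need not be square-summable itself.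
\<close>

theorem zipper_action_imp_haagerup_property:
  fixes \<Gamma> :: "('a, 'm) monoid_scheme" (structure)
  assumes zip: "zipper_action \<Gamma> \<Omega> \<phi>" and \<Omega>: "countable \<Omega>"
  shows "haagerup_property \<Gamma>"
proof -
  from zip obtain Z where "group_action \<Gamma> \<Omega> \<phi>" and Z: "Z \<subseteq> \<Omega>"
    and fin: "\<And>\<alpha>. \<alpha> \<in> carrier \<Gamma> \<Longrightarrow> finite (sym_diff (\<phi> \<alpha> ` Z) Z)"
    and proper: "\<And>r::real. r > 0 \<Longrightarrow>
      finite {\<alpha> \<in> carrier \<Gamma>. real (card (sym_diff (\<phi> \<alpha> ` Z) Z)) \<le> r}"
    unfolding zipper_action_def by blast
  interpret group_action \<Gamma> \<Omega> \<phi> by fact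
  interpret group \<Gamma> using group_hom group_hom.axioms(1) by blast
  define e where "e = to_nat_on \<Omega>"
  have e: "inj_on e \<Omega>" unfolding e_def by (rule inj_on_to_nat_on[OF \<Omega>])
  define p where "p = transport_action e \<Omega> \<phi>"
  note p = transport_action[OF e, folded p_def]
  have p_inv: "p g \<circ> p (inv g) = id" "p (inv g) \<circ> p g = id" if "g \<in> carrier \<Gamma>" for g
    using that p(3)[of g "inv g"] p(3)[of "inv g" g] p(2) by simp_all
  have inj_p: "inj (p g)" if "g \<in> carrier \<Gamma>" for g
    using p_inv[OF that] by (metis inj_on_id inj_on_imageI2)
  have surj_p: "surj (p g)" if "g \<in> carrier \<Gamma>" for g
    using p_inv[OF that] by (metis surj_id comp_surj surj_def comp_apply id_apply)
  define \<zeta> :: "nat \<Rightarrow> real" where "\<zeta> = indicator (e ` Z)"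
  \<comment> \<open>Precomposition with the inverse of \<open>g\<close> moves \<zeta> to the
    indicator of the image of \<open>Z\<close> under \<open>g\<close>.\<close>
  have image: "\<zeta> (p (inv g) n) = indicator (e ` \<phi> g ` Z) n" if g: "g \<in> carrier \<Gamma>" for g n
  proof (cases "n \<in> e ` \<Omega>")
    case True
    then obtain x where x: "n = e x" "x \<in> \<Omega>" by blast
    have gx: "\<phi> (inv g) x \<in> \<Omega>"
      using element_image[OF _ x(2) refl] g by simp
    have "e (\<phi> (inv g) x) \<in> e ` Z \<longleftrightarrow> \<phi> (inv g) x \<in> Z"
      using inj_on_image_mem_iff[OF e gx Z] .
    also have "\<dots> \<longleftrightarrow> x \<in> \<phi> g ` Z"
    proof
      assume "\<phi> (inv g) x \<in> Z"
      moreover have "x = \<phi> g (\<phi> (inv g) x)"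
        using orbit_sym_aux[of "inv g" x] g x(2) by simp
      ultimately show "x \<in> \<phi> g ` Z" by blast
    next
      assume "x \<in> \<phi> g ` Z"
      then obtain z where "z \<in> Z" "x = \<phi> g z" by blast
      then show "\<phi> (inv g) x \<in> Z"
        using orbit_sym_aux[OF g, of z x] Z by auto
    qed
    also have "\<dots> \<longleftrightarrow> e x \<in> e ` \<phi> g ` Z"
      by (rule inj_on_image_mem_iff[OF e x(2), symmetric])
        (use Z element_image[OF g] in blast)
    finally show ?thesis
      by (simp add: \<zeta>_def x p(1) indicator_def)
  next
    case False
    then have "n \<notin> e ` Z" "n \<notin> e ` \<phi> g ` Z"
      using Z element_image[OF g] by blast+
    with False show ?thesis by (simp add: \<zeta>_def p_def transport_action_def)
  qed
  have symdiff: "sym_diff (e ` \<phi> g ` Z) (e ` Z) = e ` sym_diff (\<phi> g ` Z) Z"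
    if g: "g \<in> carrier \<Gamma>" for g
  proof -
    have sub: "\<phi> g ` Z \<subseteq> \<Omega>" using Z element_image[OF g] by blast
    have "e ` (\<phi> g ` Z - Z) = e ` \<phi> g ` Z - e ` Z" "e ` (Z - \<phi> g ` Z) = e ` Z - e ` \<phi> g ` Z"
      using sub Z by (auto intro!: inj_on_image_set_diff[OF e])
    then show ?thesis by (simp add: image_Un)
  qed
  \<comment> \<open>The formal coboundary of \<zeta>: it vanishes off the finite defect of
    \<open>g\<close>, and its squared norm is the size of that defect.\<close>
  define b where "b = (\<lambda>g n. \<zeta> (p (inv g) n) - \<zeta> n)"
  have b: "summable (\<lambda>n. (b g n)\<^sup>2)" "(\<Sum>n. (b g n)\<^sup>2) = card (sym_diff (\<phi> g ` Z) Z)"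
    if g: "g \<in> carrier \<Gamma>" for g
  proof -
    have sub: "sym_diff (\<phi> g ` Z) Z \<subseteq> \<Omega>" using Z element_image[OF g] by blast
    have "finite (sym_diff (e ` \<phi> g ` Z) (e ` Z))"
      unfolding symdiff[OF g] using fin[OF g] by blast
    note suminf_square_diff_indicator[OF this]
    moreover have "card (sym_diff (e ` \<phi> g ` Z) (e ` Z)) = card (sym_diff (\<phi> g ` Z) Z)"
      unfolding symdiff[OF g] by (rule card_image[OF inj_on_subset[OF e sub]])
    ultimately show "summable (\<lambda>n. (b g n)\<^sup>2)" "(\<Sum>n. (b g n)\<^sup>2) = card (sym_diff (\<phi> g ` Z) Z)"
      unfolding b_def image[OF g] unfolding \<zeta>_def by simp_all
  qed
  have perm: "summable (\<lambda>n. (ell2_nth v (p g n))\<^sup>2)"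
    "(\<Sum>n. (ell2_nth v (p g n))\<^sup>2) = (norm v)\<^sup>2" if g: "g \<in> carrier \<Gamma>" for v g
  proof -
    note * = summable_ell2_nth[of v] inj_p[OF g] zero_le_power2
    show "summable (\<lambda>n. (ell2_nth v (p g n))\<^sup>2)"
      using summable_reindex[OF *] by (simp add: comp_def transport_action_def)
    show "(\<Sum>n. (ell2_nth v (p g n))\<^sup>2) = (norm v)\<^sup>2"
      using suminf_reindex[OF *] surj_p[OF g]
      by (simp add: comp_def transport_action_def norm_ell2_squared)
  qed
  define L where "L = (\<lambda>g v. Abs_ell2 (\<lambda>n. ell2_nth v (p (inv g) n)))"
  define B where "B = (\<lambda>g. Abs_ell2 (b g))"
  have L_nth: "ell2_nth (L g v) n = ell2_nth v (p (inv g) n)" if "g \<in> carrier \<Gamma>" for g v n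
    using that perm(1)[of "inv g" v] by (simp add: L_def Abs_ell2_inverse)
  have B_nth: "ell2_nth (B g) n = b g n" if "g \<in> carrier \<Gamma>" for g n
    using b(1)[OF that] by (simp add: B_def Abs_ell2_inverse)
  have norm_L: "norm (L g v) = norm v" if "g \<in> carrier \<Gamma>" for g v
  proof -
    have "(norm (L g v))\<^sup>2 = (norm v)\<^sup>2"
      using that perm(2)[of "inv g" v] by (simp add: norm_ell2_squared[of "L g v"] L_nth)
    then show ?thesis by simp
  qed
  have norm_B: "(norm (B g))\<^sup>2 = card (sym_diff (\<phi> g ` Z) Z)" if "g \<in> carrier \<Gamma>" for g
    using b(2)[OF that] that by (simp add: norm_ell2_squared B_nth)
  have linear_L: "linear (L g)" if "g \<in> carrier \<Gamma>" for g
    by (rule linearI) (simp_all add: that ell2_nth_inject[symmetric] fun_eq_iff L_nth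
        plus_ell2.rep_eq scaleR_ell2.rep_eq)
  define A where "A = (\<lambda>g v. L g v + B g)"
  \<comment> \<open>Coordinatewise, \<open>A g v\<close> plus \<zeta> is \<open>v\<close> plus
    \<zeta> permuted by \<open>g\<close>. The products therefore telescope, and the cocycle identity
    needs no separate proof.\<close>
  have A_nth: "ell2_nth (A g v) n = ell2_nth v (p (inv g) n) + \<zeta> (p (inv g) n) - \<zeta> n"
    if "g \<in> carrier \<Gamma>" for g v n
    using that by (simp add: A_def plus_ell2.rep_eq L_nth B_nth b_def)
  have A_mult: "A (g \<otimes> h) = A g \<circ> A h" if g: "g \<in> carrier \<Gamma>" and h: "h \<in> carrier \<Gamma>" for g h
    by (simp add: fun_eq_iff ell2_nth_inject[symmetric] A_nth g h inv_mult_group p(3))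
  have A_one: "A \<one> = id"
    by (simp add: fun_eq_iff ell2_nth_inject[symmetric] A_nth p(2))
  have A_inv: "A g \<circ> A (inv g) = id" "A (inv g) \<circ> A g = id" if "g \<in> carrier \<Gamma>" for g
    using that A_mult[of g "inv g"] A_mult[of "inv g" g] A_one by simp_all
  have A_Bij: "A g \<in> Bij UNIV" if "g \<in> carrier \<Gamma>" for g
    using A_inv[OF that] by (simp add: Bij_def o_bij)
  have "group_action \<Gamma> UNIV A"
  proof (intro group_action.intro group_hom.intro group_BijGroup group_hom_axioms.intro homI)
    show "Group.group \<Gamma>" ..
    show "A g \<in> carrier (BijGroup UNIV)" if "g \<in> carrier \<Gamma>" for g
      using A_Bij[OF that] by (simp add: BijGroup_def transport_action_def)
    show "A (g \<otimes> h) = A g \<otimes>\<^bsub>BijGroup UNIV\<^esub> A h" if "g \<in> carrier \<Gamma>" "h \<in> carrier \<Gamma>" for g h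
      using that by (simp add: BijGroup_def transport_action_def A_Bij A_mult compose_def fun_eq_iff)
  qed
  moreover have "\<exists>L b. linear L \<and> A g = (\<lambda>v. L v + b)" if "g \<in> carrier \<Gamma>" for g
    using linear_L[OF that] unfolding A_def by blast
  moreover have "dist (A g v) (A g w) = dist v w" if g: "g \<in> carrier \<Gamma>" for g v w
    by (simp add: A_def dist_norm linear_diff[OF linear_L[OF g], symmetric] norm_L[OF g])
  moreover have "finite {g \<in> carrier \<Gamma>. norm (A g v) \<le> R}" for v R
  proof (rule finite_subset[OF _ proper])
    \<comment> \<open>Properness of the zipper action is given for positive radii only, and the
      square may be zero; hence the summand 1.\<close>
    show "(R + norm v)\<^sup>2 + 1 > 0" using zero_le_power2[of "R + norm v"] by linarith
    have "real (card (sym_diff (\<phi> g ` Z) Z)) \<le> (R + norm v)\<^sup>2"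
      if g: "g \<in> carrier \<Gamma>" and R: "norm (A g v) \<le> R" for g
    proof -
      \<comment> \<open>\<open>B g\<close> is the difference of \<open>A g v\<close> and
        \<open>L g v\<close>, and the linear part preserves norms, so a bound on
        \<open>A g v\<close> bounds the defect of \<open>g\<close>.\<close>
      have "norm (B g) \<le> norm (A g v) + norm (L g v)"
        using norm_triangle_ineq4[of "A g v" "L g v"] by (simp add: A_def)
      also have "\<dots> \<le> R + norm v" using R norm_L[OF g, of v] by simp
      finally show ?thesis
        using power_mono[of "norm (B g)" "R + norm v" 2] by (simp add: norm_B[OF g])
    qed
    then show "{g \<in> carrier \<Gamma>. norm (A g v) \<le> R} \<subseteq>
      {g \<in> carrier \<Gamma>. real (card (sym_diff (\<phi> g ` Z) Z)) \<le> (R + norm v)\<^sup>2 + 1}"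
      by (fastforce intro: add_increasing2)
  qed
  ultimately show ?thesis
    unfolding haagerup_property_def proper_affine_isometric_action_def by blast
qed

section \<open>Words and the topology of the groupoid\<close>

text \<open>Links the iterated shift to the calculus of \<open>prefix\<close>, \<open>suffix\<close>
  and \<open>\<frown>\<close> on infinite words, which replaces index computations from here
  on.\<close>

lemma shift_funpow: "shift ^^ k = suffix k"
  by (induction k) (simp_all add: fun_eq_iff shift_def)

lemma conc_mem_cylinder_iff: "w \<frown> z \<in> cylinder D w \<longleftrightarrow> w \<frown> z \<in> sft D"
  by (auto simp: cylinder_def)

lemma cylinder_subset_sft: "cylinder D w \<subseteq> sft D"
  by (auto simp: cylinder_def)

lemma mem_cylinder_iff: "x \<in> cylinder D w \<longleftrightarrow> x \<in> sft D \<and> prefix (length w) x = w"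
proof -
  have "prefix (length w) x = w \<longleftrightarrow> (\<forall>j<length w. x j = w ! j)"
    unfolding list_eq_iff_nth_eq[of "prefix (length w) x"] by simp
  then show ?thesis unfolding cylinder_def by blast
qed

lemma mem_cylinderE:
  assumes "x \<in> cylinder D w"
  obtains z where "x = w \<frown> z" "w \<frown> z \<in> sft D"
proof -
  have *: "prefix (length w) x = w" and "x \<in> sft D"
    using assms by (simp_all add: mem_cylinder_iff)
  from prefix_suffix[of x "length w"] have "w \<frown> suffix (length w) x = x"
    unfolding * by (rule sym)
  with \<open>x \<in> sft D\<close> that[of "suffix (length w) x"] show thesis by simp
qed

lemma prefix_mem_cylinder: "x \<in> sft D \<Longrightarrow> x \<in> cylinder D (prefix n x)"
  by (simp add: mem_cylinder_iff)

lemma cylinder_append_subset: "cylinder D (u @ w) \<subseteq> cylinder D u"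
  by (auto simp: cylinder_def nth_append)

text \<open>Both words are initial segments of the same sequence; the letters of \<open>x\<close>
  between the two lengths supply \<open>t\<close>.\<close>

lemma cylinder_comparable:
  assumes "x \<in> cylinder D u" "x \<in> cylinder D w"
  shows "(\<exists>t. w = u @ t) \<or> (\<exists>t. u = w @ t)"
proof -
  have *: "prefix (length u) x = u" "prefix (length w) x = w"
    using assms by (simp_all add: mem_cylinder_iff)
  show ?thesis
  proof (cases "length u \<le> length w")
    case True
    then have "w = u @ subsequence x (length u) (length w)"
      using subsequence_append[of x "length u" "length w - length u"] * by simp
    then show ?thesis by blast
  next
    case False
    then have "u = w @ subsequence x (length w) (length u)"
      using subsequence_append[of x "length w" "length u - length w"] * by simp
    then show ?thesis by blast
  qed
qed

lemma sft_arc: "x \<in> sft D \<Longrightarrow> x k \<in> arcs D"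
  and sft_step: "x \<in> sft D \<Longrightarrow> head D (x k) = tail D (x (Suc k))"
  by (simp_all add: sft_def)

lemma suffix_mem_sft: "x \<in> sft D \<Longrightarrow> suffix n x \<in> sft D"
  by (simp add: sft_def)

lemma conc_mem_sftD: "w \<frown> z \<in> sft D \<Longrightarrow> z \<in> sft D"
  using suffix_mem_sft[of "w \<frown> z" D "length w"] by simp

section \<open>Continuations of a word\<close>

definition follower_set :: "('v, 'e) pre_digraph \<Rightarrow> 'v \<Rightarrow> (nat \<Rightarrow> 'e) set" where
  "follower_set D v = {z \<in> sft D. tail D (z 0) = v}"

text \<open>Membership in the shift space is a condition on adjacent letters, so only the junction
  of \<open>w\<close> with \<open>z\<close> is in question. The continuation \<open>y\<close> stands
  for the admissibility of \<open>w\<close>, which \<open>is_word\<close> does not include.\<close>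

lemma conc_mem_sft_iff:
  assumes "w \<noteq> []" "w \<frown> y \<in> sft D"
  shows "w \<frown> z \<in> sft D \<longleftrightarrow> z \<in> follower_set D (word_end D w)"
proof
  assume wz: "w \<frown> z \<in> sft D"
  have "head D ((w \<frown> z) (length w - 1)) = tail D ((w \<frown> z) (Suc (length w - 1)))"
    by (rule sft_step[OF wz])
  with assms(1) have "tail D (z 0) = word_end D w"
    by (simp add: word_end_def last_conv_nth)
  with conc_mem_sftD[OF wz] show "z \<in> follower_set D (word_end D w)"
    by (simp add: follower_set_def)
next
  assume z: "z \<in> follower_set D (word_end D w)"
  show "w \<frown> z \<in> sft D"
    unfolding sft_def
  proof (intro CollectI allI)
    fix k
    consider "Suc k < length w" | "Suc k = length w" | "length w < Suc k" by linarith
    then show "(w \<frown> z) k \<in> arcs D \<and> head D ((w \<frown> z) k) = tail D ((w \<frown> z) (Suc k))"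
    proof cases
      case 1
      then show ?thesis
        using sft_arc[OF assms(2), of k] sft_step[OF assms(2), of k] by simp
    next
      case 2
      then have "(w \<frown> z) k = last w" "(w \<frown> z) (Suc k) = z 0"
        using assms(1) by (simp_all add: last_conv_nth flip: 2)
      moreover have "last w = (w \<frown> y) k"
        using assms(1) by (simp add: last_conv_nth flip: 2)
      ultimately show ?thesis
        using sft_arc[OF assms(2), of k] z by (simp add: follower_set_def word_end_def)
    next
      case 3
      then have "(w \<frown> z) k = z (k - length w)" "(w \<frown> z) (Suc k) = z (Suc (k - length w))"
        by (auto simp: Suc_diff_le)
      then show ?thesis using z by (simp add: follower_set_def sft_def)
    qed
  qed
qed

lemma is_word_prefix: "x \<in> sft D \<Longrightarrow> 0 < n \<Longrightarrow> is_word D (prefix n x)"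
  by (auto simp: is_word_def sft_def)

lemma is_word_nonempty: "is_word D w \<Longrightarrow> w \<noteq> []"
  by (simp add: is_word_def)

section \<open>Arrows as pairs of words with a common tail\<close>

lemma sft_arrows_conc:
  assumes "u \<frown> z \<in> sft D" "w \<frown> z \<in> sft D" "n = int (length u) - int (length w)"
  shows "(u \<frown> z, n, w \<frown> z) \<in> sft_arrows D"
proof -
  \<comment> \<open>Arrows are defined with exponents at least 1, while \<open>u\<close> and
    \<open>w\<close> may be empty here; one further shift on both sides keeps the
    difference.\<close>
  have "suffix (Suc (length u)) (u \<frown> z) = suffix (Suc (length w)) (w \<frown> z)" by simp
  then show ?thesis
    unfolding sft_arrows_def shift_funpow using assms
    by (intro CollectI exI[of _ "u \<frown> z"] exI[of _ n] exI[of _ "w \<frown> z"] conjI refl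
        exI[of _ "Suc (length u)"] exI[of _ "Suc (length w)"]) auto
qed

text \<open>Parametrizing the arrows by their common tail \<open>z\<close> reduces the later
  computations with these sets to concatenation of words.\<close>

lemma U_word_eq:
  "U_word D u w = {(u \<frown> z, int (length u) - int (length w), w \<frown> z) | z.
     u \<frown> z \<in> sft D \<and> w \<frown> z \<in> sft D}" (is "_ = ?R")
proof
  show "?R \<subseteq> U_word D u w"
    by (auto simp: U_word_def shift_funpow sft_arrows_conc cylinder_def)
  show "U_word D u w \<subseteq> ?R"
  proof
    fix g assume "g \<in> U_word D u w"
    then obtain x y where g: "g = (x, int (length u) - int (length w), y)"
      "suffix (length u) x = suffix (length w) y" "x \<in> cylinder D u" "y \<in> cylinder D w"
      by (auto simp: U_word_def shift_funpow)
    from g(3,4) obtain z z' where "x = u \<frown> z" "y = w \<frown> z'" "x \<in> sft D" "y \<in> sft D"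
      by (metis mem_cylinderE)
    with g show "g \<in> ?R" by simp
  qed
qed

lemma U_word_mem_iff:
  "(u \<frown> z, n, w \<frown> z) \<in> U_word D u w \<longleftrightarrow>
     n = int (length u) - int (length w) \<and> u \<frown> z \<in> sft D \<and> w \<frown> z \<in> sft D"
  by (auto simp: U_word_eq)

lemma U_wordE:
  assumes "(x, n, y) \<in> U_word D u w"
  obtains z where "x = u \<frown> z" "y = w \<frown> z" "n = int (length u) - int (length w)"
    "u \<frown> z \<in> sft D" "w \<frown> z \<in> sft D"
  using assms by (auto simp: U_word_eq)

lemma U_word_subset_arrows: "U_word D u w \<subseteq> sft_arrows D"
  by (auto simp: U_word_def)

lemma U_word_append_subset: "U_word D (u @ t) (w @ t) \<subseteq> U_word D u w"
  unfolding U_word_eq by (auto simp flip: conc_conc)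

text \<open>With \<open>U_word_append_subset\<close> this makes any two of these sets disjoint or
  nested. The equal integer components force both words to be extended by the same number of
  letters, and these letters are read off from one common tail.\<close>

lemma U_word_int_comparable:
  assumes "g \<in> U_word D u w" "g \<in> U_word D u' w'"
  shows "(\<exists>t. u' = u @ t \<and> w' = w @ t) \<or> (\<exists>t. u = u' @ t \<and> w = w' @ t)"
proof -
  obtain x n y where g: "g = (x, n, y)" by (cases g)
  from assms obtain z z' where
    *: "x = u \<frown> z" "y = w \<frown> z" "x = u' \<frown> z'" "y = w' \<frown> z'"
      "int (length u) - int (length w) = int (length u') - int (length w')"
    unfolding g by (metis U_wordE)
  have "\<exists>t. p' = p @ t \<and> q' = q @ t"
    if "p \<frown> r = p' \<frown> r'" "q \<frown> r = q' \<frown> r'" "length p \<le> length p'"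
      "int (length p) - int (length q) = int (length p') - int (length q')"
    for p q p' q' :: "_ list" and r r'
  proof -
    have len: "length q \<le> length q'" "length p' - length p = length q' - length q"
      using that(3,4) by linarith+
    have "p' \<frown> r' = p \<frown> r" "q' \<frown> r' = q \<frown> r" using that by simp_all
    then have p: "p' = p @ prefix (length p' - length p) r" and q: "q' = q @ prefix (length q' - length q) r"
      using prefix_conc_snd[OF that(3), of r] prefix_conc_snd[OF len(1), of r]
      by (metis prefix_conc_length)+
    then show ?thesis using len(2) by metis
  qed
  note this[of u z u' z' w w'] this[of u' z' u z w' w]
  with * show ?thesis by (metis nat_le_linear)
qed

section \<open>Cylinders as a compact open basis of the shift space\<close>

lemma openin_sft_topology_iff:
  "openin (sft_topology D) A \<longleftrightarrow>
     A \<subseteq> sft D \<and> (\<forall>x\<in>A. \<exists>n. cylinder D (prefix n x) \<subseteq> A)"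
proof
  assume "openin (sft_topology D) A"
  then obtain T where T: "openin (product_topology (\<lambda>_. discrete_topology (arcs D)) UNIV) T"
    "A = T \<inter> sft D"
    unfolding sft_topology_def openin_subtopology by blast
  have "\<exists>n. cylinder D (prefix n x) \<subseteq> A" if "x \<in> A" for x
  proof -
    have "x \<in> T" using that T(2) by blast
    with T(1) obtain U where U: "finite {i. U i \<noteq> arcs D}" "x \<in> Pi\<^sub>E UNIV U" "Pi\<^sub>E UNIV U \<subseteq> T"
      unfolding openin_product_topology_alt by auto
    \<comment> \<open>A basic open set of the product restricts finitely many coordinates;
      \<open>n\<close> lies beyond all of them, so agreeing with \<open>x\<close> on
      \<open>n\<close> letters suffices.\<close>
    obtain n where n: "\<And>i. U i \<noteq> arcs D \<Longrightarrow> i < n"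
      using U(1) unfolding finite_nat_set_iff_bounded by blast
    have "cylinder D (prefix n x) \<subseteq> Pi\<^sub>E UNIV U"
    proof
      fix y assume y: "y \<in> cylinder D (prefix n x)"
      have "y i \<in> U i" for i
      proof (cases "i < n")
        case True
        then have "y i = x i" using y by (simp add: cylinder_def)
        then show ?thesis using U(2) by (auto simp: PiE_def)
      next
        case False
        with n have "U i = arcs D" by blast
        then show ?thesis using y by (auto simp: cylinder_def sft_def)
      qed
      then show "y \<in> Pi\<^sub>E UNIV U" by (simp add: PiE_iff)
    qed
    with U(3) T(2) cylinder_subset_sft[of D "prefix n x"] have "cylinder D (prefix n x) \<subseteq> A"
      by blast
    then show ?thesis by blast
  qed
  then show "A \<subseteq> sft D \<and> (\<forall>x\<in>A. \<exists>n. cylinder D (prefix n x) \<subseteq> A)" using T(2) by blast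
next
  assume A: "A \<subseteq> sft D \<and> (\<forall>x\<in>A. \<exists>n. cylinder D (prefix n x) \<subseteq> A)"
  have cyl: "openin (sft_topology D) (cylinder D w)" if "w \<in> lists (arcs D)" for w
  proof -
    define U where "U = (\<lambda>i. if i < length w then {w ! i} else arcs D)"
    have "openin (product_topology (\<lambda>_. discrete_topology (arcs D)) UNIV) (Pi\<^sub>E UNIV U)"
      using that by (subst openin_PiE_gen)
        (auto simp: U_def intro!: disjI2 finite_subset[of _ "{..<length w}"] split: if_splits)
    moreover have "cylinder D w = Pi\<^sub>E UNIV U \<inter> sft D"
      by (auto simp: cylinder_def U_def PiE_iff sft_def split: if_splits)
    ultimately show ?thesis
      unfolding sft_topology_def openin_subtopology by blast
  qed
  show "openin (sft_topology D) A"
  proof (subst openin_subopen, intro ballI)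
    fix x assume x: "x \<in> A"
    with A obtain n where n: "cylinder D (prefix n x) \<subseteq> A" by blast
    have "x \<in> sft D" using x A by blast
    then have "prefix n x \<in> lists (arcs D)" by (auto simp: sft_def)
    with cyl prefix_mem_cylinder[OF \<open>x \<in> sft D\<close>] n
    show "\<exists>T. openin (sft_topology D) T \<and> x \<in> T \<and> T \<subseteq> A" by blast
  qed
qed

lemma openin_cylinder: "openin (sft_topology D) (cylinder D w)"
  unfolding openin_sft_topology_iff
  by (auto simp: mem_cylinder_iff intro!: exI[of _ "length w"])

text \<open>The full product is compact because the alphabet is finite. The shift space is closed in
  it because a forbidden transition shows in two coordinates, and a cylinder is closed because the
  first \<open>length w\<close> letters decide non-membership.\<close>

lemma compact_cylinder:
  assumes "finite (arcs D)"
  shows "compactin (sft_topology D) (cylinder D w)"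
proof -
  let ?P = "product_topology (\<lambda>_::nat. discrete_topology (arcs D)) UNIV"
  have "compact_space ?P"
    by (intro compact_space_product_topology[THEN iffD2] disjI2 ballI)
      (simp add: compact_space_discrete_topology assms)
  have coord: "openin ?P {x \<in> topspace ?P. P (x k)}" for k P
  proof -
    have "continuous_map ?P (discrete_topology (arcs D)) (\<lambda>x. x k)"
      by (rule continuous_map_product_projection) simp
    then have "openin ?P {x \<in> topspace ?P. x k \<in> {a \<in> arcs D. P a}}"
      by (rule openin_continuous_map_preimage) auto
    moreover have "{x \<in> topspace ?P. x k \<in> {a \<in> arcs D. P a}} = {x \<in> topspace ?P. P (x k)}"
      by auto
    ultimately show ?thesis by simp
  qed
  have coord_eq: "openin ?P {x \<in> topspace ?P. x k = a}" for k a
    by (rule coord[of "\<lambda>e. e = a" k])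
  have "closedin ?P (sft D)"
  proof -
    have sub: "sft D \<subseteq> topspace ?P" by (auto simp: sft_def)
    have "topspace ?P - sft D =
      (\<Union>(k, a, b) \<in> {(k, a, b). head D a \<noteq> tail D b}.
         {x \<in> topspace ?P. x k = a} \<inter> {x \<in> topspace ?P. x (Suc k) = b})"
      by (auto simp: sft_def PiE_iff)
    moreover have "openin ?P \<dots>"
      by (intro openin_Union ballI) (auto simp del: topspace_product_topology intro!: openin_Int coord_eq)
    ultimately show ?thesis using sub by (simp add: closedin_def)
  qed
  then have "compactin ?P (sft D)"
    using \<open>compact_space ?P\<close> closedin_compact_space by blast
  then have cs: "compact_space (sft_topology D)"
    unfolding sft_topology_def by (rule compact_space_subtopology)
  have "openin (sft_topology D) (sft D - cylinder D w)"
    unfolding openin_sft_topology_iff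
  proof (intro conjI ballI)
    fix x assume x: "x \<in> sft D - cylinder D w"
    show "\<exists>n. cylinder D (prefix n x) \<subseteq> sft D - cylinder D w"
      using x by (intro exI[of _ "length w"]) (auto simp: mem_cylinder_iff)
  qed auto
  then have "closedin (sft_topology D) (cylinder D w)"
    by (auto simp: closedin_def topspace_sft_topology cylinder_def Diff_Diff_Int)
  with cs show ?thesis by (rule closedin_compact_space)
qed

lemma gtop_sft_groupoid: "gtop (sft_groupoid D) =
  topology_generated_by {sft_basic_set D k l A B | k l A B.
    1 \<le> k \<and> 1 \<le> l \<and> openin (sft_topology D) A \<and> openin (sft_topology D) B}"
  by (simp add: sft_groupoid_def)

lemma openin_U_word:
  assumes "u \<noteq> []" "w \<noteq> []"
  shows "openin (gtop (sft_groupoid D)) (U_word D u w)"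
proof -
  have "U_word D u w = sft_basic_set D (length u) (length w) (cylinder D u) (cylinder D w)"
    by (auto simp: U_word_def sft_basic_set_def)
  moreover have "1 \<le> length u" "1 \<le> length w" using assms by (simp_all add: Suc_leI)
  ultimately show ?thesis
    unfolding gtop_sft_groupoid using openin_cylinder
    by (intro topology_generated_by_Basis) blast
qed

text \<open>The common tail \<open>y\<close> shows that both words are admissible and end at the
  same vertex, which alone decides what may follow.\<close>

lemma conc_mem_sft_cong:
  assumes "u \<noteq> []" "w \<noteq> []" "u \<frown> y \<in> sft D" "w \<frown> y \<in> sft D"
  shows "u \<frown> z \<in> sft D \<longleftrightarrow> w \<frown> z \<in> sft D"
proof -
  have "word_end D u = word_end D w"
    using conc_mem_sft_iff[OF assms(1,3), of y] conc_mem_sft_iff[OF assms(2,4), of y] assms(3,4)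
    by (simp add: follower_set_def)
  then show ?thesis
    using conc_mem_sft_iff[OF assms(1,3), of z] conc_mem_sft_iff[OF assms(2,4), of z] by simp
qed

text \<open>The set is the image of the compact cylinder of \<open>w\<close> under the section
  \<open>f\<close> of the source map that replaces the prefix \<open>w\<close> by \<open>u\<close>.
  Continuity of \<open>f\<close> is tested on the generating sets: if \<open>f y\<close> lies in one
  of them, finitely many letters of \<open>y\<close> guarantee this.\<close>

lemma compactin_U_word:
  assumes "finite (arcs D)" and uw: "u \<noteq> []" "w \<noteq> []"
  shows "compactin (gtop (sft_groupoid D)) (U_word D u w)"
proof (cases "U_word D u w = {}")
  case True
  then show ?thesis by simp
next
  case False
  then obtain z0 where z0: "u \<frown> z0 \<in> sft D" "w \<frown> z0 \<in> sft D" by (auto simp: U_word_eq)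
  define c where "c = int (length u) - int (length w)"
  define h where "h = (\<lambda>y. u \<frown> suffix (length w) y)"
  define f where "f = (\<lambda>y. (h y, c, y))"
  have h_in: "h y \<in> sft D" if "y \<in> cylinder D w" for y
    using that conc_mem_sft_cong[OF uw z0] by (auto simp: h_def elim!: mem_cylinderE)
  have image: "U_word D u w = f ` cylinder D w"
  proof (intro equalityI subsetI)
    fix g assume "g \<in> U_word D u w"
    then obtain z where "g = f (w \<frown> z)" "w \<frown> z \<in> sft D"
      by (auto simp: U_word_eq f_def h_def c_def)
    then show "g \<in> f ` cylinder D w" using conc_mem_cylinder_iff by blast
  next
    fix g assume "g \<in> f ` cylinder D w"
    then obtain y where y: "y \<in> cylinder D w" "g = f y" by blast
    from y(1) obtain z where "y = w \<frown> z" "w \<frown> z \<in> sft D" by (rule mem_cylinderE)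
    with h_in[OF y(1)] y(2) show "g \<in> U_word D u w"
      by (auto simp: U_word_eq f_def h_def c_def)
  qed
  have pre: "openin (sft_topology D) (f -` sft_basic_set D k l A B \<inter> cylinder D w)"
    if A: "openin (sft_topology D) A" and B: "openin (sft_topology D) B" for k l A B
    unfolding openin_sft_topology_iff
  proof (intro conjI ballI)
    show "f -` sft_basic_set D k l A B \<inter> cylinder D w \<subseteq> sft D" by (auto simp: cylinder_def)
    fix y assume y: "y \<in> f -` sft_basic_set D k l A B \<inter> cylinder D w"
    then have kl: "c = int k - int l" "h y \<in> A" "y \<in> B" "suffix k (h y) = suffix l y"
      by (auto simp: f_def sft_basic_set_def shift_funpow)
    with A B obtain m m' where m: "cylinder D (prefix m (h y)) \<subseteq> A" "cylinder D (prefix m' y) \<subseteq> B"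
      unfolding openin_sft_topology_iff by meson
    \<comment> \<open>Enough letters to stay in \<open>A\<close> and \<open>B\<close> although
      \<open>h\<close> displaces letters by the difference of the word lengths, to see the prefix
      \<open>w\<close>, and to reach every letter of \<open>y\<close> that is compared with a letter
      of \<open>u\<close>.\<close>
    define n where "n = m + m' + length u + length w + l"
    have "y' \<in> f -` sft_basic_set D k l A B \<inter> cylinder D w" if y': "y' \<in> cylinder D (prefix n y)" for y'
    proof -
      have agree: "y' i = y i" if "i < n" for i
        using y' that by (simp add: cylinder_def)
      have y'sft: "y' \<in> sft D" using y' by (simp add: cylinder_def)
      have w': "y' \<in> cylinder D w"
        using y y'sft agree by (simp add: cylinder_def n_def)
      have "h y' i = h y i" if "i < m" for i
        using that by (auto simp: h_def conc_def n_def intro!: agree)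
      then have "h y' \<in> A"
        using m(1) h_in[OF w'] by (force simp: cylinder_def)
      moreover have "y' \<in> B"
        using m(2) y'sft agree by (force simp: cylinder_def n_def)
      \<comment> \<open>This equation between infinite tails is still a finite condition: past the
        letters of \<open>u\<close> it holds for every point because \<open>c = k - l\<close>, and
        before that it compares letters on which \<open>y'\<close> and \<open>y\<close>
        agree.\<close>
      moreover have "suffix k (h y') = suffix l y'"
      proof
        fix i
        show "suffix k (h y') i = suffix l y' i"
        proof (cases "k + i < length u")
          case True
          then have "l + i < n" using kl(1) unfolding c_def n_def by linarith
          then have "y' (l + i) = h y (k + i)"
            using agree fun_cong[OF kl(4), of i] by simp
          then show ?thesis using True by (simp add: h_def)
        next
          case False
          then have "length w + (k + i - length u) = l + i"
            using kl(1) unfolding c_def by linarith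
          then show ?thesis using False by (simp add: h_def)
        qed
      qed
      moreover have "f y' \<in> sft_arrows D"
        using w' image U_word_subset_arrows by blast
      ultimately show ?thesis
        using w' kl(1) by (simp add: f_def sft_basic_set_def shift_funpow)
    qed
    then show "\<exists>n. cylinder D (prefix n y) \<subseteq> f -` sft_basic_set D k l A B \<inter> cylinder D w"
      by blast
  qed
  have "continuous_map (subtopology (sft_topology D) (cylinder D w)) (gtop (sft_groupoid D)) f"
    unfolding gtop_sft_groupoid
  proof (rule continuous_on_generated_topo)
    have top: "topspace (subtopology (sft_topology D) (cylinder D w)) = cylinder D w"
      by (auto simp: topspace_sft_topology cylinder_def)
    show "openin (subtopology (sft_topology D) (cylinder D w))
        (f -` S \<inter> topspace (subtopology (sft_topology D) (cylinder D w)))"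
      if "S \<in> {sft_basic_set D k l A B | k l A B.
        1 \<le> k \<and> 1 \<le> l \<and> openin (sft_topology D) A \<and> openin (sft_topology D) B}" for S
      unfolding top openin_open_subtopology[OF openin_cylinder] using that pre by blast
    have "\<Union>{sft_basic_set D k l A B | k l A B.
        1 \<le> k \<and> 1 \<le> l \<and> openin (sft_topology D) A \<and> openin (sft_topology D) B} = sft_arrows D"
      using topspace_sft_groupoid[of D] unfolding gtop_sft_groupoid topology_generated_by_topspace .
    note eq = this
    show "f ` topspace (subtopology (sft_topology D) (cylinder D w)) \<subseteq>
      \<Union>{sft_basic_set D k l A B | k l A B.
        1 \<le> k \<and> 1 \<le> l \<and> openin (sft_topology D) A \<and> openin (sft_topology D) B}"
      unfolding top eq image[symmetric] by (rule U_word_subset_arrows)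
  qed
  moreover have "compactin (subtopology (sft_topology D) (cylinder D w)) (cylinder D w)"
    using compact_cylinder[OF assms(1)] by (simp add: compactin_subtopology)
  ultimately show ?thesis
    unfolding image using image_compactin by blast
qed

text \<open>Induction on the generation of the open set. Intersections reduce to the smaller of two
  nested sets; a generating set is treated by cutting both ends of the arrow at long
  prefixes.\<close>

lemma open_contains_U_word:
  assumes "openin (gtop (sft_groupoid D)) V" "g \<in> V"
  obtains u w where "is_word D u" "is_word D w" "g \<in> U_word D u w" "U_word D u w \<subseteq> V"
proof -
  let ?S = "{sft_basic_set D k l A B | k l A B.
    1 \<le> k \<and> 1 \<le> l \<and> openin (sft_topology D) A \<and> openin (sft_topology D) B}"
  have "generate_topology_on ?S V"
    using assms(1) unfolding gtop_sft_groupoid openin_topology_generated_by_iff .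
  then have "\<forall>g\<in>V. \<exists>u w. is_word D u \<and> is_word D w \<and> g \<in> U_word D u w \<and> U_word D u w \<subseteq> V"
  proof induction
    case Empty
    then show ?case by simp
  next
    case (Int a b)
    show ?case
    proof
      fix g assume "g \<in> a \<inter> b"
      with Int.IH obtain u w u' w' where *: "is_word D u" "is_word D w" "g \<in> U_word D u w" "U_word D u w \<subseteq> a"
        "is_word D u'" "is_word D w'" "g \<in> U_word D u' w'" "U_word D u' w' \<subseteq> b"
        by (meson IntD1 IntD2)
      from U_word_int_comparable[OF *(3,7)] U_word_append_subset
      have "U_word D u' w' \<subseteq> U_word D u w \<or> U_word D u w \<subseteq> U_word D u' w'" by metis
      then show "\<exists>u w. is_word D u \<and> is_word D w \<and> g \<in> U_word D u w \<and> U_word D u w \<subseteq> a \<inter> b"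
        using * by (meson Int_greatest order_trans)
    qed
  next
    case (UN K)
    then show ?case by (meson Union_iff Union_upper order_trans)
  next
    case (Basis s)
    then obtain k l A B where s: "s = sft_basic_set D k l A B" and kl: "1 \<le> k" "1 \<le> l"
      and A: "openin (sft_topology D) A" and B: "openin (sft_topology D) B" by blast
    show ?case
    proof
      fix g assume "g \<in> s"
      then obtain x y where g: "g = (x, int k - int l, y)" "g \<in> sft_arrows D" "x \<in> A" "y \<in> B"
        "suffix k x = suffix l y"
        unfolding s sft_basic_set_def shift_funpow by blast
      have xy: "x \<in> sft D" "y \<in> sft D" using g A B openin_sft_topology_iff by blast+
      from A B g obtain m m' where m: "cylinder D (prefix m x) \<subseteq> A" "cylinder D (prefix m' y) \<subseteq> B"
        unfolding openin_sft_topology_iff by meson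
      \<comment> \<open>Taking \<open>r\<close> letters beyond both exponents preserves the
        difference \<open>k - l\<close> and makes the two prefixes long enough for their cylinders
        to lie in \<open>A\<close> and \<open>B\<close>.\<close>
      define r where "r = m + m'"
      define u w where "u = prefix (k + r) x" and "w = prefix (l + r) y"
      have "cylinder D u \<subseteq> A" "cylinder D w \<subseteq> B"
        using m cylinder_append_subset[of D "prefix m x" "x [m \<rightarrow> k + r]"]
          cylinder_append_subset[of D "prefix m' y" "y [m' \<rightarrow> l + r]"]
          subsequence_append[of x m "k + r - m"] subsequence_append[of y m' "l + r - m'"]
        unfolding u_def w_def r_def by (auto simp: algebra_simps)
      moreover have "g \<in> U_word D u w"
      proof -
        have x: "u \<frown> suffix (k + r) x = x" and y: "w \<frown> suffix (l + r) y = y"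
          by (simp_all add: u_def w_def)
        have "suffix (l + r) y = suffix (k + r) x"
          using arg_cong[OF g(5), of "suffix r"] by simp
        then have "w \<frown> suffix (k + r) x = y" using y by simp
        then show ?thesis
          using U_word_mem_iff[of u "suffix (k + r) x" "int k - int l" w D] g(1) xy x
          by (simp add: u_def w_def)
      qed
      moreover have "U_word D u w \<subseteq> s"
      proof
        fix h assume "h \<in> U_word D u w"
        then obtain z where h: "h = (u \<frown> z, int k - int l, w \<frown> z)" "u \<frown> z \<in> sft D" "w \<frown> z \<in> sft D"
          by (auto simp: U_word_eq u_def w_def)
        \<comment> \<open>The two words coincide after \<open>k\<close> and \<open>l\<close> letters
          respectively, so every arrow over them, and not only \<open>g\<close>, satisfies the shift
          equation.\<close>
        have "drop k u = drop l w"
          unfolding u_def w_def using g(5)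
          by (simp add: fun_eq_iff list_eq_iff_nth_eq)
        then have "suffix k (u \<frown> z) = suffix l (w \<frown> z)"
          by (simp add: u_def w_def)
        moreover have "h \<in> sft_arrows D" "u \<frown> z \<in> A" "w \<frown> z \<in> B"
          using h \<open>h \<in> U_word D u w\<close> U_word_subset_arrows \<open>cylinder D u \<subseteq> A\<close> \<open>cylinder D w \<subseteq> B\<close>
            conc_mem_cylinder_iff by blast+
        ultimately show "h \<in> s"
          unfolding s sft_basic_set_def shift_funpow using h(1) by blast
      qed
      moreover have "is_word D u" "is_word D w"
        using kl xy unfolding u_def w_def by (auto intro!: is_word_prefix)
      ultimately show "\<exists>u w. is_word D u \<and> is_word D w \<and> g \<in> U_word D u w \<and> U_word D u w \<subseteq> s"
        by blast
    qed
  qed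
  with assms(2) that show thesis by blast
qed

section \<open>The sets $U_{\mu,\nu}$\<close>

lemma conc_eq_append_conc_iff: "w \<frown> z = (w @ t) \<frown> z' \<longleftrightarrow> z = t \<frown> z'"
  unfolding conc_conc[symmetric] using concat_eq[of w w] by blast

section \<open>Products of sets of arrows\<close>

lemma gmult_sft_groupoid: "gmult (sft_groupoid D) (x, n, y) (y', m, z) = (x, n + m, z)"
  by (simp add: sft_groupoid_def)

lemma ginv_sft_groupoid: "ginv (sft_groupoid D) (x, n, y) = (y, - n, x)"
  by (simp add: sft_groupoid_def)

lemma inj_sft_unit: "inj sft_unit"
  by (auto simp: inj_def sft_unit_def)

lemma sft_unit_eq_iff [simp]: "sft_unit x = sft_unit y \<longleftrightarrow> x = y"
  by (simp add: sft_unit_def)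

lemma sft_unit_image_eq_iff [simp]: "sft_unit ` A = sft_unit ` B \<longleftrightarrow> A = B"
  by (rule inj_image_eq_iff[OF inj_sft_unit])

lemma gset_mult_sft_groupoid: "gset_mult (sft_groupoid D) U V =
    {(x, n + m, z) | x n y m z. (x, n, y) \<in> U \<and> (y, m, z) \<in> V}"
  unfolding gset_mult_def
  by (force simp: gmult_sft_groupoid gsource_sft_groupoid grange_sft_groupoid)

lemma arrow_subsetI: "(\<And>x n y. (x, n, y) \<in> A \<Longrightarrow> (x, n, y) \<in> B) \<Longrightarrow> A \<subseteq> B"
  by auto

lemma gset_multI:
  "(x, n, y) \<in> U \<Longrightarrow> (y, m, z) \<in> V \<Longrightarrow> k = n + m \<Longrightarrow> (x, k, z) \<in> gset_mult (sft_groupoid D) U V"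
  unfolding gset_mult_sft_groupoid by blast

lemma gset_multE:
  assumes "(x, k, z) \<in> gset_mult (sft_groupoid D) U V"
  obtains n y m where "(x, n, y) \<in> U" "(y, m, z) \<in> V" "k = n + m"
  using assms unfolding gset_mult_sft_groupoid by blast

lemma gset_mult_assoc:
  "gset_mult (sft_groupoid D) (gset_mult (sft_groupoid D) U V) W =
   gset_mult (sft_groupoid D) U (gset_mult (sft_groupoid D) V W)" (is "?L = ?R")
proof (intro subset_antisym arrow_subsetI)
  fix x k z
  show "(x, k, z) \<in> ?R" if "(x, k, z) \<in> ?L"
    using that by (elim gset_multE) (auto intro!: gset_multI)
  show "(x, k, z) \<in> ?L" if "(x, k, z) \<in> ?R"
    using that by (elim gset_multE) (auto intro!: gset_multI)
qed

lemma gset_mult_UN: "gset_mult (sft_groupoid D) (\<Union>i\<in>I. U i) (\<Union>j\<in>J. V j) =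
    (\<Union>(i, j)\<in>I \<times> J. gset_mult (sft_groupoid D) (U i) (V j))"
  unfolding gset_mult_sft_groupoid by blast

lemma gset_mult_mono:
  "U \<subseteq> U' \<Longrightarrow> V \<subseteq> V' \<Longrightarrow> gset_mult (sft_groupoid D) U V \<subseteq> gset_mult (sft_groupoid D) U' V'"
  unfolding gset_mult_sft_groupoid by blast

text \<open>The ends of an arrow as points of the shift space, whereas \<open>grange\<close> and
  \<open>gsource\<close> return unit arrows. Working with points avoids carrying
  \<open>sft_unit\<close> through every computation.\<close>

definition arrow_range :: "'e sft_arrow \<Rightarrow> nat \<Rightarrow> 'e" where
  "arrow_range = (\<lambda>(x, n, y). x)"

definition arrow_source :: "'e sft_arrow \<Rightarrow> nat \<Rightarrow> 'e" where
  "arrow_source = (\<lambda>(x, n, y). y)"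

lemma arrow_range_simp [simp]: "arrow_range (x, n, y) = x"
  and arrow_source_simp [simp]: "arrow_source (x, n, y) = y"
  by (simp_all add: arrow_range_def arrow_source_def)

lemma gsource_eq: "gsource (sft_groupoid D) g = sft_unit (arrow_source g)"
  and grange_eq: "grange (sft_groupoid D) g = sft_unit (arrow_range g)"
  by (cases g; simp add: gsource_sft_groupoid grange_sft_groupoid sft_unit_def)+

lemma gsource_image: "gsource (sft_groupoid D) ` V = sft_unit ` arrow_source ` V"
  and grange_image: "grange (sft_groupoid D) ` V = sft_unit ` arrow_range ` V"
  by (simp_all add: image_image gsource_eq grange_eq)

lemma G_set_sft_groupoid_iff: "G_set (sft_groupoid D) V \<longleftrightarrow>
    V \<subseteq> sft_arrows D \<and> inj_on arrow_range V \<and> inj_on arrow_source V"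
  by (simp add: G_set_def topspace_sft_groupoid inj_on_def gsource_eq grange_eq)

lemma inj_on_arrow_sourceD:
  "inj_on arrow_source V \<Longrightarrow> (x, n, y) \<in> V \<Longrightarrow> (x', n', y) \<in> V \<Longrightarrow> x = x' \<and> n = n'"
  unfolding inj_on_def by fastforce

lemma inj_on_arrow_rangeD:
  "inj_on arrow_range V \<Longrightarrow> (x, n, y) \<in> V \<Longrightarrow> (x, n', y') \<in> V \<Longrightarrow> y = y' \<and> n = n'"
  unfolding inj_on_def by fastforce

lemma gunits_sft_groupoid: "gunits (sft_groupoid D) = sft_unit ` sft D"
proof -
  have "arrow_source ` sft_arrows D = sft D"
  proof (intro equalityI subsetI)
    fix y assume "y \<in> arrow_source ` sft_arrows D"
    then show "y \<in> sft D" by (auto simp: sft_arrows_def)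
  next
    fix y assume "y \<in> sft D"
    then have "(y, 0, y) \<in> sft_arrows D" using sft_arrows_conc[of "[]" y D "[]" 0] by simp
    then show "y \<in> arrow_source ` sft_arrows D" by force
  qed
  then show ?thesis
    unfolding gunits_def gsource_image topspace_sft_groupoid by simp
qed

lemma U_word_ends:
  assumes "u \<noteq> []" "w \<noteq> []" "U_word D u w \<noteq> {}"
  shows "word_end D u = word_end D w" and "u \<frown> z \<in> sft D \<longleftrightarrow> w \<frown> z \<in> sft D"
proof -
  from assms(3) obtain y where y: "u \<frown> y \<in> sft D" "w \<frown> y \<in> sft D" by (auto simp: U_word_eq)
  show "word_end D u = word_end D w"
    using conc_mem_sft_iff[OF assms(1) y(1), of y] conc_mem_sft_iff[OF assms(2) y(2), of y] y
    by (simp add: follower_set_def)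
  show "u \<frown> z \<in> sft D \<longleftrightarrow> w \<frown> z \<in> sft D"
    using conc_mem_sft_cong[OF assms(1,2) y] .
qed

lemma U_word_source:
  assumes "u \<noteq> []" "w \<noteq> []" "U_word D u w \<noteq> {}"
  shows "arrow_source ` U_word D u w = cylinder D w"
proof (intro equalityI subsetI)
  fix y assume "y \<in> arrow_source ` U_word D u w"
  then show "y \<in> cylinder D w" by (auto simp: U_word_eq conc_mem_cylinder_iff)
next
  fix y assume "y \<in> cylinder D w"
  then obtain z where z: "y = w \<frown> z" "w \<frown> z \<in> sft D" by (rule mem_cylinderE)
  then have "(u \<frown> z, int (length u) - int (length w), w \<frown> z) \<in> U_word D u w"
    using U_word_ends(2)[OF assms] by (simp add: U_word_mem_iff)
  then show "y \<in> arrow_source ` U_word D u w" using z(1) by force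
qed

lemma U_word_inverse: "ginv (sft_groupoid D) ` U_word D u w = U_word D w u"
  unfolding U_word_eq by (force simp: ginv_sft_groupoid image_iff)

lemma U_word_range:
  assumes "u \<noteq> []" "w \<noteq> []" "U_word D u w \<noteq> {}"
  shows "arrow_range ` U_word D u w = cylinder D u"
proof -
  have "arrow_range g = arrow_source (ginv (sft_groupoid D) g)" for g :: "_ sft_arrow"
    by (cases g) (simp add: ginv_sft_groupoid)
  then have "arrow_range ` U_word D u w = arrow_source ` U_word D w u"
    unfolding U_word_inverse[of D u w, symmetric] image_image by (intro image_cong refl)
  moreover have "U_word D w u \<noteq> {}" using assms(3) by (auto simp: U_word_eq)
  ultimately show ?thesis using U_word_source[OF assms(2,1)] by simp
qed

lemma inj_on_U_word: "inj_on arrow_range (U_word D u w)" "inj_on arrow_source (U_word D u w)"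
  by (auto simp: inj_on_def U_word_eq)

lemma U_word_diag: "U_word D w w = {(x, 0, x) | x. x \<in> cylinder D w}"
  by (auto simp: U_word_eq conc_mem_cylinder_iff elim: mem_cylinderE)

text \<open>Multiplying on the left replaces the prefix \<open>w\<close> by \<open>u\<close> and
  leaves the letters \<open>t\<close> in place. Non-emptiness provides the reverse inclusion: it
  makes the tails of \<open>u\<close> and \<open>w\<close> the same, so an arrow of the right-hand
  side factors through a point over \<open>w\<close>.\<close>

lemma U_word_mult_append_left:
  assumes "u \<noteq> []" "w \<noteq> []" "U_word D u w \<noteq> {}"
  shows "gset_mult (sft_groupoid D) (U_word D u w) (U_word D (w @ t) v) = U_word D (u @ t) v"
proof (intro subset_antisym arrow_subsetI)
  fix x k y
  assume "(x, k, y) \<in> gset_mult (sft_groupoid D) (U_word D u w) (U_word D (w @ t) v)"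
  then obtain n m p where *: "(x, n, p) \<in> U_word D u w" "(p, m, y) \<in> U_word D (w @ t) v" "k = n + m"
    by (rule gset_multE)
  from *(1) obtain z where z: "x = u \<frown> z" "p = w \<frown> z" "n = int (length u) - int (length w)"
    "u \<frown> z \<in> sft D" by (rule U_wordE)
  from *(2) obtain z' where z': "p = (w @ t) \<frown> z'" "y = v \<frown> z'" "v \<frown> z' \<in> sft D"
    "m = int (length (w @ t)) - int (length v)" by (rule U_wordE)
  from z(2) z'(1) have "z = t \<frown> z'" using conc_eq_append_conc_iff by metis
  with * z z' show "(x, k, y) \<in> U_word D (u @ t) v" by (simp add: U_word_mem_iff)
next
  fix x k y
  assume "(x, k, y) \<in> U_word D (u @ t) v"
  then obtain z where z: "x = (u @ t) \<frown> z" "y = v \<frown> z" "v \<frown> z \<in> sft D" "(u @ t) \<frown> z \<in> sft D"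
    "k = int (length (u @ t)) - int (length v)" by (rule U_wordE)
  from z(4) have w: "w \<frown> t \<frown> z \<in> sft D" "u \<frown> t \<frown> z \<in> sft D"
    using U_word_ends(2)[OF assms, of "t \<frown> z"] by simp_all
  have x: "x = u \<frown> t \<frown> z" using z(1) by simp
  show "(x, k, y) \<in> gset_mult (sft_groupoid D) (U_word D u w) (U_word D (w @ t) v)"
  proof (rule gset_multI)
    show "(x, int (length u) - int (length w), w \<frown> t \<frown> z) \<in> U_word D u w"
      unfolding x U_word_mem_iff using w by blast
    show "(w \<frown> t \<frown> z, int (length (w @ t)) - int (length v), y) \<in> U_word D (w @ t) v"
      unfolding conc_conc z(2) U_word_mem_iff using w(1) z(3) by simp
  qed (simp add: z(5))
qed

lemma gset_mult_inverse:
  "ginv (sft_groupoid D) ` gset_mult (sft_groupoid D) U V =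
   gset_mult (sft_groupoid D) (ginv (sft_groupoid D) ` V) (ginv (sft_groupoid D) ` U)"
  unfolding gset_mult_sft_groupoid
  by (force simp: ginv_sft_groupoid image_iff)

text \<open>Inversion exchanges the two words and the order of the factors, so this is the left-hand
  version inverted.\<close>

lemma U_word_mult_append_right:
  assumes "v \<noteq> []" "w \<noteq> []" "U_word D w v \<noteq> {}"
  shows "gset_mult (sft_groupoid D) (U_word D u (w @ t)) (U_word D w v) = U_word D u (v @ t)"
proof -
  have "U_word D v w \<noteq> {}" using assms(3) by (auto simp: U_word_eq)
  from arg_cong[OF U_word_mult_append_left[OF assms(1,2) this, of t u], of "image (ginv (sft_groupoid D))"]
  show ?thesis unfolding gset_mult_inverse U_word_inverse .
qed

text \<open>The middle point of a composable pair has both \<open>b\<close> and \<open>c\<close> as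
  prefixes, so one extends the other, and the surplus letters are transferred to the outer word on
  the shorter side.\<close>

lemma U_word_mult_cases:
  assumes "is_word D a" "is_word D b" "is_word D c" "is_word D d"
  shows "gset_mult (sft_groupoid D) (U_word D a b) (U_word D c d) = {} \<or>
    (\<exists>e f. is_word D e \<and> is_word D f \<and>
       gset_mult (sft_groupoid D) (U_word D a b) (U_word D c d) = U_word D e f)"
proof (cases "gset_mult (sft_groupoid D) (U_word D a b) (U_word D c d) = {}")
  case False
  then obtain x n y m z where *: "(x, n, y) \<in> U_word D a b" "(y, m, z) \<in> U_word D c d"
    unfolding gset_mult_sft_groupoid by blast
  have ne: "U_word D a b \<noteq> {}" "U_word D c d \<noteq> {}" using * by blast+
  have "y \<in> cylinder D b" "y \<in> cylinder D c" using * by (auto simp: U_word_def)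
  from cylinder_comparable[OF this]
  show ?thesis
  proof
    assume "\<exists>t. c = b @ t"
    then obtain t where t: "c = b @ t" by blast
    have eq: "gset_mult (sft_groupoid D) (U_word D a b) (U_word D c d) = U_word D (a @ t) d"
      unfolding t using U_word_mult_append_left[OF _ _ ne(1)] assms by (simp add: is_word_def)
    moreover have "is_word D (a @ t)" using assms t by (auto simp: is_word_def)
    ultimately show ?thesis using assms by blast
  next
    assume "\<exists>t. b = c @ t"
    then obtain t where t: "b = c @ t" by blast
    have eq: "gset_mult (sft_groupoid D) (U_word D a b) (U_word D c d) = U_word D a (d @ t)"
      unfolding t using U_word_mult_append_right[OF _ _ ne(2)] assms by (simp add: is_word_def)
    moreover have "is_word D (d @ t)" using assms t by (auto simp: is_word_def)
    ultimately show ?thesis using assms by blast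
  qed
qed blast

text \<open>The basic sets contained in \<open>V\<close> cover it, and compactness leaves finitely
  many of them. This is what replaces topology by finite sets of words.\<close>

lemma compact_open_iff:
  assumes "finite (arcs D)"
  shows "compactin (gtop (sft_groupoid D)) V \<and> openin (gtop (sft_groupoid D)) V \<longleftrightarrow>
    (\<exists>F. finite F \<and> F \<subseteq> Collect (is_word D) \<times> Collect (is_word D) \<and> V = (\<Union>(u, w)\<in>F. U_word D u w))"
    (is "?L \<longleftrightarrow> ?R")
proof
  assume ?L
  let ?F = "{p \<in> Collect (is_word D) \<times> Collect (is_word D). case_prod (U_word D) p \<subseteq> V}"
  have cover: "V \<subseteq> \<Union>(case_prod (U_word D) ` ?F)"
  proof
    fix g assume "g \<in> V"
    moreover have "openin (gtop (sft_groupoid D)) V" using \<open>?L\<close> by blast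
    ultimately obtain u w where uw: "is_word D u" "is_word D w" "g \<in> U_word D u w" "U_word D u w \<subseteq> V"
      by (elim open_contains_U_word)
    then show "g \<in> \<Union>(case_prod (U_word D) ` ?F)"
      by (intro UnionI[of "case_prod (U_word D) (u, w)"] imageI) simp_all
  qed
  have opn: "openin (gtop (sft_groupoid D)) U" if "U \<in> case_prod (U_word D) ` ?F" for U
    using that by (auto simp: is_word_def intro!: openin_U_word)
  have "compactin (gtop (sft_groupoid D)) V" using \<open>?L\<close> ..
  then have "\<exists>\<F>. finite \<F> \<and> \<F> \<subseteq> case_prod (U_word D) ` ?F \<and> V \<subseteq> \<Union>\<F>"
    by (rule compactinD[OF _ opn cover])
  then obtain \<F> where \<F>: "finite \<F>" "\<F> \<subseteq> case_prod (U_word D) ` ?F" "V \<subseteq> \<Union>\<F>"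
    by (elim exE conjE)
  from finite_subset_image[OF \<F>(1,2)] obtain F where F: "F \<subseteq> ?F" "finite F" "\<F> = case_prod (U_word D) ` F"
    by (elim exE conjE)
  moreover from F have "F \<subseteq> Collect (is_word D) \<times> Collect (is_word D)" by blast
  moreover have "V = (\<Union>(u, w)\<in>F. U_word D u w)"
  proof
    show "V \<subseteq> (\<Union>(u, w)\<in>F. U_word D u w)" using \<F>(3) unfolding F(3) .
    show "(\<Union>(u, w)\<in>F. U_word D u w) \<subseteq> V" using F(1) by blast
  qed
  ultimately show ?R by (intro exI[of _ F] conjI)
next
  assume ?R
  then obtain F where F: "finite F" "F \<subseteq> Collect (is_word D) \<times> Collect (is_word D)"
    "V = (\<Union>(u, w)\<in>F. U_word D u w)" by blast
  have oc: "\<forall>U\<in>case_prod (U_word D) ` F. openin (gtop (sft_groupoid D)) U \<and> compactin (gtop (sft_groupoid D)) U"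
  proof
    fix U assume "U \<in> case_prod (U_word D) ` F"
    then obtain u w where uw: "(u, w) \<in> F" "U = U_word D u w" by auto
    then have "u \<noteq> []" "w \<noteq> []" using F(2) is_word_nonempty by auto
    then show "openin (gtop (sft_groupoid D)) U \<and> compactin (gtop (sft_groupoid D)) U"
      unfolding uw(2) using openin_U_word compactin_U_word[OF assms] by blast
  qed
  show ?L
    unfolding F(3)
  proof
    show "openin (gtop (sft_groupoid D)) (\<Union>(case_prod (U_word D) ` F))"
      by (rule openin_Union) (use oc in blast)
    show "compactin (gtop (sft_groupoid D)) (\<Union>(case_prod (U_word D) ` F))"
      using finite_imageI[OF F(1)] by (rule compactin_Union) (use oc in blast)
  qed
qed

section \<open>Branching\<close>

text \<open>Suppose \<open>p\<close> is the shorter word. The letter of \<open>z\<close> at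
  \<open>i\<close> is the letter of \<open>q \<frown> z\<close> at \<open>length p + i\<close>,
  which is either a letter of \<open>q\<close> or a letter of \<open>z\<close> at an index below
  \<open>i\<close>. So the equation determines \<open>z\<close> recursively.\<close>

lemma conc_fixpoint_unique:
  assumes "p \<frown> z = q \<frown> z" "p \<frown> z' = q \<frown> z'" "length p \<noteq> length q"
  shows "z = z'"
proof -
  have *: "z = z'"
    if eq: "p \<frown> z = q \<frown> z" "p \<frown> z' = q \<frown> z'" and len: "length p < length q"
    for p q :: "'a list"
  proof
    fix i show "z i = z' i"
    proof (induction i rule: less_induct)
      case (less i)
      have z: "z i = (q \<frown> z) (length p + i)" and z': "z' i = (q \<frown> z') (length p + i)"
        by (simp_all flip: eq)
      show ?case
      proof (cases "length p + i < length q")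
        case True
        then show ?thesis unfolding z z' by simp
      next
        case False
        then have "length p + i - length q < i" using len by linarith
        from less[OF this] False show ?thesis unfolding z z' by simp
      qed
    qed
  qed
  show ?thesis
    using *[of p q] *[of q p] assms by (metis nat_neq_iff)
qed

section \<open>Paths read off from powers of the adjacency matrix\<close>

lemma matrix_power_Suc_pos:
  assumes "matrix_power I M (Suc n) \<xi> \<eta> > 0"
  obtains \<zeta> where "\<zeta> \<in> I" "matrix_power I M n \<xi> \<zeta> > 0" "M \<zeta> \<eta> > 0"
proof -
  have "(\<Sum>\<zeta>\<in>I. matrix_power I M n \<xi> \<zeta> * M \<zeta> \<eta>) \<noteq> 0"
    using assms by simp
  then obtain \<zeta> where "\<zeta> \<in> I" "matrix_power I M n \<xi> \<zeta> * M \<zeta> \<eta> \<noteq> 0"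
    by (rule sum.not_neutral_contains_not_neutral)
  then show thesis using that[of \<zeta>] by simp
qed

lemma adjacency_pos:
  assumes "adjacency D \<xi> \<eta> > 0"
  obtains e where "e \<in> arcs D" "tail D e = \<xi>" "head D e = \<eta>"
proof -
  have "{e \<in> arcs D. tail D e = \<xi> \<and> head D e = \<eta>} \<noteq> {}"
    using assms unfolding adjacency_def by (metis card.empty less_irrefl)
  with that show thesis by blast
qed

text \<open>A positive entry of the power yields a path from \<xi> to \<eta>, and a path starting in
  \<open>R\<close> cannot leave it.\<close>

lemma matrix_power_adjacency_closed:
  assumes "\<And>e. e \<in> arcs D \<Longrightarrow> tail D e \<in> R \<Longrightarrow> head D e \<in> R"
    and "matrix_power I (adjacency D) n \<xi> \<eta> > 0" "\<xi> \<in> R"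
  shows "\<eta> \<in> R"
  using assms(2)
proof (induction n arbitrary: \<eta>)
  case 0
  then show ?case using assms(3) by (simp split: if_splits)
next
  case (Suc n)
  from Suc.prems obtain \<zeta> where \<zeta>: "matrix_power I (adjacency D) n \<xi> \<zeta> > 0" "adjacency D \<zeta> \<eta> > 0"
    by (rule matrix_power_Suc_pos)
  from \<zeta>(2) obtain e where "e \<in> arcs D" "tail D e = \<zeta>" "head D e = \<eta>" by (rule adjacency_pos)
  then show ?case using assms(1)[of e] Suc.IH[OF \<zeta>(1)] by simp
qed

lemma matrix_power_adjacency_out_arc:
  assumes "matrix_power I (adjacency D) (Suc n) \<xi> \<eta> > 0"
  shows "\<exists>e\<in>arcs D. tail D e = \<xi>"
  using assms
proof (induction n arbitrary: \<eta>)
  case 0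
  from 0 obtain \<zeta> where \<zeta>: "matrix_power I (adjacency D) 0 \<xi> \<zeta> > 0" "adjacency D \<zeta> \<eta> > 0"
    by (rule matrix_power_Suc_pos)
  from \<zeta>(2) obtain e where "e \<in> arcs D" "tail D e = \<zeta>" by (rule adjacency_pos)
  with \<zeta>(1) show ?case by (auto split: if_splits)
next
  case (Suc n)
  from Suc.prems obtain \<zeta> where "matrix_power I (adjacency D) (Suc n) \<xi> \<zeta> > 0"
    by (rule matrix_power_Suc_pos)
  then show ?case by (rule Suc.IH)
qed

definition branching :: "('v, 'e) pre_digraph \<Rightarrow> 'v \<Rightarrow> bool" where
  "branching D v \<longleftrightarrow> (\<exists>e\<in>arcs D. \<exists>e'\<in>arcs D. e \<noteq> e' \<and> tail D e = v \<and> tail D e' = v)"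

lemma not_branchingD:
  "\<not> branching D v \<Longrightarrow> e \<in> arcs D \<Longrightarrow> e' \<in> arcs D \<Longrightarrow> tail D e = v \<Longrightarrow> tail D e' = v \<Longrightarrow> e = e'"
  unfolding branching_def by blast

locale irreducible_sft = fin_digraph D for D :: "('v, 'e) pre_digraph" +
  assumes irreducible: "irreducible_matrix (verts D) (adjacency D)"
    and not_permutation: "\<not> permutation_matrix (verts D) (adjacency D)"
begin

lemma vertex_cases:
  assumes "\<xi> \<in> verts D" "\<eta> \<in> verts D"
  obtains n where "matrix_power (verts D) (adjacency D) (Suc n) \<xi> \<eta> > 0"
  using irreducible assms unfolding irreducible_matrix_def
  by (metis Suc_le_D One_nat_def)

lemma out_arc: "v \<in> verts D \<Longrightarrow> \<exists>e\<in>arcs D. tail D e = v"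
  by (metis vertex_cases matrix_power_adjacency_out_arc)

lemma in_arc: "v \<in> verts D \<Longrightarrow> \<exists>e\<in>arcs D. head D e = v"
  by (metis vertex_cases matrix_power_Suc_pos adjacency_pos)

lemma follower_set_nonempty:
  assumes "v \<in> verts D"
  shows "\<exists>z. z \<in> follower_set D v"
proof -
  obtain f where f: "\<And>v. v \<in> verts D \<Longrightarrow> f v \<in> arcs D" "\<And>v. v \<in> verts D \<Longrightarrow> tail D (f v) = v"
    using out_arc by metis
  define s where "s = (\<lambda>k. ((\<lambda>v. head D (f v)) ^^ k) v)"
  have s: "s k \<in> verts D" for k
    by (induction k) (simp_all add: s_def assms f)
  have "(\<lambda>k. f (s k)) \<in> sft D"
    unfolding sft_def
  proof (intro CollectI allI conjI)
    show "f (s k) \<in> arcs D" for k by (rule f(1)[OF s])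
    show "head D (f (s k)) = tail D (f (s (Suc k)))" for k
      unfolding f(2)[OF s] by (simp add: s_def)
  qed
  moreover have "tail D (f (s 0)) = v" using f(2)[OF s, of 0] by (simp add: s_def)
  ultimately show ?thesis unfolding follower_set_def by blast
qed

lemma tail_sft_verts: "x \<in> sft D \<Longrightarrow> tail D (x k) \<in> verts D"
  by (rule tail_in_verts[OF sft_arc])

text \<open>If no vertex on \<open>z\<close> branches, the vertices on \<open>z\<close> are closed
  under outgoing arcs, so by irreducibility they are all vertices, and each has exactly one outgoing
  arc. Every vertex also has an incoming arc, so following the unique arcs is a surjection of a
  finite set onto itself, hence a permutation, and its matrix is the adjacency matrix.\<close>

lemma exists_branching:
  assumes z: "z \<in> sft D"
  shows "\<exists>j. branching D (tail D (z j))"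
proof (rule ccontr)
  assume nb: "\<nexists>j. branching D (tail D (z j))"
  define R where "R = range (\<lambda>j. tail D (z j))"
  have closed: "head D e \<in> R" if e: "e \<in> arcs D" "tail D e \<in> R" for e
  proof -
    from e(2) obtain j where j: "tail D e = tail D (z j)" unfolding R_def by blast
    have "e = z j"
      using nb by (intro not_branchingD[of D "tail D (z j)"] e(1) sft_arc[OF z] j) auto
    then show ?thesis unfolding R_def using sft_step[OF z, of j] by simp
  qed
  have R: "v \<in> R" if v: "v \<in> verts D" for v
  proof -
    obtain n where n: "matrix_power (verts D) (adjacency D) (Suc n) (tail D (z 0)) v > 0"
      using vertex_cases[OF tail_sft_verts[OF z] v] .
    have "tail D (z 0) \<in> R" unfolding R_def by blast
    from matrix_power_adjacency_closed[OF closed n this] show ?thesis .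
  qed
  then have nb': "\<not> branching D v" if "v \<in> verts D" for v
    using that nb unfolding R_def by blast
  obtain f where f: "\<And>v. v \<in> verts D \<Longrightarrow> f v \<in> arcs D" "\<And>v. v \<in> verts D \<Longrightarrow> tail D (f v) = v"
    using out_arc by metis
  have f_unique: "e = f v" if "e \<in> arcs D" "tail D e = v" for e v
  proof -
    have v: "v \<in> verts D" using tail_in_verts[OF that(1)] that(2) by simp
    show ?thesis by (rule not_branchingD[OF nb'[OF v] that(1) f(1)[OF v] that(2) f(2)[OF v]])
  qed
  define p where "p = (\<lambda>v. head D (f v))"
  have "p ` verts D = verts D"
  proof (intro equalityI subsetI)
    fix v assume "v \<in> verts D"
    with in_arc obtain e where "e \<in> arcs D" "head D e = v" by blast
    then have "v = p (tail D e)" using f_unique[of e] by (simp add: p_def)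
    then show "v \<in> p ` verts D" using \<open>e \<in> arcs D\<close> by simp
  qed (auto simp: p_def f)
  then have "bij_betw p (verts D) (verts D)"
    unfolding bij_betw_def using finite_surj_inj[OF finite_verts, of p] by simp
  moreover have "adjacency D \<xi> \<eta> = (if \<eta> = p \<xi> then 1 else 0)" if "\<xi> \<in> verts D" for \<xi> \<eta>
  proof -
    have "e \<in> arcs D \<and> tail D e = \<xi> \<and> head D e = \<eta> \<longleftrightarrow> e = f \<xi> \<and> \<eta> = p \<xi>" for e
    proof
      assume e: "e \<in> arcs D \<and> tail D e = \<xi> \<and> head D e = \<eta>"
      then have "e = f \<xi>" by (blast intro: f_unique)
      then show "e = f \<xi> \<and> \<eta> = p \<xi>" using e unfolding p_def by blast
    next
      assume "e = f \<xi> \<and> \<eta> = p \<xi>"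
      then show "e \<in> arcs D \<and> tail D e = \<xi> \<and> head D e = \<eta>"
        using f(1)[OF that] f(2)[OF that] unfolding p_def by blast
    qed
    then have "{e \<in> arcs D. tail D e = \<xi> \<and> head D e = \<eta>} = (if \<eta> = p \<xi> then {f \<xi>} else {})"
      by simp
    then show ?thesis by (simp add: adjacency_def)
  qed
  ultimately have "permutation_matrix (verts D) (adjacency D)"
    unfolding permutation_matrix_def by (intro exI[of _ p]) simp
  with not_permutation show False ..
qed

text \<open>Until a branching vertex is met, a path is forced by its first vertex. So every path
  from \<open>v\<close> branches at the latest where one chosen path \<open>z0\<close> does, and
  there are finitely many first vertices.\<close>

lemma branching_bound:
  obtains N where "\<And>z. z \<in> sft D \<Longrightarrow> \<exists>j<N. branching D (tail D (z j))"
proof -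
  have "\<exists>n. \<forall>z\<in>follower_set D v. \<exists>j<n. branching D (tail D (z j))" if v: "v \<in> verts D" for v
  proof -
    obtain z0 where z0: "z0 \<in> follower_set D v" using follower_set_nonempty[OF v] by blast
    then obtain j0 where j0: "branching D (tail D (z0 j0))"
      using exists_branching unfolding follower_set_def by blast
    have "\<exists>j<Suc j0. branching D (tail D (z j))" if z: "z \<in> follower_set D v" for z
    proof (rule ccontr)
      assume nb: "\<not> (\<exists>j<Suc j0. branching D (tail D (z j)))"
      have "tail D (z j) = tail D (z0 j)" if "j \<le> j0" for j
        using that
      proof (induction j)
        case 0
        then show ?case using z z0 by (simp add: follower_set_def)
      next
        case (Suc j)
        have zz: "z \<in> sft D" "z0 \<in> sft D" using z z0 by (simp_all add: follower_set_def)
        have "\<not> branching D (tail D (z j))" using nb Suc.prems by auto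
        then have "z j = z0 j"
          using Suc zz by (intro not_branchingD[of D "tail D (z j)"] sft_arc) auto
        then show ?case using zz sft_step by metis
      qed
      from this[of j0] j0 nb show False by auto
    qed
    then show ?thesis by blast
  qed
  then obtain n where n: "\<And>v z. v \<in> verts D \<Longrightarrow> z \<in> follower_set D v \<Longrightarrow> \<exists>j<n v. branching D (tail D (z j))"
    by metis
  \<comment> \<open>The sum over all vertices serves as a crude maximum.\<close>
  have "\<exists>j<(\<Sum>v\<in>verts D. n v). branching D (tail D (z j))" if z: "z \<in> sft D" for z
  proof -
    have v: "tail D (z 0) \<in> verts D" by (rule tail_sft_verts[OF z])
    moreover have "z \<in> follower_set D (tail D (z 0))" using z by (simp add: follower_set_def)
    ultimately obtain j where "j < n (tail D (z 0))" "branching D (tail D (z j))" using n by blast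
    moreover have "n (tail D (z 0)) \<le> (\<Sum>v\<in>verts D. n v)"
      by (rule member_le_sum[OF v]) simp_all
    ultimately show ?thesis by (meson order_less_le_trans)
  qed
  with that show thesis by blast
qed

text \<open>Another arc \<open>e\<close> is taken at position \<open>k\<close>, followed by any path
  from its head.\<close>

lemma branching_extension:
  assumes x: "x \<in> sft D" and k: "0 < k" and b: "branching D (tail D (x k))"
  shows "\<exists>x'\<in>cylinder D (prefix k x). x' k \<noteq> x k"
proof -
  from b obtain e where e: "e \<in> arcs D" "tail D e = tail D (x k)" "e \<noteq> x k"
    unfolding branching_def by metis
  obtain z where z: "z \<in> follower_set D (head D e)"
    using follower_set_nonempty[OF head_in_verts[OF e(1)]] by blast
  have ez: "[e] \<frown> z \<in> sft D"
    unfolding sft_def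
  proof (intro CollectI allI)
    fix i show "([e] \<frown> z) i \<in> arcs D \<and> head D (([e] \<frown> z) i) = tail D (([e] \<frown> z) (Suc i))"
      using e(1) z by (cases i) (auto simp: follower_set_def sft_def conc_def)
  qed
  have "word_end D (prefix k x) = tail D (x k)"
    using k sft_step[OF x, of "k - 1"] by (cases k) (simp_all add: word_end_def)
  then have "[e] \<frown> z \<in> follower_set D (word_end D (prefix k x))"
    using ez e(2) by (simp add: follower_set_def)
  moreover have "prefix k x \<noteq> []" "prefix k x \<frown> suffix k x \<in> sft D" using k x by simp_all
  ultimately have "prefix k x \<frown> [e] \<frown> z \<in> sft D"
    using conc_mem_sft_iff by blast
  then have "prefix k x \<frown> [e] \<frown> z \<in> cylinder D (prefix k x)"
    by (simp only: conc_mem_cylinder_iff)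
  moreover have "(prefix k x \<frown> [e] \<frown> z) k = e"
    by (simp add: conc_def)
  ultimately show ?thesis using e(3) by metis
qed

text \<open>This measures how far a cylinder is from determining its word. A branching vertex met
  within \<open>t\<close> would let a point of the cylinder of \<open>w\<close> deviate from
  \<open>w @ t\<close>, so \<open>t\<close> ends before the first branching that is guaranteed after
  \<open>w\<close>.\<close>

lemma forced_extension_bound:
  obtains N where "\<And>w t. w \<noteq> [] \<Longrightarrow> cylinder D w \<noteq> {} \<Longrightarrow> cylinder D (w @ t) = cylinder D w \<Longrightarrow> length t \<le> N"
proof -
  obtain N where N: "\<And>z. z \<in> sft D \<Longrightarrow> \<exists>j<N. branching D (tail D (z j))"
    by (rule branching_bound) (rule that; blast)
  have "length t \<le> N"
    if w: "w \<noteq> []" and ne: "cylinder D w \<noteq> {}" and eq: "cylinder D (w @ t) = cylinder D w" for w t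
  proof -
    from ne eq obtain x where x: "x \<in> cylinder D (w @ t)" by blast
    have xs: "x \<in> sft D" using x cylinder_subset_sft by blast
    obtain j where j: "j < N" "branching D (tail D (suffix (length w) x j))"
      using N[OF suffix_mem_sft[OF xs]] by blast
    then obtain x' where x': "x' \<in> cylinder D (prefix (length w + j) x)" "x' (length w + j) \<noteq> x (length w + j)"
      using branching_extension[OF xs, of "length w + j"] w by auto
    have "x' \<in> cylinder D w"
      using x' x by (auto simp: cylinder_def nth_append)
    then have "x' \<in> cylinder D (w @ t)" using eq by simp
    then have "\<not> length w + j < length (w @ t)" using x'(2) x unfolding cylinder_def by auto
    then show ?thesis using j(1) by simp
  qed
  with that show thesis by blast
qed

lemma cylinder_chain:
  obtains L where "L \<ge> 1" "\<And>x k. x \<in> sft D \<Longrightarrow> k \<ge> L \<Longrightarrow> card ((\<lambda>j. cylinder D (prefix j x)) ` {1..k}) > r"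
proof -
  obtain N where N: "\<And>w t. w \<noteq> [] \<Longrightarrow> cylinder D w \<noteq> {} \<Longrightarrow> cylinder D (w @ t) = cylinder D w \<Longrightarrow> length t \<le> N"
    by (rule forced_extension_bound) (rule that; blast)
  \<comment> \<open>The spacing \<open>Suc N\<close> exceeds every extension that leaves a cylinder
    unchanged, so the cylinders at the lengths \<open>p i\<close> are distinct; the offset 1 keeps
    the prefixes non-empty. The indices up to \<open>r\<close> give \<open>r + 1\<close>
    cylinders.\<close>
  define p where "p = (\<lambda>i. 1 + i * Suc N)"
  have "card ((\<lambda>j. cylinder D (prefix j x)) ` {1..k}) > r" if x: "x \<in> sft D" and k: "k \<ge> p r" for x k
  proof -
    have neq: "cylinder D (prefix (p i) x) \<noteq> cylinder D (prefix (p i') x)" if "i < i'" for i i'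
    proof
      assume eq: "cylinder D (prefix (p i) x) = cylinder D (prefix (p i') x)"
      define t where "t = subsequence x (p i) (p i')"
      have "p i' = p i + (i' - i) * Suc N"
        using that unfolding p_def by (metis add.assoc add_mult_distrib le_add_diff_inverse less_imp_le)
      then have pp: "p i \<le> p i'" and len: "length t = (i' - i) * Suc N" by (simp_all add: t_def)
      have t: "prefix (p i') x = prefix (p i) x @ t"
        using subsequence_append[of x "p i" "p i' - p i"] pp by (simp add: t_def)
      have "length t \<le> N"
      proof (rule N)
        show "prefix (p i) x \<noteq> []" by (simp add: p_def)
        show "cylinder D (prefix (p i) x) \<noteq> {}" using prefix_mem_cylinder[OF x] by blast
        show "cylinder D (prefix (p i) x @ t) = cylinder D (prefix (p i) x)" using eq unfolding t by simp
      qed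
      moreover have "1 * Suc N \<le> (i' - i) * Suc N" using that by (intro mult_le_mono1) simp
      ultimately show False using len by simp
    qed
    have "inj_on (\<lambda>i. cylinder D (prefix (p i) x)) {..r}"
      by (rule linorder_inj_onI) (use neq in auto)
    then have "card ((\<lambda>i. cylinder D (prefix (p i) x)) ` {..r}) = Suc r"
      by (simp add: card_image)
    moreover have "(\<lambda>i. cylinder D (prefix (p i) x)) ` {..r} \<subseteq> (\<lambda>j. cylinder D (prefix j x)) ` {1..k}"
    proof -
      have "p i \<in> {1..k}" if "i \<le> r" for i
      proof -
        have "p i \<le> p r" unfolding p_def using that by (intro add_left_mono mult_le_mono1)
        then show ?thesis using k by (auto simp: p_def)
      qed
      then show ?thesis by blast
    qed
    ultimately show ?thesis
      using card_mono[OF finite_imageI[OF finite_atLeastAtMost]] by (metis Suc_le_lessD)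
  qed
  with that[of "p r"] show thesis by (auto simp: p_def)
qed

text \<open>Used against \<open>conc_fixpoint_unique\<close>: an equation with at most one solution
  cannot hold for all tails of a word.\<close>

lemma two_followers:
  assumes "w \<noteq> []" "w \<frown> z \<in> sft D"
  obtains z' where "w \<frown> z' \<in> sft D" "z' \<noteq> z"
proof -
  obtain j where j: "branching D (tail D (z j))"
    using exists_branching[OF conc_mem_sftD[OF assms(2)]] by blast
  from branching_extension[OF assms(2), of "length w + j"] j assms(1)
  obtain x' where x': "x' \<in> cylinder D (prefix (length w + j) (w \<frown> z))" "x' (length w + j) \<noteq> z j"
    by auto
  from x'(1) have "x' \<in> cylinder D w"
    using cylinder_append_subset[of D w] by (auto simp: prefix_conc_snd)
  then obtain z' where "x' = w \<frown> z'" "w \<frown> z' \<in> sft D" by (rule mem_cylinderE)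
  with x'(2) that show thesis by auto
qed

end

section \<open>The topological full group\<close>

text \<open>By \<open>compact_open_iff\<close> these are the compact open sets of arrows when there
  are finitely many edges. In this form, closure under products and inverses is a statement about
  words.\<close>

definition word_union :: "('v, 'e) pre_digraph \<Rightarrow> 'e sft_arrow set \<Rightarrow> bool" where
  "word_union D V \<longleftrightarrow> (\<exists>F. finite F \<and> F \<subseteq> Collect (is_word D) \<times> Collect (is_word D) \<and>
     V = (\<Union>(u, w)\<in>F. U_word D u w))"

lemma word_unionE:
  assumes "word_union D V"
  obtains F where "finite F" "F \<subseteq> Collect (is_word D) \<times> Collect (is_word D)"
    "V = (\<Union>(u, w)\<in>F. U_word D u w)"
  using assms unfolding word_union_def by blast

lemma word_union_empty: "word_union D {}"
  unfolding word_union_def by (rule exI[of _ "{}"]) simp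

lemma word_union_U_word: "is_word D u \<Longrightarrow> is_word D w \<Longrightarrow> word_union D (U_word D u w)"
  unfolding word_union_def by (rule exI[of _ "{(u, w)}"]) simp

lemma word_union_UN:
  assumes "finite I" "\<And>i. i \<in> I \<Longrightarrow> word_union D (A i)"
  shows "word_union D (\<Union>i\<in>I. A i)"
proof -
  obtain F where F: "\<And>i. i \<in> I \<Longrightarrow> finite (F i) \<and> F i \<subseteq> Collect (is_word D) \<times> Collect (is_word D) \<and>
    A i = (\<Union>(u, w)\<in>F i. U_word D u w)"
    using assms(2) unfolding word_union_def by metis
  show ?thesis
    unfolding word_union_def
  proof (intro exI[of _ "\<Union>i\<in>I. F i"] conjI)
    show "finite (\<Union>i\<in>I. F i)" using assms(1) F by blast
    show "(\<Union>i\<in>I. F i) \<subseteq> Collect (is_word D) \<times> Collect (is_word D)" using F by blast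
    have "(\<Union>i\<in>I. A i) = (\<Union>i\<in>I. \<Union>(u, w)\<in>F i. U_word D u w)" using F by simp
    then show "(\<Union>i\<in>I. A i) = (\<Union>(u, w)\<in>(\<Union>i\<in>I. F i). U_word D u w)" by blast
  qed
qed

lemma word_union_mult:
  assumes "word_union D U" "word_union D V"
  shows "word_union D (gset_mult (sft_groupoid D) U V)"
proof -
  obtain E where E: "finite E" "E \<subseteq> Collect (is_word D) \<times> Collect (is_word D)"
    "U = (\<Union>(u, w)\<in>E. U_word D u w)"
    using assms(1) by (rule word_unionE)
  obtain F where F: "finite F" "F \<subseteq> Collect (is_word D) \<times> Collect (is_word D)"
    "V = (\<Union>(u, w)\<in>F. U_word D u w)"
    using assms(2) by (rule word_unionE)
  have "word_union D (gset_mult (sft_groupoid D) (U_word D a b) (U_word D c d))"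
    if "(a, b) \<in> E" "(c, d) \<in> F" for a b c d
  proof -
    have "is_word D a" "is_word D b" "is_word D c" "is_word D d" using E(2) F(2) that by blast+
    from U_word_mult_cases[OF this] show ?thesis
      using word_union_empty word_union_U_word by metis
  qed
  then have "word_union D (\<Union>(p, q)\<in>E \<times> F. gset_mult (sft_groupoid D) (case_prod (U_word D) p) (case_prod (U_word D) q))"
    using E(1) F(1) by (intro word_union_UN) auto
  then show ?thesis unfolding E(3) F(3) gset_mult_UN .
qed

lemma word_union_subset_arrows: "word_union D V \<Longrightarrow> V \<subseteq> sft_arrows D"
  using U_word_subset_arrows unfolding word_union_def by fast

lemma word_union_local:
  assumes "word_union D V" "g \<in> V"
  obtains u w where "is_word D u" "is_word D w" "g \<in> U_word D u w" "U_word D u w \<subseteq> V"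
  using assms unfolding word_union_def by blast

text \<open>Upgrades an inclusion to an equality: where the source map is injective, a subset with
  all the sources is everything.\<close>

lemma arrow_set_eqI:
  assumes "A \<subseteq> B" "inj_on arrow_source B" "arrow_source ` B \<subseteq> arrow_source ` A"
  shows "A = B"
  using assms unfolding inj_on_def by blast

section \<open>Sources, ranges and injectivity of products\<close>

lemma sft_arrows_endpoints:
  assumes "(x, n, y) \<in> sft_arrows D"
  shows "x \<in> sft D" "y \<in> sft D"
  using assms by (auto simp: sft_arrows_def)

lemma gset_mult_diag_right:
  assumes "arrow_source ` V \<subseteq> A"
  shows "gset_mult (sft_groupoid D) V (sft_unit ` A) = V"
proof (intro subset_antisym arrow_subsetI)
  fix x n y assume "(x, n, y) \<in> V"
  moreover from this have "y \<in> A" using assms by force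
  ultimately show "(x, n, y) \<in> gset_mult (sft_groupoid D) V (sft_unit ` A)"
    by (auto simp: sft_unit_def intro!: gset_multI)
qed (auto simp: sft_unit_def elim!: gset_multE)

lemma gset_mult_diag_left:
  assumes "arrow_range ` V \<subseteq> A"
  shows "gset_mult (sft_groupoid D) (sft_unit ` A) V = V"
proof (intro subset_antisym arrow_subsetI)
  fix x n y assume "(x, n, y) \<in> V"
  moreover from this have "x \<in> A" using assms by force
  ultimately show "(x, n, y) \<in> gset_mult (sft_groupoid D) (sft_unit ` A) V"
    by (auto simp: sft_unit_def intro!: gset_multI)
qed (auto simp: sft_unit_def elim!: gset_multE)

lemma source_gset_mult_subset: "arrow_source ` gset_mult (sft_groupoid D) U V \<subseteq> arrow_source ` V"
  unfolding gset_mult_sft_groupoid by force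

lemma source_gset_mult:
  assumes "arrow_range ` V \<subseteq> arrow_source ` U"
  shows "arrow_source ` gset_mult (sft_groupoid D) U V = arrow_source ` V"
proof (intro subset_antisym source_gset_mult_subset subsetI)
  fix z assume "z \<in> arrow_source ` V"
  then obtain y m where V: "(y, m, z) \<in> V" by auto
  then have "y \<in> arrow_source ` U" using assms by force
  then obtain x n where "(x, n, y) \<in> U" by auto
  with V have "(x, n + m, z) \<in> gset_mult (sft_groupoid D) U V" by (auto intro: gset_multI)
  then show "z \<in> arrow_source ` gset_mult (sft_groupoid D) U V" by force
qed

lemma range_gset_mult:
  assumes "arrow_source ` U \<subseteq> arrow_range ` V"
  shows "arrow_range ` gset_mult (sft_groupoid D) U V = arrow_range ` U"
proof (intro subset_antisym subsetI)
  fix x assume "x \<in> arrow_range ` U"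
  then obtain n y where U: "(x, n, y) \<in> U" by auto
  then have "y \<in> arrow_range ` V" using assms by force
  then obtain m z where "(y, m, z) \<in> V" by auto
  with U have "(x, n + m, z) \<in> gset_mult (sft_groupoid D) U V" by (auto intro: gset_multI)
  then show "x \<in> arrow_range ` gset_mult (sft_groupoid D) U V" by force
qed (force simp: gset_mult_sft_groupoid)

lemma inj_on_source_gset_mult:
  assumes "inj_on arrow_source U" "inj_on arrow_source V"
  shows "inj_on arrow_source (gset_mult (sft_groupoid D) U V)"
proof (rule inj_onI)
  fix g h assume gh: "g \<in> gset_mult (sft_groupoid D) U V" "h \<in> gset_mult (sft_groupoid D) U V"
    "arrow_source g = arrow_source h"
  obtain x k z x' k' z' where g: "g = (x, k, z)" and h: "h = (x', k', z')" by (metis prod_cases3)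
  from gh obtain n y m n' y' m' where
    "(x, n, y) \<in> U" "(y, m, z) \<in> V" "k = n + m" "(x', n', y') \<in> U" "(y', m', z) \<in> V" "k' = n' + m'" "z = z'"
    unfolding g h by (auto elim!: gset_multE)
  then show "g = h"
    using inj_on_arrow_sourceD[OF assms(1)] inj_on_arrow_sourceD[OF assms(2)] unfolding g h by metis
qed

lemma inj_on_range_gset_mult:
  assumes "inj_on arrow_range U" "inj_on arrow_range V"
  shows "inj_on arrow_range (gset_mult (sft_groupoid D) U V)"
proof (rule inj_onI)
  fix g h assume gh: "g \<in> gset_mult (sft_groupoid D) U V" "h \<in> gset_mult (sft_groupoid D) U V"
    "arrow_range g = arrow_range h"
  obtain x k z x' k' z' where g: "g = (x, k, z)" and h: "h = (x', k', z')" by (metis prod_cases3)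
  from gh obtain n y m n' y' m' where
    "(x, n, y) \<in> U" "(y, m, z) \<in> V" "k = n + m" "(x, n', y') \<in> U" "(y', m', z') \<in> V" "k' = n' + m'" "x = x'"
    unfolding g h by (auto elim!: gset_multE)
  then show "g = h"
    using inj_on_arrow_rangeD[OF assms(1)] inj_on_arrow_rangeD[OF assms(2)] unfolding g h by metis
qed

lemma arrow_source_ginv: "arrow_source (ginv (sft_groupoid D) g) = arrow_range g"
  and arrow_range_ginv: "arrow_range (ginv (sft_groupoid D) g) = arrow_source g"
  by (cases g; simp add: ginv_sft_groupoid)+

lemma ginv_image_mem_iff: "(x, n, y) \<in> ginv (sft_groupoid D) ` V \<longleftrightarrow> (y, - n, x) \<in> V"
  by (force simp: ginv_sft_groupoid image_iff)

lemma word_union_ginv: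
  assumes "word_union D V"
  shows "word_union D (ginv (sft_groupoid D) ` V)"
proof -
  obtain F where F: "finite F" "F \<subseteq> Collect (is_word D) \<times> Collect (is_word D)"
    "V = (\<Union>(u, w)\<in>F. U_word D u w)"
    using assms by (rule word_unionE)
  have "ginv (sft_groupoid D) ` V = (\<Union>(u, w)\<in>F. ginv (sft_groupoid D) ` U_word D u w)"
    unfolding F(3) by blast
  also have "\<dots> = (\<Union>(u, w)\<in>F. U_word D w u)" by (simp only: U_word_inverse)
  finally show ?thesis
    using F(1,2) by (auto intro!: word_union_UN word_union_U_word)
qed

section \<open>Sets of arrows representing elements of the full group\<close>

context irreducible_sft
begin

lemma word_union_units: "word_union D (gunits (sft_groupoid D))"
proof -
  \<comment> \<open>Each point lies in the cylinder of its first letter, so the one-letter words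
    cover all units.\<close>
  have "gunits (sft_groupoid D) = (\<Union>e\<in>arcs D. U_word D [e] [e])"
  proof -
    have "x \<in> cylinder D [x 0]" if "x \<in> sft D" for x
      using that by (simp add: cylinder_def)
    moreover have "x 0 \<in> arcs D" if "x \<in> sft D" for x using that by (rule sft_arc)
    ultimately show ?thesis
      unfolding gunits_sft_groupoid U_word_diag sft_unit_def using cylinder_subset_sft[of D] by blast
  qed
  then show ?thesis
    by (auto simp: is_word_def intro!: word_union_UN word_union_U_word)
qed

lemma compact_open_G_set_iff: "compact_open_G_set (sft_groupoid D) V \<longleftrightarrow>
    inj_on arrow_range V \<and> inj_on arrow_source V \<and> word_union D V"
  unfolding compact_open_G_set_def G_set_sft_groupoid_iff compact_open_iff[OF finite_arcs]
    word_union_def[symmetric]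
  using word_union_subset_arrows by blast

lemma representsD:
  assumes "represents (sft_groupoid D) W \<alpha>"
  shows "inj_on arrow_range W" "inj_on arrow_source W" "word_union D W" "W \<subseteq> sft_arrows D"
    "arrow_source ` W = sft D" "arrow_range ` W = sft D" "\<alpha> = gset_map (sft_groupoid D) W"
  using assms word_union_subset_arrows
  unfolding represents_def compact_open_G_set_iff gunits_sft_groupoid gsource_image grange_image
  by auto

lemma gset_map_apply:
  assumes "inj_on arrow_source W" "(x, n, y) \<in> W"
  shows "gset_map (sft_groupoid D) W (sft_unit y) = sft_unit x"
proof -
  have "inj_on (gsource (sft_groupoid D)) W"
    using assms(1) inj_sft_unit by (auto simp: inj_on_def gsource_eq)
  moreover have "gsource (sft_groupoid D) (x, n, y) = sft_unit y" by (simp add: gsource_eq)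
  ultimately have "inv_into W (gsource (sft_groupoid D)) (sft_unit y) = (x, n, y)"
    using inv_into_f_eq assms(2) by metis
  moreover have "sft_unit y \<in> gsource (sft_groupoid D) ` W"
    using assms(2) unfolding gsource_image by force
  ultimately show ?thesis by (simp add: gset_map_def grange_eq)
qed

lemma represents_apply:
  assumes "represents (sft_groupoid D) W \<alpha>" "(x, n, y) \<in> W"
  shows "\<alpha> (sft_unit y) = sft_unit x"
  using gset_map_apply[OF representsD(2)[OF assms(1)] assms(2)] representsD(7)[OF assms(1)] by simp

lemma representsI:
  assumes "inj_on arrow_range W" "inj_on arrow_source W" "word_union D W"
    "arrow_source ` W = sft D" "arrow_range ` W = sft D"
    and \<alpha>: "\<alpha> \<in> extensional (gunits (sft_groupoid D))"
    and eq: "\<And>x n y. (x, n, y) \<in> W \<Longrightarrow> \<alpha> (sft_unit y) = sft_unit x"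
  shows "represents (sft_groupoid D) W \<alpha>"
proof -
  have src: "gsource (sft_groupoid D) ` W = gunits (sft_groupoid D)"
    unfolding gsource_image gunits_sft_groupoid assms(4) ..
  have "\<alpha> = gset_map (sft_groupoid D) W"
  proof (rule extensionalityI[OF \<alpha>])
    show "gset_map (sft_groupoid D) W \<in> extensional (gunits (sft_groupoid D))"
      by (simp add: gset_map_def src)
    fix p assume "p \<in> gunits (sft_groupoid D)"
    then obtain y where y: "y \<in> sft D" "p = sft_unit y" unfolding gunits_sft_groupoid by blast
    then obtain x n where "(x, n, y) \<in> W" using assms(4) by fastforce
    then show "\<alpha> p = gset_map (sft_groupoid D) W p"
      using gset_map_apply[OF assms(2)] eq y(2) by metis
  qed
  then show ?thesis
    unfolding represents_def compact_open_G_set_iff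
    using assms src by (simp add: grange_image gunits_sft_groupoid)
qed

lemma represents_mult:
  assumes W: "represents (sft_groupoid D) W \<alpha>" and W': "represents (sft_groupoid D) W' \<beta>"
  shows "represents (sft_groupoid D) (gset_mult (sft_groupoid D) W W')
    (compose (gunits (sft_groupoid D)) \<alpha> \<beta>)"
proof (rule representsI)
  note D = representsD[OF W] and D' = representsD[OF W']
  show "inj_on arrow_range (gset_mult (sft_groupoid D) W W')"
    by (rule inj_on_range_gset_mult[OF D(1) D'(1)])
  show "inj_on arrow_source (gset_mult (sft_groupoid D) W W')"
    by (rule inj_on_source_gset_mult[OF D(2) D'(2)])
  show "word_union D (gset_mult (sft_groupoid D) W W')"
    by (rule word_union_mult[OF D(3) D'(3)])
  show "arrow_source ` gset_mult (sft_groupoid D) W W' = sft D"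
    using source_gset_mult[of W' W] D(5) D'(5,6) by simp
  show "arrow_range ` gset_mult (sft_groupoid D) W W' = sft D"
    using range_gset_mult[of W W'] D(5,6) D'(6) by simp
  fix x n z assume "(x, n, z) \<in> gset_mult (sft_groupoid D) W W'"
  then obtain k y m where "(x, k, y) \<in> W" "(y, m, z) \<in> W'" by (rule gset_multE)
  moreover have "sft_unit z \<in> gunits (sft_groupoid D)"
    using calculation(2) D'(5) unfolding gunits_sft_groupoid by force
  ultimately show "compose (gunits (sft_groupoid D)) \<alpha> \<beta> (sft_unit z) = sft_unit x"
    using represents_apply[OF W] represents_apply[OF W'] by (simp add: compose_def)
qed simp

lemma represents_one: "represents (sft_groupoid D) (gunits (sft_groupoid D)) (\<lambda>p\<in>gunits (sft_groupoid D). p)"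
proof (rule representsI)
  show "inj_on arrow_range (gunits (sft_groupoid D))" "inj_on arrow_source (gunits (sft_groupoid D))"
    by (auto simp: gunits_sft_groupoid sft_unit_def inj_on_def)
  show "arrow_source ` gunits (sft_groupoid D) = sft D" "arrow_range ` gunits (sft_groupoid D) = sft D"
    by (simp_all add: gunits_sft_groupoid image_image sft_unit_def)
  show "word_union D (gunits (sft_groupoid D))" by (rule word_union_units)
qed (auto simp: gunits_sft_groupoid sft_unit_def)

text \<open>The restricted \<open>inv_into\<close> is the form in which \<open>BijGroup\<close>
  gives its inverses; on arrows it is reversal.\<close>

lemma represents_inverse:
  assumes W: "represents (sft_groupoid D) W \<alpha>"
  shows "represents (sft_groupoid D) (ginv (sft_groupoid D) ` W)
    (\<lambda>p\<in>gunits (sft_groupoid D). inv_into (gunits (sft_groupoid D)) \<alpha> p)"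
proof (rule representsI)
  note D = representsD[OF W]
  show "inj_on arrow_range (ginv (sft_groupoid D) ` W)" "inj_on arrow_source (ginv (sft_groupoid D) ` W)"
    using D(1,2) by (auto intro!: inj_on_imageI simp: comp_def arrow_source_ginv arrow_range_ginv)
  show "arrow_source ` ginv (sft_groupoid D) ` W = sft D" "arrow_range ` ginv (sft_groupoid D) ` W = sft D"
    using D(5,6) by (simp_all add: image_image arrow_source_ginv arrow_range_ginv)
  show "word_union D (ginv (sft_groupoid D) ` W)" by (rule word_union_ginv[OF D(3)])
  fix y n x assume "(y, n, x) \<in> ginv (sft_groupoid D) ` W"
  then have xy: "(x, - n, y) \<in> W" by (simp add: ginv_image_mem_iff)
  then have units: "sft_unit x \<in> gunits (sft_groupoid D)" "sft_unit y \<in> gunits (sft_groupoid D)"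
    using D(5,6) unfolding gunits_sft_groupoid by force+
  have "inj_on \<alpha> (gunits (sft_groupoid D))"
  proof (rule inj_onI)
    fix p q assume "p \<in> gunits (sft_groupoid D)" "q \<in> gunits (sft_groupoid D)" and eq: "\<alpha> p = \<alpha> q"
    then obtain y z where pq: "y \<in> sft D" "z \<in> sft D" "p = sft_unit y" "q = sft_unit z"
      unfolding gunits_sft_groupoid by blast
    then obtain x n x' n' where "(x, n, y) \<in> W" "(x', n', z) \<in> W" using D(5) by fastforce
    moreover from this have "sft_unit x = sft_unit x'"
      using represents_apply[OF W] eq pq by metis
    ultimately have "y = z"
      using inj_on_arrow_rangeD[OF D(1)] inj_sft_unit by (metis injD)
    then show "p = q" using pq by simp
  qed
  then have "inv_into (gunits (sft_groupoid D)) \<alpha> (sft_unit x) = sft_unit y"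
    using represents_apply[OF W xy] units(2) by (metis inv_into_f_eq)
  then show "(\<lambda>p\<in>gunits (sft_groupoid D). inv_into (gunits (sft_groupoid D)) \<alpha> p) (sft_unit x) = sft_unit y"
    using units(1) by simp
qed simp

text \<open>
  Two arrows with the same range and source but different integer components would extend to whole
  cylinders; the sequences that can follow some word would then solve an equation with at most one
  solution, which branching excludes.
\<close>

lemma represents_subset:
  assumes W: "represents (sft_groupoid D) W \<alpha>" and W': "represents (sft_groupoid D) W' \<alpha>"
  shows "W \<subseteq> W'"
proof (rule arrow_subsetI)
  fix x n y assume xy: "(x, n, y) \<in> W"
  note D = representsD[OF W] and D' = representsD[OF W']
  have "y \<in> arrow_source ` W'" using xy D(5) D'(5) by force
  then obtain x' n' where xy': "(x', n', y) \<in> W'" by auto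
  have "x' = x"
    using represents_apply[OF W xy] represents_apply[OF W' xy'] inj_sft_unit by (metis injD)
  obtain a b where ab: "is_word D a" "is_word D b" "(x, n, y) \<in> U_word D a b" "U_word D a b \<subseteq> W"
    using word_union_local[OF D(3) xy] by blast
  obtain a' b' where ab': "is_word D a'" "is_word D b'" "(x', n', y) \<in> U_word D a' b'" "U_word D a' b' \<subseteq> W'"
    using word_union_local[OF D'(3) xy'] by blast
  have ne: "a \<noteq> []" "b \<noteq> []" "a' \<noteq> []" "b' \<noteq> []" using ab ab' by (simp_all add: is_word_def)
  have n: "n = int (length a) - int (length b)" "n' = int (length a') - int (length b')"
    using ab(3) ab'(3) by (auto simp: U_word_def)
  have "y \<in> cylinder D b" "y \<in> cylinder D b'" using ab(3) ab'(3) by (auto simp: U_word_def)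
  \<comment> \<open>The two source words are extended to a common prefix of \<open>y\<close>, so
    that both arrows can be continued by the same tails.\<close>
  then have "\<exists>t t'. b @ t = b' @ t'"
    using cylinder_comparable by (metis append_Nil2)
  moreover have "y \<in> cylinder D (b @ t)" if "b @ t = b' @ t'" "t = [] \<or> t' = []" for t t'
    using that \<open>y \<in> cylinder D b\<close> \<open>y \<in> cylinder D b'\<close> by auto
  ultimately obtain t t' where t: "b @ t = b' @ t'" "y \<in> cylinder D (b @ t)"
    using cylinder_comparable[OF \<open>y \<in> cylinder D b\<close> \<open>y \<in> cylinder D b'\<close>] by (metis append_Nil2)
  from t(2) obtain z where z: "y = (b @ t) \<frown> z" "(b @ t) \<frown> z \<in> sft D" by (rule mem_cylinderE)
  \<comment> \<open>Both \<open>W\<close> and \<open>W'\<close> compute \<alpha> at the same source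
    point, so the two range points agree for every admissible tail.\<close>
  have same: "(a @ t) \<frown> z' = (a' @ t') \<frown> z'" if z': "(b @ t) \<frown> z' \<in> sft D" for z'
  proof -
    have "b \<frown> t \<frown> z' \<in> sft D" using z' by simp
    then have "a \<frown> t \<frown> z' \<in> sft D"
      using U_word_ends(2)[OF ne(1,2), of D "t \<frown> z'"] ab(3) by blast
    then have 1: "(a \<frown> t \<frown> z', n, b \<frown> t \<frown> z') \<in> W"
      using ab(4) n(1) U_word_mem_iff[of a "t \<frown> z'" n b D] \<open>b \<frown> t \<frown> z' \<in> sft D\<close> by blast
    have "b' \<frown> t' \<frown> z' \<in> sft D" using z' t(1) by simp
    then have "a' \<frown> t' \<frown> z' \<in> sft D"
      using U_word_ends(2)[OF ne(3,4), of D "t' \<frown> z'"] ab'(3) by blast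
    then have 2: "(a' \<frown> t' \<frown> z', n', b' \<frown> t' \<frown> z') \<in> W'"
      using ab'(4) n(2) U_word_mem_iff[of a' "t' \<frown> z'" n' b' D] \<open>b' \<frown> t' \<frown> z' \<in> sft D\<close> by blast
    have "b \<frown> t \<frown> z' = b' \<frown> t' \<frown> z'" using t(1) by simp
    then have "sft_unit (a \<frown> t \<frown> z') = sft_unit (a' \<frown> t' \<frown> z')"
      using represents_apply[OF W 1] represents_apply[OF W' 2] by metis
    then have "a \<frown> t \<frown> z' = a' \<frown> t' \<frown> z'" by (rule injD[OF inj_sft_unit])
    then show ?thesis by simp
  qed
  obtain z' where z': "(b @ t) \<frown> z' \<in> sft D" "z' \<noteq> z"
    using two_followers[OF _ z(2)] ne(2) by auto
  \<comment> \<open>With unequal lengths the equation \<open>same\<close> would have a single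
    solution, against the two tails \<open>z\<close> and \<open>z'\<close>. Equal lengths on the
    range side and on the source side give equal integer components.\<close>
  have "length (a @ t) = length (a' @ t')"
    using conc_fixpoint_unique[OF same[OF z(2)] same[OF z'(1)]] z'(2) by blast
  then have "n = n'" using n arg_cong[OF t(1), of length] by simp
  with \<open>x' = x\<close> xy' show "(x, n, y) \<in> W'" by simp
qed

lemma represents_unique:
  "represents (sft_groupoid D) W \<alpha> \<Longrightarrow> represents (sft_groupoid D) W' \<alpha> \<Longrightarrow> W = W'"
  using represents_subset by blast

section \<open>The full group as a subgroup of the bijections of the unit space\<close>

lemma topspace_units: "topspace (subtopology (gtop (sft_groupoid D)) (gunits (sft_groupoid D))) = gunits (sft_groupoid D)"
proof -
  have "gunits (sft_groupoid D) \<subseteq> topspace (gtop (sft_groupoid D))"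
    using representsD(4)[OF represents_one] unfolding topspace_sft_groupoid .
  then show ?thesis by auto
qed

lemma mem_full_group_iff: "\<alpha> \<in> carrier (full_group (sft_groupoid D)) \<longleftrightarrow>
    \<alpha> \<in> extensional (gunits (sft_groupoid D)) \<and>
    homeomorphic_map (subtopology (gtop (sft_groupoid D)) (gunits (sft_groupoid D)))
      (subtopology (gtop (sft_groupoid D)) (gunits (sft_groupoid D))) \<alpha> \<and>
    (\<exists>W. represents (sft_groupoid D) W \<alpha>)"
  by (simp add: full_group_def)

lemma full_group_subset_Bij:
  assumes "\<alpha> \<in> carrier (full_group (sft_groupoid D))"
  shows "\<alpha> \<in> Bij (gunits (sft_groupoid D))"
proof -
  have "homeomorphic_map (subtopology (gtop (sft_groupoid D)) (gunits (sft_groupoid D)))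
      (subtopology (gtop (sft_groupoid D)) (gunits (sft_groupoid D))) \<alpha>"
    using assms unfolding mem_full_group_iff by blast
  from homeomorphic_imp_injective_map[OF this] homeomorphic_imp_surjective_map[OF this]
  have "bij_betw \<alpha> (gunits (sft_groupoid D)) (gunits (sft_groupoid D))"
    unfolding topspace_units bij_betw_def by blast
  then show ?thesis
    using assms unfolding mem_full_group_iff Bij_def by blast
qed

lemma subgroup_full_group:
  "subgroup (carrier (full_group (sft_groupoid D))) (BijGroup (gunits (sft_groupoid D)))"
proof (rule group.subgroupI[OF group_BijGroup])
  let ?S = "gunits (sft_groupoid D)" and ?T = "subtopology (gtop (sft_groupoid D)) (gunits (sft_groupoid D))"
  let ?C = "carrier (full_group (sft_groupoid D))"
  show "?C \<subseteq> carrier (BijGroup ?S)"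
    using full_group_subset_Bij by (auto simp: BijGroup_def)
  have "homeomorphic_map ?T ?T (\<lambda>p\<in>?S. p)"
    by (rule homeomorphic_map_eq[of _ _ id]) (simp_all add: topspace_units del: topspace_subtopology)
  then have "(\<lambda>p\<in>?S. p) \<in> ?C"
    unfolding mem_full_group_iff using represents_one by auto
  then show "?C \<noteq> {}" by blast
  show "\<alpha> \<otimes>\<^bsub>BijGroup ?S\<^esub> \<beta> \<in> ?C" if \<alpha>: "\<alpha> \<in> ?C" and \<beta>: "\<beta> \<in> ?C" for \<alpha> \<beta>
  proof -
    have "homeomorphic_map ?T ?T (\<alpha> \<circ> \<beta>)"
      using \<alpha> \<beta> homeomorphic_map_compose unfolding mem_full_group_iff by blast
    then have "homeomorphic_map ?T ?T (compose ?S \<alpha> \<beta>)"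
      by (rule homeomorphic_map_eq) (simp add: topspace_units compose_def)
    moreover have "\<exists>W. represents (sft_groupoid D) W (compose ?S \<alpha> \<beta>)"
      using \<alpha> \<beta> represents_mult unfolding mem_full_group_iff by blast
    ultimately have "compose ?S \<alpha> \<beta> \<in> ?C"
      unfolding mem_full_group_iff by simp
    then show ?thesis
      using full_group_subset_Bij[OF \<alpha>] full_group_subset_Bij[OF \<beta>] by (simp add: BijGroup_def)
  qed
  show "inv\<^bsub>BijGroup ?S\<^esub> \<alpha> \<in> ?C" if \<alpha>: "\<alpha> \<in> ?C" for \<alpha>
  proof -
    obtain \<beta> where \<beta>: "homeomorphic_maps ?T ?T \<alpha> \<beta>"
      using \<alpha> unfolding mem_full_group_iff homeomorphic_map_maps by blast
    then have "homeomorphic_map ?T ?T \<beta>"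
      using homeomorphic_maps_map by blast
    \<comment> \<open>The topological inverse \<beta> is arbitrary off the unit space, while the
      group inverse is extensional, so the two are compared on units only.\<close>
    moreover have "\<beta> p = (\<lambda>p\<in>?S. inv_into ?S \<alpha> p) p" if "p \<in> topspace ?T" for p
    proof -
      have p: "p \<in> ?S" using that by (simp only: topspace_units)
      have "\<alpha> (\<beta> p) = p" "\<beta> p \<in> ?S"
        using \<beta> p topspace_units unfolding homeomorphic_maps_def continuous_map_def by fastforce+
      moreover have "inj_on \<alpha> ?S"
        using full_group_subset_Bij[OF \<alpha>] by (simp add: Bij_def bij_betw_def)
      ultimately have "inv_into ?S \<alpha> p = \<beta> p" by (metis inv_into_f_eq)
      then show ?thesis using p by simp
    qed
    ultimately have "homeomorphic_map ?T ?T (\<lambda>p\<in>?S. inv_into ?S \<alpha> p)"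
      by (rule homeomorphic_map_eq)
    moreover have "\<exists>W. represents (sft_groupoid D) W (\<lambda>p\<in>?S. inv_into ?S \<alpha> p)"
      using \<alpha> represents_inverse unfolding mem_full_group_iff by blast
    ultimately have "(\<lambda>p\<in>?S. inv_into ?S \<alpha> p) \<in> ?C"
      unfolding mem_full_group_iff by simp
    then show ?thesis
      using inv_BijGroup[OF full_group_subset_Bij[OF \<alpha>]] by simp
  qed
qed

lemma group_full_group: "group (full_group (sft_groupoid D))"
proof -
  have "full_group (sft_groupoid D) =
    (BijGroup (gunits (sft_groupoid D)))\<lparr>carrier := carrier (full_group (sft_groupoid D))\<rparr>"
    by (simp add: full_group_def)
  then show ?thesis
    using subgroup.subgroup_is_group[OF subgroup_full_group group_BijGroup] by simp
qed

lemma full_group_mult: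
  assumes "\<alpha> \<in> carrier (full_group (sft_groupoid D))" "\<beta> \<in> carrier (full_group (sft_groupoid D))"
  shows "\<alpha> \<otimes>\<^bsub>full_group (sft_groupoid D)\<^esub> \<beta> = compose (gunits (sft_groupoid D)) \<alpha> \<beta>"
  using full_group_subset_Bij[OF assms(1)] full_group_subset_Bij[OF assms(2)]
  by (simp add: full_group_def BijGroup_def)

lemma full_group_one: "\<one>\<^bsub>full_group (sft_groupoid D)\<^esub> = (\<lambda>p\<in>gunits (sft_groupoid D). p)"
  by (simp add: full_group_def BijGroup_def)

lemma represents_full_group_inverse:
  assumes \<alpha>: "\<alpha> \<in> carrier (full_group (sft_groupoid D))"
    and W: "represents (sft_groupoid D) W \<alpha>"
  shows "represents (sft_groupoid D) (ginv (sft_groupoid D) ` W) (inv\<^bsub>full_group (sft_groupoid D)\<^esub> \<alpha>)"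
proof -
  have "full_group (sft_groupoid D) =
    (BijGroup (gunits (sft_groupoid D)))\<lparr>carrier := carrier (full_group (sft_groupoid D))\<rparr>"
    by (simp add: full_group_def)
  then have "inv\<^bsub>full_group (sft_groupoid D)\<^esub> \<alpha> = inv\<^bsub>BijGroup (gunits (sft_groupoid D))\<^esub> \<alpha>"
    using group.m_inv_consistent[OF group_BijGroup subgroup_full_group \<alpha>] by simp
  then show ?thesis
    using represents_inverse[OF W] inv_BijGroup[OF full_group_subset_Bij[OF \<alpha>]] by simp
qed

end

section \<open>The action on classes\<close>

context irreducible_sft
begin

lemma cylinder_G_sets_iff: "V \<in> cylinder_G_sets D \<longleftrightarrow> V \<noteq> {} \<and> inj_on arrow_range V \<and>
    inj_on arrow_source V \<and> word_union D V \<and> (\<exists>w. is_word D w \<and> arrow_source ` V = cylinder D w)"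
  unfolding cylinder_G_sets_def gsource_image compact_open_G_set_iff by auto

lemma cylinder_rel_iff: "(V, V') \<in> cylinder_rel D \<longleftrightarrow> V \<in> cylinder_G_sets D \<and> V' \<in> cylinder_G_sets D \<and>
    (\<exists>u w. is_word D u \<and> is_word D w \<and> word_end D u = word_end D w \<and>
      arrow_source ` V = cylinder D u \<and> arrow_source ` V' = cylinder D w \<and>
      V' = gset_mult (sft_groupoid D) V (U_word D u w))"
  by (simp add: cylinder_rel_def gsource_image)

lemma U_word_nonempty:
  assumes "is_word D u" "is_word D w" "word_end D u = word_end D w"
    "cylinder D u \<noteq> {}" "cylinder D w \<noteq> {}"
  shows "U_word D u w \<noteq> {}"
proof -
  obtain z where z: "u \<frown> z \<in> sft D" using assms(4) by (auto elim: mem_cylinderE)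
  obtain z' where z': "w \<frown> z' \<in> sft D" using assms(5) by (auto elim: mem_cylinderE)
  have "z \<in> follower_set D (word_end D w)"
    using conc_mem_sft_iff[OF is_word_nonempty[OF assms(1)] z, of z] z assms(3) by simp
  then have "w \<frown> z \<in> sft D"
    using conc_mem_sft_iff[OF is_word_nonempty[OF assms(2)] z'] by blast
  with z show ?thesis by (auto simp: U_word_eq)
qed

lemma U_word_self: "U_word D w w = sft_unit ` cylinder D w"
  by (auto simp: U_word_diag sft_unit_def)

lemma U_word_mult_U_word:
  assumes "is_word D u" "is_word D w" "U_word D u w \<noteq> {}"
  shows "gset_mult (sft_groupoid D) (U_word D u w) (U_word D w v) = U_word D u v"
  using U_word_mult_append_left[of u w D "[]" v] assms by (simp add: is_word_nonempty)

text \<open>Whether the letters \<open>t\<close> are forced depends only on the tails that may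
  follow, and these are the same for \<open>u\<close> and \<open>w\<close> once
  \<open>U_word D u w\<close> is non-empty.\<close>

lemma U_word_cylinder_extend:
  assumes "u \<noteq> []" "w \<noteq> []" "U_word D u w \<noteq> {}" "cylinder D (w @ t) = cylinder D w"
  shows "cylinder D (u @ t) = cylinder D u"
proof (intro subset_antisym cylinder_append_subset subsetI)
  fix x assume "x \<in> cylinder D u"
  then obtain z where z: "x = u \<frown> z" "u \<frown> z \<in> sft D" by (rule mem_cylinderE)
  then have "w \<frown> z \<in> cylinder D (w @ t)"
    using U_word_ends(2)[OF assms(1-3)] assms(4) by (simp add: conc_mem_cylinder_iff)
  then obtain z' where "w \<frown> z = (w @ t) \<frown> z'" by (rule mem_cylinderE)
  then have "z = t \<frown> z'" by (simp only: conc_eq_append_conc_iff)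
  then have "x = (u @ t) \<frown> z'" "(u @ t) \<frown> z' \<in> sft D" using z by simp_all
  then show "x \<in> cylinder D (u @ t)" by (simp add: conc_mem_cylinder_iff)
qed

section \<open>The equivalence relation\<close>

lemma refl_cylinder_rel: "V \<in> cylinder_G_sets D \<Longrightarrow> (V, V) \<in> cylinder_rel D"
  unfolding cylinder_rel_iff
proof (intro conjI)
  assume V: "V \<in> cylinder_G_sets D"
  then obtain w where w: "is_word D w" "arrow_source ` V = cylinder D w"
    unfolding cylinder_G_sets_iff by blast
  moreover have "V = gset_mult (sft_groupoid D) V (U_word D w w)"
    unfolding U_word_self using gset_mult_diag_right[of V "cylinder D w" D] w by simp
  ultimately show "\<exists>u w. is_word D u \<and> is_word D w \<and> word_end D u = word_end D w \<and>
      arrow_source ` V = cylinder D u \<and> arrow_source ` V = cylinder D w \<and>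
      V = gset_mult (sft_groupoid D) V (U_word D u w)" by blast
qed

lemma cylinder_relE:
  assumes "(V, V') \<in> cylinder_rel D"
  obtains u w where "is_word D u" "is_word D w" "word_end D u = word_end D w" "U_word D u w \<noteq> {}"
    "arrow_source ` V = cylinder D u" "arrow_source ` V' = cylinder D w"
    "V' = gset_mult (sft_groupoid D) V (U_word D u w)" "V \<in> cylinder_G_sets D" "V' \<in> cylinder_G_sets D"
proof -
  from assms obtain u w where *: "V \<in> cylinder_G_sets D" "V' \<in> cylinder_G_sets D"
      "is_word D u" "is_word D w" "word_end D u = word_end D w"
      "arrow_source ` V = cylinder D u" "arrow_source ` V' = cylinder D w"
      "V' = gset_mult (sft_groupoid D) V (U_word D u w)"
    unfolding cylinder_rel_iff by blast
  have ne: "cylinder D u \<noteq> {}" "cylinder D w \<noteq> {}"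
    using *(1,2,6,7) unfolding cylinder_G_sets_iff by auto
  show thesis
    by (rule that[OF *(3-5) U_word_nonempty[OF *(3-5) ne] *(6-8) *(1,2)])
qed

lemma sym_cylinder_rel:
  assumes "(V, V') \<in> cylinder_rel D"
  shows "(V', V) \<in> cylinder_rel D"
proof -
  from assms obtain u w where *: "is_word D u" "is_word D w" "word_end D u = word_end D w" "U_word D u w \<noteq> {}"
    "arrow_source ` V = cylinder D u" "arrow_source ` V' = cylinder D w"
    "V' = gset_mult (sft_groupoid D) V (U_word D u w)" "V \<in> cylinder_G_sets D" "V' \<in> cylinder_G_sets D"
    by (rule cylinder_relE)
  have "gset_mult (sft_groupoid D) V' (U_word D w u) = gset_mult (sft_groupoid D) V (U_word D u u)"
    unfolding *(7) gset_mult_assoc U_word_mult_U_word[OF *(1,2,4)] ..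
  also have "\<dots> = V"
    unfolding U_word_self using *(5) by (intro gset_mult_diag_right) simp
  finally have V_eq: "V = gset_mult (sft_groupoid D) V' (U_word D w u)" ..
  show ?thesis
    unfolding cylinder_rel_iff
    by (intro conjI exI[of _ w] exI[of _ u] *(9,8,2,1,6,5) *(3)[symmetric] V_eq)
qed

text \<open>The middle set comes with two words \<open>b\<close> and \<open>c\<close> that have the
  same cylinder but may differ. One extends the other by forced letters; appending these to the
  outer word on the other side leaves its cylinder unchanged, and the product of the two connecting
  sets becomes a single \<open>U_word D u w\<close>.\<close>

lemma trans_cylinder_rel:
  assumes "(V1, V2) \<in> cylinder_rel D" "(V2, V3) \<in> cylinder_rel D"
  shows "(V1, V3) \<in> cylinder_rel D"
proof -
  from assms(1) obtain a b where ab: "is_word D a" "is_word D b" "word_end D a = word_end D b" "U_word D a b \<noteq> {}"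
    "arrow_source ` V1 = cylinder D a" "arrow_source ` V2 = cylinder D b"
    "V2 = gset_mult (sft_groupoid D) V1 (U_word D a b)" "V1 \<in> cylinder_G_sets D" "V2 \<in> cylinder_G_sets D"
    by (rule cylinder_relE)
  from assms(2) obtain c d where cd: "is_word D c" "is_word D d" "word_end D c = word_end D d" "U_word D c d \<noteq> {}"
    "arrow_source ` V2 = cylinder D c" "arrow_source ` V3 = cylinder D d"
    "V3 = gset_mult (sft_groupoid D) V2 (U_word D c d)" "V2 \<in> cylinder_G_sets D" "V3 \<in> cylinder_G_sets D"
    by (rule cylinder_relE)
  note ne = ab(1,2)[THEN is_word_nonempty] cd(1,2)[THEN is_word_nonempty]
  have eq: "cylinder D b = cylinder D c" using ab(6) cd(5) by simp
  have "cylinder D b \<noteq> {}" using ab(6,9) unfolding cylinder_G_sets_iff by auto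
  then obtain y where "y \<in> cylinder D b" "y \<in> cylinder D c" using eq by blast
  have V3: "V3 = gset_mult (sft_groupoid D) V1 (gset_mult (sft_groupoid D) (U_word D a b) (U_word D c d))"
    unfolding cd(7) ab(7) gset_mult_assoc ..
  have "V3 \<noteq> {}" using cd(9) unfolding cylinder_G_sets_iff by blast
  have prod_ne: "gset_mult (sft_groupoid D) (U_word D a b) (U_word D c d) \<noteq> {}"
  proof
    assume "gset_mult (sft_groupoid D) (U_word D a b) (U_word D c d) = {}"
    then have "V3 = gset_mult (sft_groupoid D) V1 {}" unfolding V3 by simp
    with \<open>V3 \<noteq> {}\<close> show False by (simp add: gset_mult_sft_groupoid)
  qed
  from cylinder_comparable[OF \<open>y \<in> cylinder D b\<close> \<open>y \<in> cylinder D c\<close>]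
  obtain u w where uw: "is_word D u" "is_word D w" "cylinder D u = cylinder D a" "cylinder D w = cylinder D d"
    "gset_mult (sft_groupoid D) (U_word D a b) (U_word D c d) = U_word D u w"
  proof (elim disjE exE)
    fix t assume t: "c = b @ t"
    show thesis
    proof (rule that[of "a @ t" d])
      show "is_word D (a @ t)" using ab(1) cd(1) t by (simp add: is_word_def)
      show "cylinder D (a @ t) = cylinder D a"
        using U_word_cylinder_extend[OF ne(1,2) ab(4)] eq t by simp
      show "gset_mult (sft_groupoid D) (U_word D a b) (U_word D c d) = U_word D (a @ t) d"
        unfolding t by (rule U_word_mult_append_left[OF ne(1,2) ab(4)])
    qed (use cd in simp_all)
  next
    fix t assume t: "b = c @ t"
    have "U_word D d c \<noteq> {}" using cd(4) by (auto simp: U_word_eq)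
    show thesis
    proof (rule that[of a "d @ t"])
      show "is_word D (d @ t)" using ab(2) cd(2) t by (simp add: is_word_def)
      show "cylinder D (d @ t) = cylinder D d"
        using U_word_cylinder_extend[OF ne(4,3) \<open>U_word D d c \<noteq> {}\<close>] eq t by simp
      show "gset_mult (sft_groupoid D) (U_word D a b) (U_word D c d) = U_word D a (d @ t)"
        unfolding t by (rule U_word_mult_append_right[OF ne(4,3) cd(4)])
    qed (use ab in simp_all)
  qed
  have ends: "word_end D u = word_end D w"
    using prod_ne unfolding uw(5)
    by (rule U_word_ends(1)[OF is_word_nonempty[OF uw(1)] is_word_nonempty[OF uw(2)]])
  have "arrow_source ` V1 = cylinder D u" "arrow_source ` V3 = cylinder D w"
    using ab(5) cd(6) uw(3,4) by simp_all
  moreover have "V3 = gset_mult (sft_groupoid D) V1 (U_word D u w)"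
    using V3 unfolding uw(5) .
  ultimately show ?thesis
    unfolding cylinder_rel_iff
    by (intro conjI exI[of _ u] exI[of _ w] ab(8) cd(9) uw(1,2) ends)
qed

lemma equiv_cylinder_rel: "equiv (cylinder_G_sets D) (cylinder_rel D)"
proof (rule equivI)
  show "cylinder_rel D \<subseteq> cylinder_G_sets D \<times> cylinder_G_sets D"
    using cylinder_rel_iff by auto
  show "refl_on (cylinder_G_sets D) (cylinder_rel D)"
    using refl_cylinder_rel cylinder_rel_iff by (auto simp: refl_on_def)
  show "sym (cylinder_rel D)" using sym_cylinder_rel by (auto simp: sym_def)
  show "trans (cylinder_rel D)" using trans_cylinder_rel by (blast intro: transI)
qed

lemma cylinder_class_eq_iff:
  assumes "V \<in> cylinder_G_sets D" "V' \<in> cylinder_G_sets D"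
  shows "cylinder_class D V = cylinder_class D V' \<longleftrightarrow> (V, V') \<in> cylinder_rel D"
  unfolding cylinder_class_def using eq_equiv_class_iff[OF equiv_cylinder_rel assms] .

lemma Omega_iff: "c \<in> Omega D \<longleftrightarrow> (\<exists>V\<in>cylinder_G_sets D. c = cylinder_class D V)"
  unfolding Omega_def cylinder_class_def quotient_def by blast

lemma cylinder_class_in_Omega: "V \<in> cylinder_G_sets D \<Longrightarrow> cylinder_class D V \<in> Omega D"
  unfolding Omega_iff by blast

section \<open>The action on the quotient\<close>

lemma range_subset_sft: "V \<in> cylinder_G_sets D \<Longrightarrow> arrow_range ` V \<subseteq> sft D"
  unfolding cylinder_G_sets_iff using word_union_subset_arrows sft_arrows_endpoints(1) by fastforce

lemma source_represents_mult:
  assumes "represents (sft_groupoid D) W \<alpha>" "V \<in> cylinder_G_sets D"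
  shows "arrow_source ` gset_mult (sft_groupoid D) W V = arrow_source ` V"
  using source_gset_mult range_subset_sft[OF assms(2)] representsD(5)[OF assms(1)] by metis

lemma represents_mult_cylinder_G_sets:
  assumes "represents (sft_groupoid D) W \<alpha>" "V \<in> cylinder_G_sets D"
  shows "gset_mult (sft_groupoid D) W V \<in> cylinder_G_sets D"
proof -
  from assms(2) have V: "V \<noteq> {}" "inj_on arrow_range V" "inj_on arrow_source V" "word_union D V"
    "\<exists>w. is_word D w \<and> arrow_source ` V = cylinder D w"
    unfolding cylinder_G_sets_iff by blast+
  note W = representsD[OF assms(1)]
  have "gset_mult (sft_groupoid D) W V \<noteq> {}"
    using source_represents_mult[OF assms] V(1) by auto
  then show ?thesis
    unfolding cylinder_G_sets_iff source_represents_mult[OF assms]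
    by (intro conjI inj_on_range_gset_mult[OF W(1) V(2)] inj_on_source_gset_mult[OF W(2) V(3)]
        word_union_mult[OF W(3) V(4)] V(5))
qed

text \<open>\<open>W\<close> multiplies on the left and the relation on the right, so associativity
  suffices; full range and source of \<open>W\<close> keep the source of \<open>V\<close>.\<close>

lemma represents_mult_cylinder_rel:
  assumes "represents (sft_groupoid D) W \<alpha>" "(V, V') \<in> cylinder_rel D"
  shows "(gset_mult (sft_groupoid D) W V, gset_mult (sft_groupoid D) W V') \<in> cylinder_rel D"
proof -
  from assms(2) obtain u w where *: "is_word D u" "is_word D w" "word_end D u = word_end D w"
    "arrow_source ` V = cylinder D u" "arrow_source ` V' = cylinder D w"
    "V' = gset_mult (sft_groupoid D) V (U_word D u w)" "V \<in> cylinder_G_sets D" "V' \<in> cylinder_G_sets D"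
    by (rule cylinder_relE)
  have "gset_mult (sft_groupoid D) W V' = gset_mult (sft_groupoid D) (gset_mult (sft_groupoid D) W V) (U_word D u w)"
    unfolding gset_mult_assoc *(6) ..
  moreover have "arrow_source ` gset_mult (sft_groupoid D) W V = cylinder D u"
    "arrow_source ` gset_mult (sft_groupoid D) W V' = cylinder D w"
    using source_represents_mult[OF assms(1)] *(4,5,7,8) by simp_all
  ultimately show ?thesis
    unfolding cylinder_rel_iff
    by (intro conjI exI[of _ u] exI[of _ w] *(1-3) represents_mult_cylinder_G_sets[OF assms(1)] *(7,8))
qed

text \<open>Justifies the definite description in \<open>Omega_action\<close>: independence of the
  representative is compatibility of the relation with left multiplication, and independence of
  \<open>W\<close> is \<open>represents_unique\<close>.\<close>

lemma Omega_action_class: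
  assumes W: "represents (sft_groupoid D) W \<alpha>" and V: "V \<in> cylinder_G_sets D"
  shows "Omega_action D \<alpha> (cylinder_class D V) = cylinder_class D (gset_mult (sft_groupoid D) W V)"
proof -
  have "(THE d. \<exists>V' W'. V' \<in> cylinder_class D V \<and> represents (sft_groupoid D) W' \<alpha> \<and>
      d = cylinder_class D (gset_mult (sft_groupoid D) W' V')) = cylinder_class D (gset_mult (sft_groupoid D) W V)"
  proof (rule the_equality)
    have "V \<in> cylinder_class D V" unfolding cylinder_class_def using refl_cylinder_rel[OF V] by blast
    with W show "\<exists>V' W'. V' \<in> cylinder_class D V \<and> represents (sft_groupoid D) W' \<alpha> \<and>
      cylinder_class D (gset_mult (sft_groupoid D) W V) = cylinder_class D (gset_mult (sft_groupoid D) W' V')"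
      by blast
    fix d assume "\<exists>V' W'. V' \<in> cylinder_class D V \<and> represents (sft_groupoid D) W' \<alpha> \<and>
      d = cylinder_class D (gset_mult (sft_groupoid D) W' V')"
    then obtain V' where V': "(V, V') \<in> cylinder_rel D" and d: "d = cylinder_class D (gset_mult (sft_groupoid D) W V')"
      unfolding cylinder_class_def using represents_unique[OF W] by blast
    have "cylinder_rel D `` {gset_mult (sft_groupoid D) W V} = cylinder_rel D `` {gset_mult (sft_groupoid D) W V'}"
      by (rule equiv_class_eq[OF equiv_cylinder_rel represents_mult_cylinder_rel[OF W V']])
    then show "d = cylinder_class D (gset_mult (sft_groupoid D) W V)"
      unfolding d cylinder_class_def by simp
  qed
  then show ?thesis
    unfolding Omega_action_def using cylinder_class_in_Omega[OF V] by simp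
qed

lemma full_group_represented:
  assumes "\<alpha> \<in> carrier (full_group (sft_groupoid D))"
  obtains W where "represents (sft_groupoid D) W \<alpha>"
  using assms unfolding mem_full_group_iff by blast

lemma Omega_action_closed:
  assumes "\<alpha> \<in> carrier (full_group (sft_groupoid D))" "c \<in> Omega D"
  shows "Omega_action D \<alpha> c \<in> Omega D"
proof -
  obtain W where W: "represents (sft_groupoid D) W \<alpha>" using assms(1) by (rule full_group_represented)
  obtain V where "V \<in> cylinder_G_sets D" "c = cylinder_class D V" using assms(2) unfolding Omega_iff by blast
  then show ?thesis
    using Omega_action_class[OF W] cylinder_class_in_Omega represents_mult_cylinder_G_sets[OF W] by simp
qed

lemma Omega_action_mult:
  assumes \<alpha>: "\<alpha> \<in> carrier (full_group (sft_groupoid D))" and \<beta>: "\<beta> \<in> carrier (full_group (sft_groupoid D))"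
    and c: "c \<in> Omega D"
  shows "Omega_action D (\<alpha> \<otimes>\<^bsub>full_group (sft_groupoid D)\<^esub> \<beta>) c = Omega_action D \<alpha> (Omega_action D \<beta> c)"
proof -
  obtain W where W: "represents (sft_groupoid D) W \<alpha>" using \<alpha> by (rule full_group_represented)
  obtain W' where W': "represents (sft_groupoid D) W' \<beta>" using \<beta> by (rule full_group_represented)
  obtain V where V: "V \<in> cylinder_G_sets D" "c = cylinder_class D V" using c unfolding Omega_iff by blast
  show ?thesis
    unfolding full_group_mult[OF \<alpha> \<beta>] V(2) Omega_action_class[OF represents_mult[OF W W'] V(1)]
      Omega_action_class[OF W' V(1)] Omega_action_class[OF W represents_mult_cylinder_G_sets[OF W' V(1)]]
      gset_mult_assoc ..
qed

lemma Omega_action_one: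
  assumes c: "c \<in> Omega D"
  shows "Omega_action D \<one>\<^bsub>full_group (sft_groupoid D)\<^esub> c = c"
proof -
  obtain V where V: "V \<in> cylinder_G_sets D" "c = cylinder_class D V" using c unfolding Omega_iff by blast
  have "gset_mult (sft_groupoid D) (gunits (sft_groupoid D)) V = V"
    unfolding gunits_sft_groupoid by (rule gset_mult_diag_left[OF range_subset_sft[OF V(1)]])
  then show ?thesis
    unfolding full_group_one V(2) Omega_action_class[OF represents_one V(1)] by simp
qed

lemma group_action_Omega: "group_action (full_group (sft_groupoid D)) (Omega D) (Omega_action D)"
proof -
  interpret group "full_group (sft_groupoid D)" by (rule group_full_group)
  have Bij: "Omega_action D \<alpha> \<in> Bij (Omega D)" if \<alpha>: "\<alpha> \<in> carrier (full_group (sft_groupoid D))" for \<alpha>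
  proof -
    have "bij_betw (Omega_action D \<alpha>) (Omega D) (Omega D)"
    proof (rule bij_betw_byWitness[where f' = "Omega_action D (inv\<^bsub>full_group (sft_groupoid D)\<^esub> \<alpha>)"])
      show "\<forall>c\<in>Omega D. Omega_action D (inv\<^bsub>full_group (sft_groupoid D)\<^esub> \<alpha>) (Omega_action D \<alpha> c) = c"
        using \<alpha> by (simp add: Omega_action_one flip: Omega_action_mult)
      show "\<forall>c\<in>Omega D. Omega_action D \<alpha> (Omega_action D (inv\<^bsub>full_group (sft_groupoid D)\<^esub> \<alpha>) c) = c"
        using \<alpha> by (simp add: Omega_action_one flip: Omega_action_mult)
    qed (use \<alpha> Omega_action_closed in auto)
    moreover have "Omega_action D \<alpha> \<in> extensional (Omega D)" by (simp add: Omega_action_def)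
    ultimately show ?thesis by (simp add: Bij_def)
  qed
  show ?thesis
  proof (intro group_action.intro group_hom.intro group_BijGroup group_hom_axioms.intro homI)
    show "Group.group (full_group (sft_groupoid D))" by (rule group_full_group)
    show "Omega_action D \<alpha> \<in> carrier (BijGroup (Omega D))" if "\<alpha> \<in> carrier (full_group (sft_groupoid D))" for \<alpha>
      using Bij[OF that] by (simp add: BijGroup_def)
    show "Omega_action D (\<alpha> \<otimes>\<^bsub>full_group (sft_groupoid D)\<^esub> \<beta>) =
        Omega_action D \<alpha> \<otimes>\<^bsub>BijGroup (Omega D)\<^esub> Omega_action D \<beta>"
      if "\<alpha> \<in> carrier (full_group (sft_groupoid D))" "\<beta> \<in> carrier (full_group (sft_groupoid D))" for \<alpha> \<beta>
    proof -
      have "Omega_action D (\<alpha> \<otimes>\<^bsub>full_group (sft_groupoid D)\<^esub> \<beta>) = compose (Omega D) (Omega_action D \<alpha>) (Omega_action D \<beta>)"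
        by (rule extensionalityI[of _ "Omega D"])
          (simp_all add: Omega_action_def[of D "\<alpha> \<otimes>\<^bsub>full_group (sft_groupoid D)\<^esub> \<beta>"] compose_eq flip: Omega_action_mult[OF that])
      then show ?thesis using Bij[OF that(1)] Bij[OF that(2)] by (simp add: BijGroup_def)
    qed
  qed
qed

text \<open>Allows functions on the classes to be treated as sequences. There are countably many
  words, hence countably many finite unions of the basic sets.\<close>

lemma countable_Omega: "countable (Omega D)"
proof -
  have "countable (Collect (is_word D))"
    by (rule countable_subset[of _ "lists (arcs D)"]) (auto simp: is_word_def countable_finite)
  then have "countable {F. finite F \<and> F \<subseteq> Collect (is_word D) \<times> Collect (is_word D)}"
    by (intro countable_Collect_finite_subset countable_SIGMA) auto
  then have "countable ((\<lambda>F. \<Union>(u, w)\<in>F. U_word D u w) ` {F. finite F \<and> F \<subseteq> Collect (is_word D) \<times> Collect (is_word D)})"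
    by (rule countable_image)
  moreover have "cylinder_G_sets D \<subseteq> (\<lambda>F. \<Union>(u, w)\<in>F. U_word D u w) ` {F. finite F \<and> F \<subseteq> Collect (is_word D) \<times> Collect (is_word D)}"
  proof
    fix V assume "V \<in> cylinder_G_sets D"
    then have "word_union D V" unfolding cylinder_G_sets_iff by blast
    then obtain F where "finite F" "F \<subseteq> Collect (is_word D) \<times> Collect (is_word D)"
      "V = (\<Union>(u, w)\<in>F. U_word D u w)" by (rule word_unionE)
    then show "V \<in> (\<lambda>F. \<Union>(u, w)\<in>F. U_word D u w) `
        {F. finite F \<and> F \<subseteq> Collect (is_word D) \<times> Collect (is_word D)}"
      by (intro image_eqI[of _ _ F] CollectI conjI)
  qed
  ultimately have "countable (cylinder_G_sets D)" by (rule countable_subset[rotated])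
  moreover have "Omega D = cylinder_class D ` cylinder_G_sets D" by (auto simp: Omega_iff)
  ultimately show ?thesis by simp
qed

end

section \<open>The zipper\<close>

context irreducible_sft
begin

text \<open>Inadmissible words satisfy \<open>is_word\<close> but have empty cylinders, whose sets
  of units have no class; the second condition removes them.\<close>

definition zipper_set :: "'e sft_arrow set set set" where
  "zipper_set = (\<lambda>w. cylinder_class D (sft_unit ` cylinder D w)) ` {w. is_word D w \<and> cylinder D w \<noteq> {}}"

lemma arrow_sft_unit [simp]: "arrow_source (sft_unit x) = x" "arrow_range (sft_unit x) = x"
  by (simp_all add: sft_unit_def)

lemma U_word_in_cylinder_G_sets:
  assumes "is_word D u" "is_word D w" "U_word D u w \<noteq> {}"
  shows "U_word D u w \<in> cylinder_G_sets D"
  unfolding cylinder_G_sets_iff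
  using assms inj_on_U_word word_union_U_word U_word_source is_word_nonempty by metis

lemma diag_in_cylinder_G_sets:
  assumes "is_word D w" "cylinder D w \<noteq> {}"
  shows "sft_unit ` cylinder D w \<in> cylinder_G_sets D"
  using U_word_in_cylinder_G_sets[OF assms(1,1)] assms(2) unfolding U_word_self by simp

text \<open>Right multiplication by \<open>U_word D u w\<close> turns the units over the cylinder of
  \<open>u\<close> into \<open>U_word D u w\<close> itself. So membership of a class can be tested
  on any one of its representatives.\<close>

lemma mem_zipper_set_iff:
  assumes V: "V \<in> cylinder_G_sets D"
  shows "cylinder_class D V \<in> zipper_set \<longleftrightarrow> (\<exists>u w. is_word D u \<and> is_word D w \<and> V = U_word D u w)"
proof
  assume "cylinder_class D V \<in> zipper_set"
  then obtain c where c: "is_word D c" "cylinder D c \<noteq> {}"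
    "cylinder_class D V = cylinder_class D (sft_unit ` cylinder D c)"
    unfolding zipper_set_def by blast
  then have "(sft_unit ` cylinder D c, V) \<in> cylinder_rel D"
    using cylinder_class_eq_iff[OF diag_in_cylinder_G_sets[OF c(1,2)] V] by simp
  then obtain u w where uw: "is_word D u" "is_word D w" "U_word D u w \<noteq> {}"
    "arrow_source ` sft_unit ` cylinder D c = cylinder D u"
    "V = gset_mult (sft_groupoid D) (sft_unit ` cylinder D c) (U_word D u w)"
    by (elim cylinder_relE)
  have "arrow_range ` U_word D u w \<subseteq> cylinder D c"
    using uw(4) U_word_range[OF is_word_nonempty[OF uw(1)] is_word_nonempty[OF uw(2)] uw(3)]
    by (simp add: image_image)
  then have "V = U_word D u w" unfolding uw(5) by (rule gset_mult_diag_left)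
  then show "\<exists>u w. is_word D u \<and> is_word D w \<and> V = U_word D u w" using uw by blast
next
  assume "\<exists>u w. is_word D u \<and> is_word D w \<and> V = U_word D u w"
  then obtain u w where uw: "is_word D u" "is_word D w" "V = U_word D u w" by blast
  note ne = is_word_nonempty[OF uw(1)] is_word_nonempty[OF uw(2)]
  have V_ne: "U_word D u w \<noteq> {}" using V uw(3) unfolding cylinder_G_sets_iff by blast
  have u: "cylinder D u \<noteq> {}" using U_word_range[OF ne V_ne] V_ne by auto
  have "(sft_unit ` cylinder D u, V) \<in> cylinder_rel D"
    unfolding cylinder_rel_iff
  proof (intro conjI exI)
    show "V = gset_mult (sft_groupoid D) (sft_unit ` cylinder D u) (U_word D u w)"
      unfolding uw(3) using U_word_range[OF ne V_ne] by (intro gset_mult_diag_left[symmetric]) simp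
    show "arrow_source ` V = cylinder D w" unfolding uw(3) by (rule U_word_source[OF ne V_ne])
  qed (use uw V diag_in_cylinder_G_sets[OF uw(1) u] U_word_ends(1)[OF ne V_ne] in \<open>simp_all add: image_image\<close>)
  then have "cylinder_class D V = cylinder_class D (sft_unit ` cylinder D u)"
    using cylinder_class_eq_iff[OF diag_in_cylinder_G_sets[OF uw(1) u] V] by simp
  then show "cylinder_class D V \<in> zipper_set" unfolding zipper_set_def using uw(1) u by blast
qed

lemma zipper_set_subset_Omega: "zipper_set \<subseteq> Omega D"
  unfolding zipper_set_def using diag_in_cylinder_G_sets cylinder_class_in_Omega by blast

text \<open>Right multiplication within a class does not change the range, and the range of a set of
  units is its cylinder. Distinct cylinders thus give distinct classes to be counted.\<close>

lemma diag_class_inj: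
  assumes w: "is_word D w" "cylinder D w \<noteq> {}" and w': "is_word D w'" "cylinder D w' \<noteq> {}"
    and eq: "cylinder_class D (sft_unit ` cylinder D w) = cylinder_class D (sft_unit ` cylinder D w')"
  shows "cylinder D w = cylinder D w'"
proof -
  have "(sft_unit ` cylinder D w, sft_unit ` cylinder D w') \<in> cylinder_rel D"
    using cylinder_class_eq_iff[OF diag_in_cylinder_G_sets[OF w] diag_in_cylinder_G_sets[OF w']] eq by simp
  then obtain a b where ab: "is_word D a" "is_word D b" "U_word D a b \<noteq> {}"
    "arrow_source ` sft_unit ` cylinder D w = cylinder D a"
    "sft_unit ` cylinder D w' = gset_mult (sft_groupoid D) (sft_unit ` cylinder D w) (U_word D a b)"
    by (elim cylinder_relE)
  have a: "cylinder D w = cylinder D a" using ab(4) by (simp add: image_image)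
  have r: "arrow_range ` U_word D a b = cylinder D a"
    using ab(1-3) by (intro U_word_range is_word_nonempty)
  have "sft_unit ` cylinder D w' = U_word D a b"
    unfolding ab(5) a using r by (intro gset_mult_diag_left) simp
  then have "arrow_range ` sft_unit ` cylinder D w' = cylinder D a" using r by simp
  then show ?thesis using a by (simp add: image_image)
qed

section \<open>Finiteness of the defect\<close>

lemma Omega_action_diag:
  assumes "represents (sft_groupoid D) W \<alpha>" "is_word D w" "cylinder D w \<noteq> {}"
  shows "Omega_action D \<alpha> (cylinder_class D (sft_unit ` cylinder D w)) =
      cylinder_class D (gset_mult (sft_groupoid D) W (sft_unit ` cylinder D w))"
    and "gset_mult (sft_groupoid D) W (sft_unit ` cylinder D w) \<in> cylinder_G_sets D"
    and "arrow_source ` gset_mult (sft_groupoid D) W (sft_unit ` cylinder D w) = cylinder D w"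
    and "gset_mult (sft_groupoid D) W (sft_unit ` cylinder D w) \<subseteq> W"
proof -
  note diag = diag_in_cylinder_G_sets[OF assms(2,3)]
  show "Omega_action D \<alpha> (cylinder_class D (sft_unit ` cylinder D w)) =
      cylinder_class D (gset_mult (sft_groupoid D) W (sft_unit ` cylinder D w))"
    by (rule Omega_action_class[OF assms(1) diag])
  show "gset_mult (sft_groupoid D) W (sft_unit ` cylinder D w) \<in> cylinder_G_sets D"
    by (rule represents_mult_cylinder_G_sets[OF assms(1) diag])
  show "arrow_source ` gset_mult (sft_groupoid D) W (sft_unit ` cylinder D w) = cylinder D w"
    using source_represents_mult[OF assms(1) diag] by (simp add: image_image)
  show "gset_mult (sft_groupoid D) W (sft_unit ` cylinder D w) \<subseteq> W"
    by (rule arrow_subsetI) (auto simp: sft_unit_def elim!: gset_multE)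
qed

lemma long_word_mult_U_word:
  assumes W: "represents (sft_groupoid D) W \<alpha>"
  obtains L where "\<And>w. is_word D w \<Longrightarrow> cylinder D w \<noteq> {} \<Longrightarrow> L \<le> length w \<Longrightarrow>
    cylinder_class D (gset_mult (sft_groupoid D) W (sft_unit ` cylinder D w)) \<in> zipper_set"
proof -
  note R = representsD[OF W]
  obtain F where F: "finite F" "F \<subseteq> Collect (is_word D) \<times> Collect (is_word D)"
    "W = (\<Union>(u, w)\<in>F. U_word D u w)"
    using R(3) by (rule word_unionE)
  \<comment> \<open>The sum bounds the lengths of all source words in the finite cover of
    \<open>W\<close>.\<close>
  define L where "L = (\<Sum>p\<in>F. length (snd p))"
  have L: "length b \<le> L" if "(a, b) \<in> F" for a b
    using member_le_sum[OF that, of "\<lambda>p. length (snd p)"] F(1) by (simp add: L_def)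
  have "cylinder_class D (gset_mult (sft_groupoid D) W (sft_unit ` cylinder D w)) \<in> zipper_set"
    if w: "is_word D w" "cylinder D w \<noteq> {}" "L \<le> length w" for w
  proof -
    let ?V = "gset_mult (sft_groupoid D) W (sft_unit ` cylinder D w)"
    note V = Omega_action_diag[OF W w(1,2)]
    obtain y where y: "y \<in> cylinder D w" using w(2) by blast
    then have "y \<in> arrow_source ` W" using R(5) cylinder_subset_sft by blast
    then obtain x n where "(x, n, y) \<in> W" by auto
    then obtain a b where ab: "(a, b) \<in> F" "(x, n, y) \<in> U_word D a b" unfolding F(3) by blast
    have words: "is_word D a" "is_word D b" using F(2) ab(1) by blast+
    have ne: "U_word D a b \<noteq> {}" using ab(2) by blast
    have "y \<in> cylinder D b" using ab(2) by (auto simp: U_word_def)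
    moreover have "length b \<le> length w" using L[OF ab(1)] w(3) by simp
    ultimately obtain t where t: "w = b @ t"
      using cylinder_comparable[OF _ y] by (metis append.right_neutral append_eq_append_conv le_antisym length_append le_add1)
    have eq: "gset_mult (sft_groupoid D) (U_word D a b) (sft_unit ` cylinder D w) = U_word D (a @ t) w"
      unfolding U_word_self[symmetric] t
      by (rule U_word_mult_append_left[OF is_word_nonempty[OF words(1)] is_word_nonempty[OF words(2)] ne])
    have sub: "U_word D (a @ t) w \<subseteq> ?V"
      unfolding eq[symmetric] using ab(1) F(3) by (intro gset_mult_mono) auto
    have word: "is_word D (a @ t)" using words(1) w(1) t by (simp add: is_word_def)
    have "(a @ t) \<frown> z \<in> sft D" if "w \<frown> z \<in> sft D" for z
      using that U_word_ends(2)[OF is_word_nonempty[OF words(1)] is_word_nonempty[OF words(2)] ne, of "t \<frown> z"]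
      unfolding t by simp
    then have "U_word D (a @ t) w \<noteq> {}"
      using y by (auto simp: U_word_eq elim!: mem_cylinderE)
    then have "arrow_source ` U_word D (a @ t) w = cylinder D w"
      by (intro U_word_source is_word_nonempty[OF word] is_word_nonempty[OF w(1)])
    \<comment> \<open>One piece of the cover already has the whole cylinder as its source, so by
      injectivity it is the entire product.\<close>
    then have "U_word D (a @ t) w = ?V"
      using V(2,3) by (intro arrow_set_eqI[OF sub]) (auto simp: cylinder_G_sets_iff)
    then show ?thesis
      unfolding mem_zipper_set_iff[OF V(2)] using word w(1) by metis
  qed
  with that show thesis by blast
qed

lemma finite_words_length_le: "finite {w. is_word D w \<and> length w \<le> n}"
  by (rule finite_subset[OF _ finite_lists_length_le[OF finite_arcs, of n]]) (auto simp: is_word_def)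

lemma finite_zipper_diff:
  assumes "\<alpha> \<in> carrier (full_group (sft_groupoid D))"
  shows "finite (Omega_action D \<alpha> ` zipper_set - zipper_set)"
proof -
  obtain W where W: "represents (sft_groupoid D) W \<alpha>" using assms by (rule full_group_represented)
  obtain L where L: "\<And>w. is_word D w \<Longrightarrow> cylinder D w \<noteq> {} \<Longrightarrow> L \<le> length w \<Longrightarrow>
    cylinder_class D (gset_mult (sft_groupoid D) W (sft_unit ` cylinder D w)) \<in> zipper_set"
    by (rule long_word_mult_U_word[OF W]) (rule that; blast)
  have "Omega_action D \<alpha> ` zipper_set - zipper_set \<subseteq>
    (\<lambda>w. cylinder_class D (gset_mult (sft_groupoid D) W (sft_unit ` cylinder D w))) ` {w. is_word D w \<and> length w \<le> L}"
  proof
    fix c assume c: "c \<in> Omega_action D \<alpha> ` zipper_set - zipper_set"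
    then obtain w where w: "is_word D w" "cylinder D w \<noteq> {}"
      "c = cylinder_class D (gset_mult (sft_groupoid D) W (sft_unit ` cylinder D w))"
      unfolding zipper_set_def using Omega_action_diag(1)[OF W] by auto
    with L c have "length w \<le> L" by (metis DiffD2 nat_le_linear)
    with w show "c \<in> (\<lambda>w. cylinder_class D (gset_mult (sft_groupoid D) W (sft_unit ` cylinder D w))) `
        {w. is_word D w \<and> length w \<le> L}" by blast
  qed
  then show ?thesis using finite_words_length_le by (meson finite_imageI finite_subset)
qed

text \<open>The bijection given by \<alpha> carries the defect of the inverse onto the defect of
  \<alpha>, with the two halves exchanged.\<close>

lemma card_sym_diff_inverse:
  assumes \<alpha>: "\<alpha> \<in> carrier (full_group (sft_groupoid D))"
  shows "card (sym_diff (Omega_action D (inv\<^bsub>full_group (sft_groupoid D)\<^esub> \<alpha>) ` zipper_set) zipper_set)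
     = card (sym_diff (Omega_action D \<alpha> ` zipper_set) zipper_set)"
    (is "card (sym_diff (?g ` ?Z) ?Z) = card (sym_diff (?f ` ?Z) ?Z)")
proof -
  interpret group_action "full_group (sft_groupoid D)" "Omega D" "Omega_action D"
    by (rule group_action_Omega)
  interpret group "full_group (sft_groupoid D)" by (rule group_full_group)
  note Z = zipper_set_subset_Omega
  have inj: "inj_on ?f (Omega D)" by (rule inj_prop[OF \<alpha>])
  have fg: "?f (?g c) = c" if "c \<in> Omega D" for c
    using that \<alpha> by (simp add: Omega_action_one flip: Omega_action_mult)
  have gZ: "?g ` ?Z \<subseteq> Omega D" using Z \<alpha> Omega_action_closed by blast
  have fgZ: "?f ` ?g ` ?Z = ?Z"
    using fg Z by (force simp: image_image)
  have 1: "?f ` (?g ` ?Z - ?Z) = ?f ` ?g ` ?Z - ?f ` ?Z"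
    using Z gZ by (intro inj_on_image_set_diff[OF inj]) auto
  have 2: "?f ` (?Z - ?g ` ?Z) = ?f ` ?Z - ?f ` ?g ` ?Z"
    using Z gZ by (intro inj_on_image_set_diff[OF inj]) auto
  have eq: "?f ` sym_diff (?g ` ?Z) ?Z = sym_diff (?f ` ?Z) ?Z"
    unfolding image_Un 1 2 fgZ by (rule Un_commute)
  have "inj_on ?f (sym_diff (?g ` ?Z) ?Z)"
    using Z gZ by (intro inj_on_subset[OF inj]) auto
  then show "card (sym_diff (?g ` ?Z) ?Z) = card (sym_diff (?f ` ?Z) ?Z)"
    unfolding eq[symmetric] by (rule card_image[symmetric])
qed

text \<open>\<open>finite_zipper_diff\<close> controls the classes moved out of the zipper set. A
  class of the zipper set outside its image under \<alpha> is the image under \<alpha> of a class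
  moved out by the inverse, so the other half follows.\<close>

lemma finite_zipper_sym_diff:
  assumes \<alpha>: "\<alpha> \<in> carrier (full_group (sft_groupoid D))"
  shows "finite (sym_diff (Omega_action D \<alpha> ` zipper_set) zipper_set)"
proof -
  interpret group_action "full_group (sft_groupoid D)" "Omega D" "Omega_action D"
    by (rule group_action_Omega)
  interpret group "full_group (sft_groupoid D)" by (rule group_full_group)
  let ?f = "Omega_action D \<alpha>" and ?g = "Omega_action D (inv\<^bsub>full_group (sft_groupoid D)\<^esub> \<alpha>)"
  have fg: "?f (?g c) = c" if "c \<in> Omega D" for c
    using that \<alpha> by (simp add: Omega_action_one flip: Omega_action_mult)
  have "zipper_set - ?f ` zipper_set \<subseteq> ?f ` (?g ` zipper_set - zipper_set)"
  proof
    fix c assume c: "c \<in> zipper_set - ?f ` zipper_set"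
    then have "?f (?g c) = c" using fg zipper_set_subset_Omega by blast
    moreover from this have "?g c \<notin> zipper_set" using c by force
    ultimately show "c \<in> ?f ` (?g ` zipper_set - zipper_set)" using c by force
  qed
  moreover have "finite (?f ` (?g ` zipper_set - zipper_set))"
    using finite_zipper_diff \<alpha> by simp
  ultimately have "finite (zipper_set - ?f ` zipper_set)" by (rule finite_subset)
  then show ?thesis using finite_zipper_diff[OF \<alpha>] by simp
qed

text \<open>The bound is chosen from \<open>R\<close> alone, before the group element and the arrow.
  It is \<open>L + N\<close>: more than \<open>R\<close> distinct cylinders occur among the first
  \<open>L\<close> prefixes of any point, and \<open>N\<close> bounds forced extensions.\<close>

lemma short_defect:
  obtains K where "\<And>\<alpha> W x n y. \<alpha> \<in> carrier (full_group (sft_groupoid D)) \<Longrightarrow>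
    represents (sft_groupoid D) W \<alpha> \<Longrightarrow>
    card (sym_diff (Omega_action D \<alpha> ` zipper_set) zipper_set) \<le> R \<Longrightarrow> (x, n, y) \<in> W \<Longrightarrow>
    \<exists>a b. is_word D a \<and> is_word D b \<and> length b \<le> K \<and> (x, n, y) \<in> U_word D a b \<and> U_word D a b \<subseteq> W"
proof -
  obtain L where L: "L \<ge> 1"
    "\<And>x k. x \<in> sft D \<Longrightarrow> k \<ge> L \<Longrightarrow> card ((\<lambda>j. cylinder D (prefix j x)) ` {1..k}) > R"
    by (rule cylinder_chain[of R]) (rule that; blast)
  obtain N where N: "\<And>w t. w \<noteq> [] \<Longrightarrow> cylinder D w \<noteq> {} \<Longrightarrow> cylinder D (w @ t) = cylinder D w \<Longrightarrow> length t \<le> N"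
    by (rule forced_extension_bound) (rule that; blast)
  have "\<exists>a b. is_word D a \<and> is_word D b \<and> length b \<le> L + N \<and> (x, n, y) \<in> U_word D a b \<and> U_word D a b \<subseteq> W"
    if \<alpha>: "\<alpha> \<in> carrier (full_group (sft_groupoid D))" and W: "represents (sft_groupoid D) W \<alpha>"
      and card: "card (sym_diff (Omega_action D \<alpha> ` zipper_set) zipper_set) \<le> R"
      and xy: "(x, n, y) \<in> W" for \<alpha> W x n y
  proof -
    have y: "y \<in> sft D" using xy representsD(4)[OF W] sft_arrows_endpoints(2) by blast
    define V where "V = (\<lambda>j. gset_mult (sft_groupoid D) W (sft_unit ` cylinder D (prefix j y)))"
    have word: "is_word D (prefix j y)" "cylinder D (prefix j y) \<noteq> {}" if "j \<ge> 1" for j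
      using that is_word_prefix[OF y, of j] prefix_mem_cylinder[OF y] by auto
    have V: "Omega_action D \<alpha> (cylinder_class D (sft_unit ` cylinder D (prefix j y))) = cylinder_class D (V j)"
      "V j \<in> cylinder_G_sets D" "arrow_source ` V j = cylinder D (prefix j y)" "V j \<subseteq> W" if "j \<ge> 1" for j
      using Omega_action_diag[OF W word[OF that]] unfolding V_def by blast+
    have "cylinder_class D (V L) \<in> zipper_set"
    proof (rule ccontr)
      assume L_notin: "cylinder_class D (V L) \<notin> zipper_set"
      \<comment> \<open>If some \<open>V j\<close> were a single \<open>U_word D u w\<close>, then
        so would be its restriction \<open>V L\<close> to a smaller cylinder.\<close>
      have notin: "cylinder_class D (V j) \<notin> zipper_set" if j: "j \<in> {1..L}" for j
      proof
        assume "cylinder_class D (V j) \<in> zipper_set"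
        then obtain u w where uw: "is_word D u" "is_word D w" "V j = U_word D u w"
          using mem_zipper_set_iff[OF V(2)[of j]] j by auto
        have "prefix L y = prefix j y @ subsequence y j L"
          using subsequence_append[of y j "L - j"] j by simp
        then have sub: "cylinder D (prefix L y) \<subseteq> cylinder D (prefix j y)"
          using cylinder_append_subset by metis
        have "V L = gset_mult (sft_groupoid D) W
            (gset_mult (sft_groupoid D) (sft_unit ` cylinder D (prefix j y)) (sft_unit ` cylinder D (prefix L y)))"
          unfolding V_def using sub by (subst gset_mult_diag_left) (simp_all add: image_image)
        also have "\<dots> = gset_mult (sft_groupoid D) (U_word D u w) (U_word D (prefix L y) (prefix L y))"
          unfolding gset_mult_assoc[symmetric] uw(3)[symmetric] V_def U_word_self ..
        finally have VL: "V L = gset_mult (sft_groupoid D) (U_word D u w) (U_word D (prefix L y) (prefix L y))" .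
        have "V L \<noteq> {}" using V(2)[OF L(1)] unfolding cylinder_G_sets_iff by blast
        then obtain e f where "is_word D e" "is_word D f" "V L = U_word D e f"
          using U_word_mult_cases[OF uw(1,2) word(1)[OF L(1)] word(1)[OF L(1)]] unfolding VL by metis
        then have "cylinder_class D (V L) \<in> zipper_set"
          unfolding mem_zipper_set_iff[OF V(2)[OF L(1)]] by blast
        with L_notin show False ..
      qed
      let ?C = "(\<lambda>j. cylinder D (prefix j y)) ` {1..L}"
      let ?f = "\<lambda>A. Omega_action D \<alpha> (cylinder_class D (sft_unit ` A))"
      interpret group_action "full_group (sft_groupoid D)" "Omega D" "Omega_action D"
        by (rule group_action_Omega)
      have "inj_on ?f ?C"
      proof (rule inj_onI)
        fix A B assume "A \<in> ?C" "B \<in> ?C" and eq: "?f A = ?f B"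
        then obtain i j where ij: "i \<ge> 1" "j \<ge> 1" "A = cylinder D (prefix i y)" "B = cylinder D (prefix j y)"
          by auto
        have "cylinder_class D (sft_unit ` A) \<in> Omega D" "cylinder_class D (sft_unit ` B) \<in> Omega D"
          using ij word by (auto intro!: cylinder_class_in_Omega diag_in_cylinder_G_sets)
        with eq have "cylinder_class D (sft_unit ` A) = cylinder_class D (sft_unit ` B)"
          using inj_onD[OF inj_prop[OF \<alpha>]] by blast
        then show "A = B" unfolding ij(3,4) by (rule diag_class_inj[OF word[OF ij(1)] word[OF ij(2)]])
      qed
      \<comment> \<open>Distinct cylinders have distinct classes, and \<alpha> acts injectively, so
        all these cylinders count towards the defect; there are more than \<open>R\<close> of
        them.\<close>
      then have "card ?C = card (?f ` ?C)" by (simp add: card_image)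
      also have "\<dots> \<le> card (sym_diff (Omega_action D \<alpha> ` zipper_set) zipper_set)"
      proof (rule card_mono[OF finite_zipper_sym_diff[OF \<alpha>]])
        have "?f (cylinder D (prefix j y)) \<in> Omega_action D \<alpha> ` zipper_set - zipper_set" if j: "j \<in> {1..L}" for j
        proof
          have j1: "j \<ge> 1" using j by simp
          show "?f (cylinder D (prefix j y)) \<in> Omega_action D \<alpha> ` zipper_set"
            unfolding zipper_set_def using word[OF j1] by blast
          show "?f (cylinder D (prefix j y)) \<notin> zipper_set"
            unfolding V(1)[OF j1] by (rule notin[OF j])
        qed
        then show "?f ` ?C \<subseteq> sym_diff (Omega_action D \<alpha> ` zipper_set) zipper_set"
          unfolding image_image by (intro image_subsetI UnI1)
      qed
      finally show False using card L(2)[OF y order_refl] by simp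
    qed
    then obtain a b where ab: "is_word D a" "is_word D b" "V L = U_word D a b"
      using mem_zipper_set_iff[OF V(2)[OF L(1)]] L(1) by auto
    have V_ne: "U_word D a b \<noteq> {}" using V(2)[OF L(1)] ab(3) unfolding cylinder_G_sets_iff by auto
    have src: "cylinder D b = cylinder D (prefix L y)"
      using V(3)[OF L(1)] U_word_source[OF is_word_nonempty[OF ab(1)] is_word_nonempty[OF ab(2)] V_ne] L(1)
      unfolding ab(3) by simp
    have yb: "y \<in> cylinder D b" "y \<in> cylinder D (prefix L y)"
      unfolding src using prefix_mem_cylinder[OF y] by blast+
    \<comment> \<open>Only the cylinder of \<open>b\<close> is known, not the word. If
      \<open>b\<close> is longer than the prefix of length \<open>L\<close>, its surplus is forced
      and has at most \<open>N\<close> letters.\<close>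
    have "length b \<le> L + N"
      using cylinder_comparable[OF yb]
    proof (elim disjE exE)
      fix t assume t: "prefix L y = b @ t"
      from arg_cong[OF t, of length] show ?thesis by simp
    next
      fix t assume t: "b = prefix L y @ t"
      have "length t \<le> N"
        using N[of "prefix L y" t] src t word(2)[OF L(1)] L(1) by simp
      then show ?thesis using t by simp
    qed
    moreover have "(x, n, y) \<in> V L"
      unfolding V_def using xy yb(2) by (auto simp: sft_unit_def intro!: gset_multI)
    moreover have "V L \<subseteq> W" using V(4)[OF L(1)] .
    ultimately show ?thesis using ab by metis
  qed
  with that show thesis by blast
qed

text \<open>An element is recovered from its set \<open>W\<close> by \<open>gset_map\<close>, and
  \<open>W\<close> is the union of the basic sets it contains from a finite stock depending on
  \<open>R\<close> only.\<close>

lemma finite_small_defect: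
  "finite {\<alpha> \<in> carrier (full_group (sft_groupoid D)).
     card (sym_diff (Omega_action D \<alpha> ` zipper_set) zipper_set) \<le> R}" (is "finite ?A")
proof -
  interpret group "full_group (sft_groupoid D)" by (rule group_full_group)
  obtain K where K: "\<And>\<alpha> W x n y. \<alpha> \<in> carrier (full_group (sft_groupoid D)) \<Longrightarrow>
    represents (sft_groupoid D) W \<alpha> \<Longrightarrow>
    card (sym_diff (Omega_action D \<alpha> ` zipper_set) zipper_set) \<le> R \<Longrightarrow> (x, n, y) \<in> W \<Longrightarrow>
    \<exists>a b. is_word D a \<and> is_word D b \<and> length b \<le> K \<and> (x, n, y) \<in> U_word D a b \<and> U_word D a b \<subseteq> W"
    by (rule short_defect[of R]) (rule that; blast)
  \<comment> \<open>The bound for the inverse limits the source word \<open>d\<close> of the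
    reversed arrow, so its integer component gives \<open>n \<le> length d \<le> K\<close>; then
    \<open>length a = n + length b\<close> is at most \<open>2 * K\<close>.\<close>
  define P where "P = {a. is_word D a \<and> length a \<le> 2 * K} \<times> {b. is_word D b \<and> length b \<le> K}"
  have P: "finite P" unfolding P_def using finite_words_length_le by blast
  have "?A \<subseteq> (\<lambda>F. gset_map (sft_groupoid D) (\<Union>(a, b)\<in>F. U_word D a b)) ` Pow P"
  proof
    fix \<alpha> assume "\<alpha> \<in> ?A"
    then have \<alpha>: "\<alpha> \<in> carrier (full_group (sft_groupoid D))"
      and card: "card (sym_diff (Omega_action D \<alpha> ` zipper_set) zipper_set) \<le> R" by auto
    obtain W where W: "represents (sft_groupoid D) W \<alpha>" using \<alpha> by (rule full_group_represented)
    define F where "F = {p \<in> P. case_prod (U_word D) p \<subseteq> W}"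
    have "W = (\<Union>(a, b)\<in>F. U_word D a b)"
    proof (intro subset_antisym arrow_subsetI)
      fix x n y assume xy: "(x, n, y) \<in> W"
      then obtain a b where ab: "is_word D a" "is_word D b" "length b \<le> K" "(x, n, y) \<in> U_word D a b" "U_word D a b \<subseteq> W"
        using K[OF \<alpha> W card] by blast
      have "(y, - n, x) \<in> ginv (sft_groupoid D) ` W" using xy by (simp add: ginv_image_mem_iff)
      then obtain c d where cd: "length d \<le> K" "(y, - n, x) \<in> U_word D c d"
        using K[OF inv_closed[OF \<alpha>] represents_full_group_inverse[OF \<alpha> W]] card
        unfolding card_sym_diff_inverse[OF \<alpha>] by blast
      have "n = int (length a) - int (length b)" "- n = int (length c) - int (length d)"
        using ab(4) cd(2) by (auto simp: U_word_def)
      then have "length a \<le> 2 * K" using ab(3) cd(1) by linarith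
      then have "(a, b) \<in> F" using ab by (simp add: F_def P_def)
      then show "(x, n, y) \<in> (\<Union>(a, b)\<in>F. U_word D a b)" using ab(4) by blast
    qed (auto simp: F_def)
    moreover have "\<alpha> = gset_map (sft_groupoid D) W" by (rule representsD(7)[OF W])
    moreover have "F \<in> Pow P" by (auto simp: F_def)
    ultimately show "\<alpha> \<in> (\<lambda>F. gset_map (sft_groupoid D) (\<Union>(a, b)\<in>F. U_word D a b)) ` Pow P" by blast
  qed
  then show ?thesis using P by (meson finite_Pow_iff finite_imageI finite_subset)
qed

lemma zipper_action_Omega:
  "zipper_action (full_group (sft_groupoid D)) (Omega D) (Omega_action D)"
  unfolding zipper_action_def
proof (intro conjI exI[of _ zipper_set] ballI allI impI)
  show "group_action (full_group (sft_groupoid D)) (Omega D) (Omega_action D)"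
    by (rule group_action_Omega)
  show "zipper_set \<subseteq> Omega D" by (rule zipper_set_subset_Omega)
  show "finite (sym_diff (Omega_action D \<alpha> ` zipper_set) zipper_set)"
    if "\<alpha> \<in> carrier (full_group (sft_groupoid D))" for \<alpha>
    using that by (rule finite_zipper_sym_diff)
  fix r :: real
  obtain R :: nat where R: "r \<le> R" using real_arch_simple by blast
  have "{\<alpha> \<in> carrier (full_group (sft_groupoid D)). real (card (sym_diff (Omega_action D \<alpha> ` zipper_set) zipper_set)) \<le> r}
    \<subseteq> {\<alpha> \<in> carrier (full_group (sft_groupoid D)). card (sym_diff (Omega_action D \<alpha> ` zipper_set) zipper_set) \<le> R}"
    using R by (auto dest: order_trans)
  then show "finite {\<alpha> \<in> carrier (full_group (sft_groupoid D)).
      real (card (sym_diff (Omega_action D \<alpha> ` zipper_set) zipper_set)) \<le> r}"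
    using finite_small_defect by (rule finite_subset)
qed

end

text \<open>The first two conjuncts secure the meaning of the others: that the classes come from an
  equivalence relation, and that the definite description in \<open>Omega_action\<close> denotes the
  class of the product for every choice of \<open>W\<close> and \<open>V\<close>.\<close>

theorem theorem6p7:
  fixes D :: "('v, 'e) pre_digraph"
  assumes "fin_digraph D"
    and "irreducible_matrix (verts D) (adjacency D)"
    and "\<not> permutation_matrix (verts D) (adjacency D)"
  shows "equiv (cylinder_G_sets D) (cylinder_rel D) \<and>
    (\<forall>\<alpha> \<in> carrier (full_group (sft_groupoid D)). \<forall>W. \<forall>V \<in> cylinder_G_sets D.
       represents (sft_groupoid D) W \<alpha> \<longrightarrow>
       Omega_action D \<alpha> (cylinder_class D V) =
         cylinder_class D (gset_mult (sft_groupoid D) W V)) \<and>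
    zipper_action (full_group (sft_groupoid D)) (Omega D) (Omega_action D) \<and>
    haagerup_property (full_group (sft_groupoid D))"
proof -
  interpret irreducible_sft D
    by (rule irreducible_sft.intro[OF assms(1)]) (unfold_locales; fact)
  show ?thesis
    using equiv_cylinder_rel Omega_action_class zipper_action_Omega
      zipper_action_imp_haagerup_property[OF zipper_action_Omega countable_Omega]
    by blast
qed

end
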